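(* Let $\{S_i\}_{i\in\mathcal{I}}$ be an IFS satisfying the weak separation condition and $\mu_{\mathbf p}$ an associated self-similar measure. Then the set of local dimensions of $\mu_{\mathbf p}$ at periodic points is dense in $\{\overline{\dim}_{\mathrm{loc}}\mu_{\mathbf p}(x):x\in K_{\mathrm{ess}}\}$ and in $\{\underline{\dim}_{\mathrm{loc}}\mu_{\mathbf p}(x):x\in K_{\mathrm{ess}}\}$; that is, each element of these two sets is a limit of local dimensions of $\mu_{\mathbf p}$ at periodic points.
   Context: IFS. An iterated function system of similarities (IFS) is a finite set of maps $S_i(x)=r_ix+d_i$ on $\mathbb{R}$, $i\in\mathcal{I}$, with $0<|r_i|<1$ and $\#\mathcal{I}\ge 2$. Its attractor $K$ is the unique non-empty compact set with $K=\bigcup_{i}S_i(K)$. Standing assumptions: $K$ is not a singleton and (normalization) the convex hull of $K$ is $[0,1]$. Given $\mathbf p=(p_i)_{i\in\mathcal I}$ with $p_i>0$, $\sum p_i=1$, the associated self-similar measure $\mu_{\mathbf p}$ is the unique Borel probability measure with $\mu_{\mathbf p}(E)=\sum_i p_i\mu_{\mathbf p}(S_i^{-1}(E))$ for all Borel $E$. $\mathcal{I}^*$ is the set of finite words; for $\sigma=(\sigma_1,\dots,\sigma_n)$, $S_\sigma=S_{\sigma_1}\circ\cdots\circ S_{\sigma_n}$, $r_\sigma=\prod r_{\sigma_k}$, and $\sigma^-$ is $\sigma$ with the last letter deleted; for the empty word $S_\emptyset=\mathrm{id}$, $r_\emptyset=1$. For $t>0$, $\Lambda_t=\{\sigma\in\mathcal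 I^*:|r_\sigma|<t\le|r_{\sigma^-}|\}$ (convention: $|r_{\emptyset^-}|=\infty$, so $\Lambda_t=\{\emptyset\}$ for $t>1$). Weak separation condition. $U(x,t)$ is the open ball of centre $x$ and radius $t$. For Borel $E$, $\mathcal{S}_t(E)=\{S_\sigma:\sigma\in\Lambda_t,\ S_\sigma(K)\cap E\ne\emptyset\}$ (a set of functions). The weak separation condition is $\sup_{x\in\mathbb{R},t>0}\#\mathcal{S}_t(U(x,t))<\infty$. Net intervals. For $t>0$ let $h_1<\dots<h_{s(t)}$ be the distinct elements of $\{S_\sigma(0),S_\sigma(1):\sigma\in\Lambda_t\}$. The net intervals of generation $t$ are the elements of $\mathcal{F}_t=\{[h_j,h_{j+1}]:1\le j<s(t),\ (h_j,h_{j+1})\cap K\ne\emptyset\}$. A net interval is always considered together with its generation. $T_\Delta(x)=rx+a$ is the map with $r>0$ and $T_\Delta([0,1])=\Delta$. The neighbour set of $\Delta\in\mathcal F_t$ is $\mathcal V(\Delta)=\mathcal{V}_t(\Delta)=\{T_\Delta^{-1}\circ S_\sigma:\sigma\in\Lambda_t,\ S_\sigma(K)\cap\Delta^\circ\neq\emptyset\}$ (a set of functions). The transition generation is $\operatorname{tg}(\Delta)=\operatorname{diam}(\Delta)\cdot\max\{|R|:(x\mapsto Rx+a)\in\mathcal V(\Delta)\}$; the children of $\Delta$ are the net intervals of generation $\operatorname{tg}(\Delta)$ contained in $\Delta$. The position index of a child $\Delta'=[a',b']$ of $\Delta=[a,b]$ is $q(\Delta,\Delta')=(a'-a)/\operatorname{diam}(\Delta)$.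 Transition graph. $\mathcal G$ is the directed graph (loops, multiple edges allowed) with vertices the distinct neighbour sets of net intervals, and with an edge $(\mathcal V(\Delta),\mathcal V(\Delta'),q(\Delta,\Delta'))$ from $\mathcal V(\Delta)$ to $\mathcal V(\Delta')$ for each net interval $\Delta$ and child $\Delta'$ of $\Delta$. A path is a sequence of consecutive edges; a cycle is a path beginning and ending at the same vertex. A symbolic representation of $x\in K$ is the infinite path $(e_i)_{i\ge1}$, $e_i=(\mathcal V(\Delta_{i-1}),\mathcal V(\Delta_i),q(\Delta_{i-1},\Delta_i))$, given by a sequence $\Delta_0=[0,1]$ (of generation $>1$), $\Delta_i$ a child of $\Delta_{i-1}$, $\{x\}=\bigcap_i\Delta_i$. A periodic point is a point $x\in K$ every symbolic representation of which has the form $(e_1,\dots,e_n,\theta,\theta,\dots)$ with $\theta$ a cycle; the local dimension of $\mu_{\mathbf p}$ exists at every periodic point. An essential class is a (non-empty) induced subgraph $\mathcal G'$ such that any two vertices $v,v'$ of $\mathcal G'$ are joined by a path from $v$ to $v'$, and any vertex of $\mathcal G$ reachable by a path from a vertex of $\mathcal G'$ is in $\mathcal G'$. Under the weak separation condition, $\mathcal G$ has a unique essential class $\mathcal G_{\mathrm{ess}}$. $K_{\mathrm{ess}}$ is the set of $x\in K$ such that every symbolic representation $(e_j)$ of $x$ has all $e_k$, $k\ge N$, edges of $\mathcal G_{\mathrm{ess}}$ for some $N$. Local dimensions. $\overline{\dim}_{\mathrm{loc}}\mu(x)$ and $\underline{\dim}_{\mathrm{loc}}\mu(x)$ are the $\limsup$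 and $\liminf$ as $t\downarrow0$ of $\log\mu(B(x,t))/\log t$, with $B(x,t)$ the closed ball; $\dim_{\mathrm{loc}}\mu(x)$ is the common value when they coincide. *)

theory Defs
  imports
    "HOL-Probability.Probability"
    "Graph_Theory.Digraph_Component"
begin

text \<open>
  An IFS of similarities \<open>S\<^sub>i(x) = r\<^sub>i x + d\<^sub>i\<close> is given by its ratios \<open>r\<close> and translations \<open>d\<close>,
  indexed by a finite type. Finite words over the index set are lists.
\<close>

definition ifs :: "('i::finite \<Rightarrow> real) \<Rightarrow> ('i \<Rightarrow> real) \<Rightarrow> bool" where
  "ifs r d \<longleftrightarrow> CARD('i) \<ge> 2 \<and> (\<forall>i. 0 < \<bar>r i\<bar> \<and> \<bar>r i\<bar> < 1)"

definition sim :: "('i \<Rightarrow> real) \<Rightarrow> ('i \<Rightarrow> real) \<Rightarrow> 'i \<Rightarrow> real \<Rightarrow> real" where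
  "sim r d i x = r i * x + d i"

definition is_attractor :: "('i::finite \<Rightarrow> real) \<Rightarrow> ('i \<Rightarrow> real) \<Rightarrow> real set \<Rightarrow> bool" where
  "is_attractor r d K \<longleftrightarrow> compact K \<and> K \<noteq> {} \<and> K = (\<Union>i. sim r d i ` K)"

definition self_similar_measure ::
  "('i::finite \<Rightarrow> real) \<Rightarrow> ('i \<Rightarrow> real) \<Rightarrow> ('i \<Rightarrow> real) \<Rightarrow> real measure \<Rightarrow> bool" where
  "self_similar_measure r d p \<mu> \<longleftrightarrow>
     prob_space \<mu> \<and> sets \<mu> = sets borel \<and>
     (\<forall>E\<in>sets borel. measure \<mu> E = (\<Sum>i\<in>UNIV. p i * measure \<mu> (sim r d i -` E)))"

definition sim_word :: "('i \<Rightarrow> real) \<Rightarrow> ('i \<Rightarrow> real) \<Rightarrow> 'i list \<Rightarrow> real \<Rightarrow> real" where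
  "sim_word r d \<sigma> = foldr (\<lambda>i f. sim r d i \<circ> f) \<sigma> id"

definition ratio_word :: "('i \<Rightarrow> real) \<Rightarrow> 'i list \<Rightarrow> real" where
  "ratio_word r \<sigma> = prod_list (map r \<sigma>)"

text \<open>
  The words \<open>\<Lambda>\<^sub>t\<close>. The guard on the empty word implements the convention that its deleted
  predecessor has infinite ratio.
\<close>
definition words_gen :: "('i \<Rightarrow> real) \<Rightarrow> real \<Rightarrow> 'i list set" where
  "words_gen r t =
     {\<sigma>. \<bar>ratio_word r \<sigma>\<bar> < t \<and> (\<sigma> \<noteq> [] \<longrightarrow> t \<le> \<bar>ratio_word r (butlast \<sigma>)\<bar>)}"

definition maps_meeting ::
  "('i \<Rightarrow> real) \<Rightarrow> ('i \<Rightarrow> real) \<Rightarrow> real set \<Rightarrow> real \<Rightarrow> real set \<Rightarrow> (real \<Rightarrow> real) set" where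
  "maps_meeting r d K t E =
     {sim_word r d \<sigma> | \<sigma>. \<sigma> \<in> words_gen r t \<and> sim_word r d \<sigma> ` K \<inter> E \<noteq> {}}"

definition weak_separation :: "('i \<Rightarrow> real) \<Rightarrow> ('i \<Rightarrow> real) \<Rightarrow> real set \<Rightarrow> bool" where
  "weak_separation r d K \<longleftrightarrow>
     (\<exists>C::nat. \<forall>x. \<forall>t>0. finite (maps_meeting r d K t (ball x t)) \<and>
                          card (maps_meeting r d K t (ball x t)) \<le> C)"

definition endpoints_gen :: "('i \<Rightarrow> real) \<Rightarrow> ('i \<Rightarrow> real) \<Rightarrow> real \<Rightarrow> real set" where
  "endpoints_gen r d t = (\<Union>\<sigma>\<in>words_gen r t. {sim_word r d \<sigma> 0, sim_word r d \<sigma> 1})"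

text \<open>
  A net interval \<open>[a, b]\<close> is always taken together with its generation \<open>t\<close>; it is represented
  by the triple \<open>(t, a, b)\<close>.
\<close>
type_synonym gen_interval = "real \<times> real \<times> real"

definition net_intervals ::
  "('i \<Rightarrow> real) \<Rightarrow> ('i \<Rightarrow> real) \<Rightarrow> real set \<Rightarrow> gen_interval set" where
  "net_intervals r d K =
     {(t, a, b). t > 0 \<and> a < b \<and> a \<in> endpoints_gen r d t \<and> b \<in> endpoints_gen r d t \<and>
        {a<..<b} \<inter> endpoints_gen r d t = {} \<and> {a<..<b} \<inter> K \<noteq> {}}"

fun ivl :: "gen_interval \<Rightarrow> real set" where
  "ivl (t, a, b) = {a..b}"

fun norm_map :: "gen_interval \<Rightarrow> real \<Rightarrow> real" where
  "norm_map (t, a, b) = (\<lambda>x. (b - a) * x + a)"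

fun nbr_set ::
  "('i \<Rightarrow> real) \<Rightarrow> ('i \<Rightarrow> real) \<Rightarrow> real set \<Rightarrow> gen_interval \<Rightarrow> (real \<Rightarrow> real) set" where
  "nbr_set r d K (t, a, b) =
     {inv (norm_map (t, a, b)) \<circ> sim_word r d \<sigma> | \<sigma>.
        \<sigma> \<in> words_gen r t \<and> sim_word r d \<sigma> ` K \<inter> {a<..<b} \<noteq> {}}"

fun trans_gen :: "('i \<Rightarrow> real) \<Rightarrow> ('i \<Rightarrow> real) \<Rightarrow> real set \<Rightarrow> gen_interval \<Rightarrow> real" where
  "trans_gen r d K (t, a, b) =
     (b - a) * Max {\<bar>R\<bar> | R c. (\<lambda>x. R * x + c) \<in> nbr_set r d K (t, a, b)}"

definition is_child ::
  "('i \<Rightarrow> real) \<Rightarrow> ('i \<Rightarrow> real) \<Rightarrow> real set \<Rightarrow> gen_interval \<Rightarrow> gen_interval \<Rightarrow> bool" where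
  "is_child r d K \<Delta> \<Delta>' \<longleftrightarrow>
     \<Delta> \<in> net_intervals r d K \<and> \<Delta>' \<in> net_intervals r d K \<and>
     fst \<Delta>' = trans_gen r d K \<Delta> \<and> ivl \<Delta>' \<subseteq> ivl \<Delta>"

fun position_index :: "gen_interval \<Rightarrow> gen_interval \<Rightarrow> real" where
  "position_index (t, a, b) (t', a', b') = (a' - a) / (b - a)"

type_synonym vertex = "(real \<Rightarrow> real) set"
type_synonym edge = "vertex \<times> vertex \<times> real"

definition edge_label ::
  "('i \<Rightarrow> real) \<Rightarrow> ('i \<Rightarrow> real) \<Rightarrow> real set \<Rightarrow> gen_interval \<Rightarrow> gen_interval \<Rightarrow> edge" where
  "edge_label r d K \<Delta> \<Delta>' = (nbr_set r d K \<Delta>, nbr_set r d K \<Delta>', position_index \<Delta> \<Delta>')"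

definition transition_graph ::
  "('i \<Rightarrow> real) \<Rightarrow> ('i \<Rightarrow> real) \<Rightarrow> real set \<Rightarrow> (vertex, edge) pre_digraph" where
  "transition_graph r d K =
     \<lparr> verts = nbr_set r d K ` net_intervals r d K,
       arcs = {edge_label r d K \<Delta> \<Delta>' | \<Delta> \<Delta>'. is_child r d K \<Delta> \<Delta>'},
       tail = (\<lambda>(v, v', q). v),
       head = (\<lambda>(v, v', q). v') \<rparr>"

text \<open>The closed walks of a digraph; repeated vertices are allowed.\<close>
definition closed_path :: "('v, 'e) pre_digraph \<Rightarrow> 'e list \<Rightarrow> bool" where
  "closed_path G \<theta> \<longleftrightarrow> \<theta> \<noteq> [] \<and> (\<exists>v. pre_digraph.awalk G v \<theta> v)"

text \<open>\<open>e n\<close> is the edge \<open>e\<^bsub>n+1\<^esub>\<close> of the symbolic representation \<open>(e\<^sub>i)\<^bsub>i\<ge>1\<^esub>\<close>.\<close>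
definition symbolic_rep ::
  "('i \<Rightarrow> real) \<Rightarrow> ('i \<Rightarrow> real) \<Rightarrow> real set \<Rightarrow> real \<Rightarrow> (nat \<Rightarrow> edge) \<Rightarrow> bool" where
  "symbolic_rep r d K x e \<longleftrightarrow>
     (\<exists>\<Delta> :: nat \<Rightarrow> gen_interval.
        (\<exists>t>1. \<Delta> 0 = (t, 0, 1)) \<and>
        (\<forall>n. is_child r d K (\<Delta> n) (\<Delta> (Suc n))) \<and>
        (\<Inter>n. ivl (\<Delta> n)) = {x} \<and>
        (\<forall>n. e n = edge_label r d K (\<Delta> n) (\<Delta> (Suc n))))"

definition periodic_points ::
  "('i \<Rightarrow> real) \<Rightarrow> ('i \<Rightarrow> real) \<Rightarrow> real set \<Rightarrow> real set" where
  "periodic_points r d K =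
     {x \<in> K. \<forall>e. symbolic_rep r d K x e \<longrightarrow>
        (\<exists>n \<theta>. closed_path (transition_graph r d K) \<theta> \<and>
               (\<forall>k. e (n + k) = \<theta> ! (k mod length \<theta>)))}"

text \<open>
  Reachability in the library is reflexive. For the transition graph this agrees with joining
  vertices by nonempty paths, since every net interval has a child.
\<close>
definition essential_class :: "('v, 'e) pre_digraph \<Rightarrow> ('v, 'e) pre_digraph \<Rightarrow> bool" where
  "essential_class G H \<longleftrightarrow>
     induced_subgraph H G \<and> strongly_connected H \<and>
     (\<forall>v\<in>verts H. \<forall>w. v \<rightarrow>\<^sup>*\<^bsub>G\<^esub> w \<longrightarrow> w \<in> verts H)"

text \<open>Only meaningful when the essential class is unique, as under the weak separation condition.\<close>
definition ess_graph ::
  "('i \<Rightarrow> real) \<Rightarrow> ('i \<Rightarrow> real) \<Rightarrow> real set \<Rightarrow> (vertex, edge) pre_digraph" where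
  "ess_graph r d K = (THE H. essential_class (transition_graph r d K) H)"

definition K_ess :: "('i \<Rightarrow> real) \<Rightarrow> ('i \<Rightarrow> real) \<Rightarrow> real set \<Rightarrow> real set" where
  "K_ess r d K =
     {x \<in> K. \<forall>e. symbolic_rep r d K x e \<longrightarrow> (\<exists>N. \<forall>k\<ge>N. e k \<in> arcs (ess_graph r d K))}"

definition upper_local_dim :: "real measure \<Rightarrow> real \<Rightarrow> ereal" where
  "upper_local_dim \<mu> x = Limsup (at_right 0) (\<lambda>t. ereal (ln (measure \<mu> (cball x t)) / ln t))"

definition lower_local_dim :: "real measure \<Rightarrow> real \<Rightarrow> ereal" where
  "lower_local_dim \<mu> x = Liminf (at_right 0) (\<lambda>t. ereal (ln (measure \<mu> (cball x t)) / ln t))"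

definition has_local_dim :: "real measure \<Rightarrow> real \<Rightarrow> ereal \<Rightarrow> bool" where
  "has_local_dim \<mu> x s \<longleftrightarrow> upper_local_dim \<mu> x = s \<and> lower_local_dim \<mu> x = s"

end

theory Submission
  imports Defs
begin

text \<open>
  A periodic point is obtained from a word \<open>\<omega>\<close> of positive ratio that maps \<open>[0, 1]\<close> into the interior
  of a fixed net interval \<open>\<Delta>\<^sub>*\<close>: the images of \<open>\<Delta>\<^sub>*\<close> under the powers of \<open>S\<^sub>\<omega>\<close> are net intervals
  with the same neighbour set, so their intersection is a point with an eventually periodic symbolic
  representation. Such a \<open>\<Delta>\<^sub>*\<close> is found inside a ball \<open>U\<close> in which the supremum of the weak separation
  condition is attained; there no maps other than the images of the maps of \<open>U\<close> can meet
  \<open>S\<^sub>\<omega>(U)\<close>. The vertex of \<open>\<Delta>\<^sub>*\<close> is reachable from every vertex, so the essential class consists of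
  the vertices reachable from it.

  Maximality also gives \<open>\<mu>(S\<^sub>\<omega>(E)) \<le> C \<mu>(S\<^sub>\<omega>[0, 1]) \<mu>(E)\<close> for \<open>E \<subseteq> U\<close> with \<open>C\<close> independent of \<open>\<omega>\<close>. By
  Fekete's lemma the local dimension \<open>D\<close> at the fixed point of \<open>S\<^sub>\<omega>\<close> exists, and \<open>D ln r\<^sub>\<omega>\<close> lies
  between \<open>ln P\<close> and \<open>ln (C \<mu>(S\<^sub>\<omega>[0, 1]))\<close> whenever \<open>\<mu>(S\<^sub>\<omega>(E)) \<ge> P \<mu>(E)\<close> for all \<open>E\<close>; the total weight
  of the words with map \<open>S\<^sub>\<omega>\<close> is such a \<open>P\<close>.

  Given \<open>x \<in> K\<^bsub>ess\<^esub>\<close> and a scale \<open>t\<close>, the ball \<open>B(x, t)\<close> is met by boundedly many maps of generation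
  about \<open>t\<close>; one of them carries a fixed proportion of its measure, and composing it with one of two
  fixed words moves its image to one side of \<open>x\<close>, hence into a net interval whose vertex is essential.
  A copy of that net interval lies inside \<open>\<Delta>\<^sub>*\<close>, so the map is transported there at the cost of
  constants that do not depend on \<open>t\<close>, and closing it up gives a periodic point whose local dimension
  lies between \<open>ln \<mu>(B(x, 4t)) / ln t\<close> and \<open>ln \<mu>(B(x, t)) / ln t\<close> up to \<open>o(1)\<close>.
\<close>

subsection \<open>Words\<close>

lemma sim_word_Nil [simp]: "sim_word r d [] = id"
  by (simp add: sim_word_def)

lemma sim_word_Cons [simp]: "sim_word r d (i # \<sigma>) = sim r d i \<circ> sim_word r d \<sigma>"
  by (simp add: sim_word_def)

lemma sim_word_append: "sim_word r d (\<sigma> @ \<tau>) = sim_word r d \<sigma> \<circ> sim_word r d \<tau>"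
  by (induction \<sigma>) (simp_all add: comp_assoc)

lemma ratio_word_Nil [simp]: "ratio_word r [] = 1"
  by (simp add: ratio_word_def)

lemma ratio_word_Cons [simp]: "ratio_word r (i # \<sigma>) = r i * ratio_word r \<sigma>"
  by (simp add: ratio_word_def)

lemma ratio_word_append: "ratio_word r (\<sigma> @ \<tau>) = ratio_word r \<sigma> * ratio_word r \<tau>"
  by (simp add: ratio_word_def)

lemma sim_word_affine: "sim_word r d \<sigma> x = ratio_word r \<sigma> * x + sim_word r d \<sigma> 0"
  by (induction \<sigma>) (simp_all add: sim_def algebra_simps)

lemma sim_word_diff: "sim_word r d \<sigma> x - sim_word r d \<sigma> y = ratio_word r \<sigma> * (x - y)"
  by (subst (1 2) sim_word_affine) (simp add: algebra_simps)

lemma ratio_word_eq: "ratio_word r \<sigma> = sim_word r d \<sigma> 1 - sim_word r d \<sigma> 0"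
  by (simp add: sim_word_diff)

definition word_weight :: "('i \<Rightarrow> real) \<Rightarrow> 'i list \<Rightarrow> real" where
  "word_weight p \<sigma> = prod_list (map p \<sigma>)"

lemma word_weight_Nil [simp]: "word_weight p [] = 1"
  by (simp add: word_weight_def)

lemma word_weight_Cons [simp]: "word_weight p (i # \<sigma>) = p i * word_weight p \<sigma>"
  by (simp add: word_weight_def)

lemma word_weight_append: "word_weight p (\<sigma> @ \<tau>) = word_weight p \<sigma> * word_weight p \<tau>"
  by (simp add: word_weight_def)

lemma word_weight_pos: "(\<And>i. p i > 0) \<Longrightarrow> word_weight p \<sigma> > 0"
  by (induction \<sigma>) auto

subsection \<open>Cut sets\<close>

locale ifs_hull =
  fixes r d :: "'i::finite \<Rightarrow> real" and K :: "real set"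
  assumes ifs: "ifs r d" and attr: "is_attractor r d K" and hull: "convex hull K = {0..1}"
begin

abbreviation S :: "'i list \<Rightarrow> real \<Rightarrow> real" where "S \<equiv> sim_word r d"
abbreviation R :: "'i list \<Rightarrow> real" where "R \<equiv> ratio_word r"
abbreviation Lam :: "real \<Rightarrow> 'i list set" where "Lam \<equiv> words_gen r"
abbreviation M :: "real \<Rightarrow> real set \<Rightarrow> (real \<Rightarrow> real) set" where "M \<equiv> maps_meeting r d K"
abbreviation endp :: "real \<Rightarrow> real set" where "endp \<equiv> endpoints_gen r d"
abbreviation Net :: "gen_interval set" where "Net \<equiv> net_intervals r d K"
abbreviation V :: "gen_interval \<Rightarrow> vertex" where "V \<equiv> nbr_set r d K"
abbreviation tg :: "gen_interval \<Rightarrow> real" where "tg \<equiv> trans_gen r d K"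
abbreviation G :: "(vertex, edge) pre_digraph" where "G \<equiv> transition_graph r d K"

definition rmax :: real where "rmax = Max (range (\<lambda>i. \<bar>r i\<bar>))"

definition rmin :: real where "rmin = Min (range (\<lambda>i. \<bar>r i\<bar>))"

lemma r_bounds: "0 < \<bar>r i\<bar>" "\<bar>r i\<bar> < 1"
  using ifs by (auto simp: ifs_def)

lemma r_neq_0: "r i \<noteq> 0"
  using r_bounds(1)[of i] by auto

lemma rmax: "\<bar>r i\<bar> \<le> rmax" "0 < rmax" "rmax < 1"
proof -
  show *: "\<bar>r i\<bar> \<le> rmax" for i
    unfolding rmax_def by (rule Max_ge) auto
  show "0 < rmax" using *[of undefined] r_bounds(1)[of undefined] by linarith
  show "rmax < 1" unfolding rmax_def by (subst Max_less_iff) (use r_bounds in auto)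
qed

lemma rmin: "rmin \<le> \<bar>r i\<bar>" "0 < rmin" "rmin < 1"
proof -
  show *: "rmin \<le> \<bar>r i\<bar>" for i
    unfolding rmin_def by (rule Min_le) auto
  show "rmin < 1" using *[of undefined] r_bounds(2)[of undefined] by linarith
  show "0 < rmin" unfolding rmin_def by (subst Min_gr_iff) (use r_bounds in auto)
qed

lemma R_pos: "0 < \<bar>R \<sigma>\<bar>"
  by (induction \<sigma>) (use r_neq_0 in \<open>auto simp: abs_mult\<close>)

lemma R_neq_0 [simp]: "R \<sigma> \<noteq> 0"
  using R_pos[of \<sigma>] by auto

lemma R_le_1: "\<bar>R \<sigma>\<bar> \<le> 1"
proof (induction \<sigma>)
  case (Cons i \<sigma>)
  then show ?case using r_bounds[of i] by (simp add: abs_mult mult_le_one)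
qed simp

lemma R_less_1: "\<sigma> \<noteq> [] \<Longrightarrow> \<bar>R \<sigma>\<bar> < 1"
proof (cases \<sigma>)
  case (Cons i \<tau>)
  have "\<bar>r i\<bar> * \<bar>R \<tau>\<bar> \<le> \<bar>r i\<bar>" using R_le_1 by (intro mult_left_le) auto
  also have "\<dots> < 1" by (rule r_bounds)
  finally show ?thesis using Cons by (simp add: abs_mult)
qed simp

lemma S_inj: "inj (S \<sigma>)"
  by (intro injI) (use sim_word_diff[of r d \<sigma>] in \<open>metis R_neq_0 eq_iff_diff_eq_0 mult_eq_0_iff\<close>)

lemma Lam_gt_1: "t > 1 \<Longrightarrow> Lam t = {[]}"
proof -
  assume t: "t > 1"
  have "\<sigma> = []" if "\<sigma> \<in> Lam t" for \<sigma>
    using that t R_le_1[of "butlast \<sigma>"] by (auto simp: words_gen_def)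
  then show "Lam t = {[]}" using t by (auto simp: words_gen_def)
qed

text \<open>Cut sets are defined through the last letter, but the recursion strips the first. For
  \<open>t \<le> 1\<close> the condition on the predecessor of a one-letter word is automatic, which
  matches the convention for the empty remainder.\<close>

lemma Cons_in_Lam: "0 < t \<Longrightarrow> t \<le> 1 \<Longrightarrow> i # \<sigma> \<in> Lam t \<longleftrightarrow> \<sigma> \<in> Lam (t / \<bar>r i\<bar>)"
  using r_bounds[of i] by (auto simp: words_gen_def abs_mult field_simps)

lemma Nil_in_Lam: "[] \<in> Lam t \<longleftrightarrow> t > 1"
  by (auto simp: words_gen_def)

lemma Lam_le_1:
  assumes "0 < t" "t \<le> 1"
  shows "Lam t = (\<Union>i. (#) i ` Lam (t / \<bar>r i\<bar>))"
proof (intro set_eqI)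
  fix \<sigma>
  show "\<sigma> \<in> Lam t \<longleftrightarrow> \<sigma> \<in> (\<Union>i. (#) i ` Lam (t / \<bar>r i\<bar>))"
    using assms by (cases \<sigma>) (auto simp: Nil_in_Lam Cons_in_Lam)
qed

text \<open>Dividing a scale by \<open>\<bar>r i\<bar>\<close> enlarges it by at least the factor
  \<open>1 / rmax\<close>, so finitely many divisions lead above 1.\<close>

lemma Lam_induct [consumes 1, case_names big small]:
  assumes "t > 0" and big: "\<And>t. t > 1 \<Longrightarrow> P t"
    and small: "\<And>t. 0 < t \<Longrightarrow> t \<le> 1 \<Longrightarrow> (\<And>i. P (t / \<bar>r i\<bar>)) \<Longrightarrow> P t"
  shows "P t"
proof -
  have *: "t > rmax ^ n \<Longrightarrow> P t" for n t
  proof (induction n arbitrary: t)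
    case 0
    then show ?case using big by simp
  next
    case (Suc n)
    have t: "t > 0" using Suc.prems rmax(2) by (meson less_trans zero_less_power)
    have "t / \<bar>r i\<bar> > rmax ^ n" for i
    proof -
      have "rmax ^ n * \<bar>r i\<bar> \<le> rmax ^ n * rmax" using rmax(1)[of i] rmax(2) by simp
      also have "\<dots> < t" using Suc.prems by (simp add: mult.commute)
      finally show ?thesis using r_bounds(1)[of i] by (simp add: pos_less_divide_eq)
    qed
    then show ?case using Suc.IH big small[OF t] by (metis linorder_not_le)
  qed
  obtain n where "rmax ^ n < t" using real_arch_pow_inv[OF assms(1) rmax(3)] by blast
  then show ?thesis using * by blast
qed

lemma finite_Lam: "t > 0 \<Longrightarrow> finite (Lam t)"
  by (induction t rule: Lam_induct) (simp_all add: Lam_gt_1 Lam_le_1)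

text \<open>Transition generations are moduli of ratios of words, so this makes them discrete away
  from 0. The descent in the transition graph and the shrinking of symbolic representations rest on
  it.\<close>

lemma finite_large_words: "t > 0 \<Longrightarrow> finite {\<sigma>. \<bar>R \<sigma>\<bar> \<ge> t}"
proof (induction t rule: Lam_induct)
  case (big t)
  then have "{\<sigma>. \<bar>R \<sigma>\<bar> \<ge> t} = {}" using R_le_1 by (auto simp: not_le intro: le_less_trans)
  then show ?case by simp
next
  case (small t)
  have "{\<sigma>. \<bar>R \<sigma>\<bar> \<ge> t} \<subseteq> insert [] (\<Union>i. (#) i ` {\<sigma>. \<bar>R \<sigma>\<bar> \<ge> t / \<bar>r i\<bar>})"
  proof
    fix \<sigma> assume "\<sigma> \<in> {\<sigma>. \<bar>R \<sigma>\<bar> \<ge> t}"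
    then show "\<sigma> \<in> insert [] (\<Union>i. (#) i ` {\<sigma>. \<bar>R \<sigma>\<bar> \<ge> t / \<bar>r i\<bar>})"
      using r_bounds by (cases \<sigma>) (auto simp: abs_mult field_simps)
  qed
  then show ?case using small by (meson finite.insertI finite_UN_I finite_imageI finite_subset finite)
qed

lemma Lam_R: "\<sigma> \<in> Lam t \<Longrightarrow> \<bar>R \<sigma>\<bar> < t"
  by (simp add: words_gen_def)

lemma Lam_R_lower:
  assumes "\<sigma> \<in> Lam t" "0 < t" "t \<le> 1"
  shows "t * rmin \<le> \<bar>R \<sigma>\<bar>"
proof -
  have "\<sigma> \<noteq> []" using assms by (auto simp: words_gen_def)
  then obtain \<tau> i where \<sigma>: "\<sigma> = \<tau> @ [i]" by (metis rev_exhaust)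
  then have "t \<le> \<bar>R \<tau>\<bar>" using assms by (simp add: words_gen_def)
  then have "t * rmin \<le> \<bar>R \<tau>\<bar> * \<bar>r i\<bar>" using rmin assms by (intro mult_mono) (auto intro: less_imp_le)
  then show ?thesis by (simp add: \<sigma> ratio_word_append abs_mult)
qed

text \<open>A word cut at the fine scale passes the coarse scale first; the remainder is cut at the
  scale divided by the ratio already spent.\<close>

lemma Lam_split:
  assumes "0 < s" "s \<le> t"
  shows "Lam s = {\<sigma> @ \<tau> | \<sigma> \<tau>. \<sigma> \<in> Lam t \<and> \<tau> \<in> Lam (s / \<bar>R \<sigma>\<bar>)}"
proof -
  have "t > 0" using assms by simp
  then show ?thesis using assms
  proof (induction t arbitrary: s rule: Lam_induct)
    case (big t)
    then show ?case by (simp add: Lam_gt_1)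
  next
    case (small t)
    have *: "Lam (s / \<bar>r i\<bar>) = {\<sigma> @ \<tau> | \<sigma> \<tau>. \<sigma> \<in> Lam (t / \<bar>r i\<bar>) \<and> \<tau> \<in> Lam (s / \<bar>r i\<bar> / \<bar>R \<sigma>\<bar>)}" for i
      using small.prems r_bounds[of i] by (intro small.IH) (auto simp: divide_right_mono r_neq_0)
    show ?case
    proof (intro set_eqI)
      fix \<rho>
      show "\<rho> \<in> Lam s \<longleftrightarrow> \<rho> \<in> {\<sigma> @ \<tau> | \<sigma> \<tau>. \<sigma> \<in> Lam t \<and> \<tau> \<in> Lam (s / \<bar>R \<sigma>\<bar>)}"
      proof (cases \<rho>)
        case Nil
        then show ?thesis using small.prems small.hyps by (simp add: Nil_in_Lam)
      next
        case (Cons i \<rho>')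
        have "\<rho> \<in> Lam s \<longleftrightarrow> \<rho>' \<in> Lam (s / \<bar>r i\<bar>)"
          using small.prems small.hyps by (simp add: Cons Cons_in_Lam)
        also have "\<dots> \<longleftrightarrow> (\<exists>\<sigma> \<tau>. \<rho>' = \<sigma> @ \<tau> \<and> i # \<sigma> \<in> Lam t \<and> \<tau> \<in> Lam (s / \<bar>R (i # \<sigma>)\<bar>))"
          using small.hyps by (simp add: * Cons_in_Lam abs_mult)
        also have "\<dots> \<longleftrightarrow> \<rho> \<in> {\<sigma> @ \<tau> | \<sigma> \<tau>. \<sigma> \<in> Lam t \<and> \<tau> \<in> Lam (s / \<bar>R \<sigma>\<bar>)}"
          using small.hyps by (auto simp: Cons Cons_eq_append_conv Nil_in_Lam simp del: ratio_word_Cons)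
        finally show ?thesis .
      qed
    qed
  qed
qed

section \<open>Geometry of the attractor\<close>

lemma K_compact: "compact K" and K_ne: "K \<noteq> {}" and K_eq: "K = (\<Union>i. sim r d i ` K)"
  using attr by (auto simp: is_attractor_def)

lemma K_subset: "K \<subseteq> {0..1}"
  using hull hull_subset[of K convex] by simp

lemma zero_in_K: "0 \<in> K" and one_in_K: "1 \<in> K"
proof -
  have "0 \<in> K"
  proof (rule ccontr)
    assume "0 \<notin> K"
    then have "x \<in> {0<..1}" if "x \<in> K" for x
      using K_subset that by (cases "x = 0") (auto simp: subset_iff less_le)
    then have "K \<subseteq> {0<..1}" by blast
    then have "convex hull K \<subseteq> {0<..1}" by (intro hull_minimal) auto
    then have "(0::real) \<in> {0<..1}" unfolding hull by (rule subsetD) simp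
    then show False by simp
  qed
  moreover have "1 \<in> K"
  proof (rule ccontr)
    assume "1 \<notin> K"
    then have "x \<in> {0..<1}" if "x \<in> K" for x
      using K_subset that by (cases "x = 1") (auto simp: subset_iff less_le)
    then have "K \<subseteq> {0..<1}" by blast
    then have "convex hull K \<subseteq> {0..<1}" by (intro hull_minimal) auto
    then have "(1::real) \<in> {0..<1}" unfolding hull by (rule subsetD) simp
    then show False by simp
  qed
  ultimately show "0 \<in> K" "1 \<in> K" by auto
qed

lemma S_K: "S \<sigma> ` K \<subseteq> K"
proof (induction \<sigma>)
  case (Cons i \<sigma>)
  then have "S (i # \<sigma>) ` K \<subseteq> sim r d i ` K" by auto
  then show ?case using K_eq by blast
qed simp

lemma S_J_between:
  assumes "x \<in> {0..1}"
  shows "min (S \<sigma> 0) (S \<sigma> 1) \<le> S \<sigma> x" "S \<sigma> x \<le> max (S \<sigma> 0) (S \<sigma> 1)"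
proof -
  have x: "0 \<le> x" "x \<le> 1" using assms by auto
  have "min 0 (R \<sigma>) \<le> R \<sigma> * x \<and> R \<sigma> * x \<le> max 0 (R \<sigma>)"
  proof (cases "R \<sigma> \<ge> 0")
    case True
    then show ?thesis using x mult_left_le[of x "R \<sigma>"] by simp
  next
    case False
    then show ?thesis using x mult_left_le[of x "- R \<sigma>"] mult_nonneg_nonneg[of "- R \<sigma>" x] by simp
  qed
  then show "min (S \<sigma> 0) (S \<sigma> 1) \<le> S \<sigma> x" "S \<sigma> x \<le> max (S \<sigma> 0) (S \<sigma> 1)"
    using sim_word_affine[of r d \<sigma> x] sim_word_affine[of r d \<sigma> 1] by auto
qed

lemma S_J: "S \<sigma> ` {0..1} \<subseteq> {0..1}"
proof -
  have "S \<sigma> 0 \<in> {0..1}" "S \<sigma> 1 \<in> {0..1}" using S_K[of \<sigma>] zero_in_K one_in_K K_subset by blast+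
  then have "S \<sigma> x \<in> {0..1}" if "x \<in> {0..1}" for x
    using S_J_between[OF that, of \<sigma>] by (auto simp: min_def max_def split: if_splits)
  then show ?thesis by blast
qed

lemma K_cover: "t > 0 \<Longrightarrow> K = (\<Union>\<sigma>\<in>Lam t. S \<sigma> ` K)"
proof (induction t rule: Lam_induct)
  case (big t)
  then show ?case by (simp add: Lam_gt_1)
next
  case (small t)
  have "K = (\<Union>i. sim r d i ` K)" by (rule K_eq)
  also have "\<dots> = (\<Union>i. sim r d i ` (\<Union>\<sigma>\<in>Lam (t / \<bar>r i\<bar>). S \<sigma> ` K))"
    using small.IH by metis
  also have "\<dots> = (\<Union>\<sigma>\<in>Lam t. S \<sigma> ` K)"
    using small.hyps by (simp add: Lam_le_1 image_UN image_comp o_def) blast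
  finally show ?case .
qed

lemma negative_letter:
  assumes "R \<sigma> < 0"
  obtains i where "r i < 0"
proof -
  have "\<exists>i. r i < 0"
  proof (rule ccontr)
    assume "\<nexists>i. r i < 0"
    then have "0 < r i" for i using r_neq_0[of i] by (metis linorder_neqE_linordered_idom)
    then have "R \<tau> > 0" for \<tau> by (induction \<tau>) auto
    then show False using assms by (metis less_asym)
  qed
  then show ?thesis using that by blast
qed

text \<open>Local isomorphisms preserve orientation, so words of positive ratio are needed. A
  negative ratio forces a letter of negative ratio; appending it costs only a bounded factor in
  ratio and weight.\<close>

lemma sign_fix:
  obtains \<eta> where "R (\<sigma> @ \<eta>) > 0" "length \<eta> \<le> 1"
proof (cases "R \<sigma> > 0")
  case True
  then show ?thesis using that[of "[]"] by simp
next
  case False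
  then have neg: "R \<sigma> < 0" using R_neq_0[of \<sigma>] by linarith
  then obtain i where "r i < 0" by (rule negative_letter)
  then show ?thesis using that[of "[i]"] neg by (simp add: ratio_word_append mult_neg_neg)
qed

lemma small_image:
  assumes "z \<in> K" "e > 0"
  obtains \<sigma> where "S \<sigma> ` {0..1} \<subseteq> ball z e" "R \<sigma> > 0" "R \<sigma> < e"
proof -
  obtain \<sigma> where \<sigma>: "\<sigma> \<in> Lam e" "z \<in> S \<sigma> ` K" using K_cover[OF assms(2)] assms(1) by blast
  then obtain u where u: "u \<in> K" "z = S \<sigma> u" by auto
  obtain \<eta> where \<eta>: "R (\<sigma> @ \<eta>) > 0" by (rule sign_fix)
  have Re: "\<bar>R \<sigma>\<bar> < e" using \<sigma> Lam_R by blast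
  have "S (\<sigma> @ \<eta>) x \<in> ball z e" if "x \<in> {0..1}" for x
  proof -
    have "S \<eta> x \<in> {0..1}" using S_J that by blast
    then have "\<bar>u - S \<eta> x\<bar> \<le> 1" using u K_subset by fastforce
    then have "\<bar>R \<sigma>\<bar> * \<bar>u - S \<eta> x\<bar> \<le> \<bar>R \<sigma>\<bar>" by (intro mult_left_le) auto
    then have "\<bar>R \<sigma>\<bar> * \<bar>u - S \<eta> x\<bar> < e" using Re by (rule le_less_trans)
    then show ?thesis
      using sim_word_diff[of r d \<sigma> u "S \<eta> x"] by (simp add: u sim_word_append dist_real_def abs_mult)
  qed
  moreover have "\<bar>R (\<sigma> @ \<eta>)\<bar> < e"
    using le_less_trans[OF mult_left_le[OF R_le_1[of \<eta>], of "\<bar>R \<sigma>\<bar>"] Re]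
    by (simp add: ratio_word_append abs_mult)
  ultimately show ?thesis using that[of "\<sigma> @ \<eta>"] \<eta> by (simp add: image_subset_iff)
qed

text \<open>Otherwise distinct points of \<open>K\<close> would have a least distance, but
  \<open>S \<sigma> 0\<close> and \<open>S \<sigma> 1\<close> are points of \<open>K\<close> at
  distance \<open>\<bar>R \<sigma>\<bar>\<close>.\<close>

lemma infinite_K: "infinite K"
proof
  assume fin: "finite K"
  define X where "X = (\<lambda>(x, y). \<bar>x - y\<bar>) ` {(x, y) \<in> K \<times> K. x \<noteq> y}"
  have finX: "finite X" unfolding X_def using fin by (auto intro: finite_subset[OF _ finite_cartesian_product])
  have "(0, 1) \<in> {(x, y) \<in> K \<times> K. x \<noteq> y}" using zero_in_K one_in_K by auto
  then have ne: "X \<noteq> {}" unfolding X_def by blast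
  have pos: "Min X > 0" using finX ne by (subst Min_gr_iff) (auto simp: X_def)
  obtain \<sigma> where \<sigma>: "\<sigma> \<in> Lam (Min X)" "0 \<in> S \<sigma> ` K" using K_cover[OF pos] zero_in_K by blast
  have "S \<sigma> 0 \<in> K" "S \<sigma> 1 \<in> K" using S_K zero_in_K one_in_K by blast+
  moreover have "S \<sigma> 1 - S \<sigma> 0 = R \<sigma>" by (simp add: sim_word_diff)
  moreover have "S \<sigma> 1 \<noteq> S \<sigma> 0" using injD[OF S_inj, of \<sigma> 1 0] by auto
  ultimately have "\<bar>R \<sigma>\<bar> \<in> X" unfolding X_def by (intro image_eqI[where x="(S \<sigma> 1, S \<sigma> 0)"]) simp_all
  then have "Min X \<le> \<bar>R \<sigma>\<bar>" using finX by simp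
  then show False using Lam_R[OF \<sigma>(1)] by simp
qed

lemma infinite_K_Int:
  assumes "open U" "z \<in> U" "z \<in> K"
  shows "infinite (U \<inter> K)"
proof -
  obtain e where e: "e > 0" "ball z e \<subseteq> U" using assms openE by blast
  obtain \<sigma> where "S \<sigma> ` {0..1} \<subseteq> ball z e" using small_image[OF assms(3) e(1)] by metis
  then have "S \<sigma> ` K \<subseteq> U \<inter> K" using e S_K[of \<sigma>] K_subset by blast
  moreover have "infinite (S \<sigma> ` K)" using infinite_K S_inj by (meson finite_imageD inj_on_subset top_greatest)
  ultimately show ?thesis using finite_subset by blast
qed

end

declare nbr_set.simps [simp del] trans_gen.simps [simp del] norm_map.simps [simp del]

context ifs_hull
begin

subsection \<open>Local isomorphisms and net intervals\<close>

lemma in_M: "f \<in> M t E \<longleftrightarrow> (\<exists>\<sigma>\<in>Lam t. f = S \<sigma> \<and> S \<sigma> ` K \<inter> E \<noteq> {})"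
  by (auto simp: maps_meeting_def)

lemma M_E:
  assumes "f \<in> M t E"
  obtains \<sigma> where "f = S \<sigma>" "\<sigma> \<in> Lam t" "S \<sigma> \<in> M t E" "\<bar>f 1 - f 0\<bar> = \<bar>R \<sigma>\<bar>"
  using assms that unfolding in_M by (metis ratio_word_eq)

lemma finite_M: "t > 0 \<Longrightarrow> finite (M t E)"
  by (rule finite_subset[of _ "S ` Lam t"]) (auto simp: in_M finite_Lam)

text \<open>The admissible continuations depend on the coarse map \<open>f\<close> only through
  \<open>\<bar>f 1 - f 0\<bar>\<close>, the modulus of its ratio. So the set of maps seen in
  \<open>I\<close> determines all finer maps seen in \<open>E\<close>, whatever words represent
  them.\<close>

lemma M_refine:
  assumes "0 < s" "s \<le> t" "E \<subseteq> I"
  shows "M s E = {f \<circ> S \<tau> | f \<tau>. f \<in> M t I \<and> \<tau> \<in> Lam (s / \<bar>f 1 - f 0\<bar>) \<and> (f \<circ> S \<tau>) ` K \<inter> E \<noteq> {}}"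
proof (intro set_eqI iffI)
  fix g assume "g \<in> M s E"
  then obtain \<rho> where \<rho>: "\<rho> \<in> Lam s" "g = S \<rho>" "S \<rho> ` K \<inter> E \<noteq> {}" by (auto simp: in_M)
  then obtain \<sigma> \<tau> where \<sigma>: "\<rho> = \<sigma> @ \<tau>" "\<sigma> \<in> Lam t" "\<tau> \<in> Lam (s / \<bar>R \<sigma>\<bar>)"
    using Lam_split[OF assms(1,2)] by blast
  have "S \<rho> ` K \<subseteq> S \<sigma> ` K"
    using S_K[of \<tau>] by (auto simp: \<sigma> sim_word_append)
  then have "S \<sigma> ` K \<inter> I \<noteq> {}" using \<rho>(3) assms(3) by blast
  then have "S \<sigma> \<in> M t I" using \<sigma>(2) by (auto simp only: in_M)
  moreover have "\<tau> \<in> Lam (s / \<bar>S \<sigma> 1 - S \<sigma> 0\<bar>)" using \<sigma>(3) by (simp add: sim_word_diff)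
  ultimately show "g \<in> {f \<circ> S \<tau> | f \<tau>. f \<in> M t I \<and> \<tau> \<in> Lam (s / \<bar>f 1 - f 0\<bar>) \<and> (f \<circ> S \<tau>) ` K \<inter> E \<noteq> {}}"
    using \<rho> unfolding \<sigma>(1) sim_word_append by blast
next
  fix g assume "g \<in> {f \<circ> S \<tau> | f \<tau>. f \<in> M t I \<and> \<tau> \<in> Lam (s / \<bar>f 1 - f 0\<bar>) \<and> (f \<circ> S \<tau>) ` K \<inter> E \<noteq> {}}"
  then obtain \<sigma> \<tau> where \<sigma>: "g = S \<sigma> \<circ> S \<tau>" "\<sigma> \<in> Lam t" "\<tau> \<in> Lam (s / \<bar>R \<sigma>\<bar>)" "(S \<sigma> \<circ> S \<tau>) ` K \<inter> E \<noteq> {}"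
  proof -
    obtain f \<tau> where f: "g = f \<circ> S \<tau>" "f \<in> M t I" "\<tau> \<in> Lam (s / \<bar>f 1 - f 0\<bar>)" "(f \<circ> S \<tau>) ` K \<inter> E \<noteq> {}"
      using \<open>g \<in> _\<close> by blast
    obtain \<sigma> where "f = S \<sigma>" "\<sigma> \<in> Lam t" "\<bar>f 1 - f 0\<bar> = \<bar>R \<sigma>\<bar>" using M_E[OF f(2)] by metis
    then show ?thesis using f by (intro that[of \<sigma> \<tau>]) simp_all
  qed
  then have "\<sigma> @ \<tau> \<in> Lam s" using Lam_split[OF assms(1,2)] by blast
  then show "g \<in> M s E" unfolding in_M using \<sigma> by (metis sim_word_append)
qed

end

definition aff :: "real \<Rightarrow> real \<Rightarrow> real \<Rightarrow> real" where
  "aff l c x = l * x + c"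

lemma aff_comp: "aff l c \<circ> aff l' c' = aff (l * l') (l * c' + c)"
  by (auto simp: aff_def algebra_simps)

lemma aff_1_0: "aff 1 0 = id"
  by (auto simp: aff_def)

lemma aff_comp_aff: "aff l c \<circ> (aff l' c' \<circ> f) = aff (l * l') (l * c' + c) \<circ> f"
  by (simp only: aff_comp[symmetric] comp_assoc)

lemma inj_aff: "l \<noteq> 0 \<Longrightarrow> inj (aff l c)"
  by (auto simp: aff_def inj_def)

lemma aff_eq_iff [simp]: "l > 0 \<Longrightarrow> aff l c x = aff l c y \<longleftrightarrow> x = y"
  by (auto simp: aff_def)

lemma aff_less_iff [simp]: "l > 0 \<Longrightarrow> aff l c x < aff l c y \<longleftrightarrow> x < y"
  by (auto simp: aff_def)

lemma aff_le_iff [simp]: "l > 0 \<Longrightarrow> aff l c x \<le> aff l c y \<longleftrightarrow> x \<le> y"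
  by (auto simp: aff_def)

lemma aff_cancel: "l > 0 \<Longrightarrow> aff l c ((y - c) / l) = y"
  by (auto simp: aff_def)

lemma aff_image_greaterThanLessThan: "l > 0 \<Longrightarrow> aff l c ` {a<..<b} = {aff l c a<..<aff l c b}"
proof (intro subset_antisym subsetI)
  fix y assume l: "l > 0" and "y \<in> {aff l c a<..<aff l c b}"
  then have "(y - c) / l \<in> {a<..<b}" by (simp add: aff_def field_simps)
  then show "y \<in> aff l c ` {a<..<b}" by (intro image_eqI[where x="(y - c) / l"]) (simp_all add: aff_cancel l)
qed auto

lemma aff_diff: "aff l c x - aff l c y = l * (x - y)"
  by (simp add: aff_def algebra_simps)

context ifs_hull
begin

lemma S_eq_aff: "S \<sigma> = aff (R \<sigma>) (S \<sigma> 0)"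
  by (intro ext) (simp add: aff_def sim_word_affine[of r d \<sigma>, symmetric])

text \<open>The maps of generation \<open>t\<close> seen in \<open>I\<close> and those of generation \<open>t'\<close> seen in the image of
  \<open>I\<close> under \<open>x \<mapsto> l x + c\<close> correspond to each other. All finer structure inside \<open>I\<close> (end points,
  net intervals, neighbour sets) is then transported by the same map.\<close>

definition loc_iso :: "real \<Rightarrow> real set \<Rightarrow> real \<Rightarrow> real \<Rightarrow> real \<Rightarrow> bool" where
  "loc_iso t I t' l c \<longleftrightarrow> l > 0 \<and> M t' (aff l c ` I) = (\<lambda>f. aff l c \<circ> f) ` M t I"

text \<open>In \<open>M_refine\<close> the scale enters only through
  \<open>s / \<bar>f 1 - f 0\<bar>\<close>, which does not change when scale and map are both
  multiplied by \<open>l\<close>.\<close>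

lemma loc_iso_refine:
  assumes "loc_iso t I t' l c" "0 < s" "s \<le> t" "l * s \<le> t'" "E \<subseteq> I"
  shows "loc_iso s E (l * s) l c"
proof -
  have l: "l > 0" and eq: "M t' (aff l c ` I) = (\<lambda>f. aff l c \<circ> f) ` M t I"
    using assms(1) by (auto simp: loc_iso_def)
  have ratio: "l * s / \<bar>(aff l c \<circ> f) 1 - (aff l c \<circ> f) 0\<bar> = s / \<bar>f 1 - f 0\<bar>" for f
    using l by (simp add: aff_diff abs_mult)
  have meets: "((aff l c \<circ> f) \<circ> S \<tau>) ` K \<inter> aff l c ` E \<noteq> {} \<longleftrightarrow> (f \<circ> S \<tau>) ` K \<inter> E \<noteq> {}" for f \<tau>
    using l by (auto simp: image_iff disjoint_iff)
  have "M (l * s) (aff l c ` E) = {g \<circ> S \<tau> | g \<tau>. g \<in> M t' (aff l c ` I) \<and>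
      \<tau> \<in> Lam (l * s / \<bar>g 1 - g 0\<bar>) \<and> (g \<circ> S \<tau>) ` K \<inter> aff l c ` E \<noteq> {}}"
    using assms l by (intro M_refine) auto
  also have "\<dots> = {(aff l c \<circ> f) \<circ> S \<tau> | f \<tau>. f \<in> M t I \<and>
      \<tau> \<in> Lam (l * s / \<bar>(aff l c \<circ> f) 1 - (aff l c \<circ> f) 0\<bar>) \<and> ((aff l c \<circ> f) \<circ> S \<tau>) ` K \<inter> aff l c ` E \<noteq> {}}"
    unfolding eq by blast
  also have "\<dots> = {aff l c \<circ> (f \<circ> S \<tau>) | f \<tau>. f \<in> M t I \<and>
      \<tau> \<in> Lam (s / \<bar>f 1 - f 0\<bar>) \<and> (f \<circ> S \<tau>) ` K \<inter> E \<noteq> {}}"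
    unfolding ratio meets by (simp only: comp_assoc)
  also have "\<dots> = (\<lambda>f. aff l c \<circ> f) ` M s E"
    unfolding M_refine[OF assms(2,3,5)] by blast
  finally show ?thesis using l by (simp add: loc_iso_def)
qed

text \<open>Since 0 and 1 belong to \<open>K\<close>, a word with an end point in \<open>I\<close>
  is seen in \<open>I\<close>.\<close>

lemma in_endp_iff: "y \<in> I \<Longrightarrow> y \<in> endp t \<longleftrightarrow> (\<exists>f\<in>M t I. y = f 0 \<or> y = f 1)"
  using zero_in_K one_in_K by (fastforce simp: endpoints_gen_def in_M)

lemma in_K_iff: "t > 0 \<Longrightarrow> y \<in> I \<Longrightarrow> y \<in> K \<longleftrightarrow> (\<exists>f\<in>M t I. y \<in> f ` K)"
proof -
  assume t: "t > 0" and y: "y \<in> I"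
  have "y \<in> K \<longleftrightarrow> (\<exists>\<sigma>\<in>Lam t. y \<in> S \<sigma> ` K)" using K_cover[OF t] by blast
  also have "\<dots> \<longleftrightarrow> (\<exists>f\<in>M t I. y \<in> f ` K)"
    using y by (auto simp only: Bex_def in_M)
  finally show "y \<in> K \<longleftrightarrow> (\<exists>f\<in>M t I. y \<in> f ` K)" .
qed

lemma loc_iso_endp:
  assumes "loc_iso t I t' l c" "y \<in> I"
  shows "aff l c y \<in> endp t' \<longleftrightarrow> y \<in> endp t"
proof -
  have "l > 0" using assms by (simp add: loc_iso_def)
  moreover have "aff l c y \<in> aff l c ` I" using assms by simp
  ultimately show ?thesis
    using assms by (simp add: in_endp_iff[of _ "aff l c ` I"] in_endp_iff[of _ I] loc_iso_def)
qed

lemma loc_iso_K: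
  assumes "loc_iso t I t' l c" "y \<in> I" "t > 0" "t' > 0"
  shows "aff l c y \<in> K \<longleftrightarrow> y \<in> K"
proof -
  have l: "l > 0" using assms by (simp add: loc_iso_def)
  have "aff l c y \<in> aff l c ` I" using assms by simp
  then have "aff l c y \<in> K \<longleftrightarrow> (\<exists>g\<in>M t' (aff l c ` I). aff l c y \<in> g ` K)"
    using assms(4) by (intro in_K_iff)
  also have "\<dots> \<longleftrightarrow> (\<exists>f\<in>M t I. aff l c y \<in> (aff l c \<circ> f) ` K)"
    using assms by (simp add: loc_iso_def)
  also have "\<dots> \<longleftrightarrow> (\<exists>f\<in>M t I. y \<in> f ` K)"
    using l by (simp add: image_iff)
  also have "\<dots> \<longleftrightarrow> y \<in> K" using in_K_iff[OF assms(3,2)] by blast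
  finally show ?thesis .
qed

lemma in_Net: "(t, a, b) \<in> Net \<longleftrightarrow> t > 0 \<and> a < b \<and> a \<in> endp t \<and> b \<in> endp t \<and>
    {a<..<b} \<inter> endp t = {} \<and> {a<..<b} \<inter> K \<noteq> {}"
  by (simp add: net_intervals_def)

text \<open>The isomorphism controls only the open interval, so the two ends have to be supplied as
  end points of the target generation.\<close>

lemma loc_iso_Net:
  assumes "loc_iso t {a<..<b} t' l c" "(t, a, b) \<in> Net" "t' > 0" "aff l c a \<in> endp t'" "aff l c b \<in> endp t'"
  shows "(t', aff l c a, aff l c b) \<in> Net"
proof -
  have l: "l > 0" using assms by (simp add: loc_iso_def)
  have im: "{aff l c a<..<aff l c b} = aff l c ` {a<..<b}" using aff_image_greaterThanLessThan[OF l] by simp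
  show ?thesis using assms(2-) l loc_iso_endp[OF assms(1)] loc_iso_K[OF assms(1)]
    unfolding in_Net im by (auto simp: disjoint_iff)
qed

lemma nbr_set_eq:
  assumes "a < b"
  shows "V (t, a, b) = (\<lambda>f. aff (1 / (b - a)) (- a / (b - a)) \<circ> f) ` M t {a<..<b}"
proof -
  have "inv (norm_map (t, a, b)) = aff (1 / (b - a)) (- a / (b - a))"
    using assms by (intro inv_equality) (auto simp: norm_map.simps aff_def divide_simps)
  then show ?thesis by (auto simp: nbr_set.simps maps_meeting_def)
qed

lemma loc_iso_nbr_set:
  assumes "loc_iso t {a<..<b} t' l c" "a < b"
  shows "V (t', aff l c a, aff l c b) = V (t, a, b)"
proof -
  have l: "l > 0" using assms by (simp add: loc_iso_def)
  have M: "M t' {aff l c a<..<aff l c b} = (\<lambda>f. aff l c \<circ> f) ` M t {a<..<b}"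
    using assms aff_image_greaterThanLessThan[OF l] by (simp add: loc_iso_def)
  have c: "1 / (l * (b - a)) * l = 1 / (b - a)"
    "1 / (l * (b - a)) * c + - aff l c a / (l * (b - a)) = - a / (b - a)"
    using l assms(2) by (simp_all add: aff_def divide_simps)
  have "aff l c a < aff l c b" using l assms by simp
  then show ?thesis using assms(2)
    by (simp only: nbr_set_eq M image_image aff_comp_aff aff_diff c)
qed

text \<open>A neighbour set is \<open>M t {a<..<b}\<close> in normalized coordinates, so equality
  means correspondence under the affine map between the intervals. Together with
  \<open>loc_iso_nbr_set\<close> this makes a vertex the isomorphism type of the interior of a net
  interval.\<close>

lemma nbr_set_loc_iso:
  assumes "V (t', a', b') = V (t, a, b)" "a < b" "a' < b'"
  defines "l \<equiv> (b' - a') / (b - a)"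
  shows "loc_iso t {a<..<b} t' l (a' - l * a)" "aff l (a' - l * a) a = a'" "aff l (a' - l * a) b = b'"
proof -
  have l: "l > 0" using assms by (simp add: l_def)
  show ab: "aff l (a' - l * a) a = a'" "aff l (a' - l * a) b = b'"
  proof -
    have "l * (b - a) = b' - a'" using assms by (simp add: l_def)
    then show "aff l (a' - l * a) a = a'" "aff l (a' - l * a) b = b'" by (auto simp: aff_def algebra_simps)
  qed
  have "M t' {a'<..<b'} = (\<lambda>f. aff (b' - a') a' \<circ> f) ` V (t', a', b')"
    using assms(3) by (simp add: nbr_set_eq image_image aff_comp_aff aff_1_0)
  also have "\<dots> = (\<lambda>f. aff l (a' - l * a) \<circ> f) ` M t {a<..<b}"
  proof -
    have c: "(b' - a') * (1 / (b - a)) = l" "(b' - a') * (- a / (b - a)) + a' = a' - l * a"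
      by (simp_all add: l_def)
    show ?thesis unfolding assms(1) nbr_set_eq[OF assms(2)] image_image aff_comp_aff c ..
  qed
  finally show "loc_iso t {a<..<b} t' l (a' - l * a)"
    unfolding loc_iso_def using l by (simp add: aff_image_greaterThanLessThan ab)
qed

section \<open>The transition generation\<close>

lemma Net_M_ne:
  assumes "(t, a, b) \<in> Net"
  shows "M t {a<..<b} \<noteq> {}"
proof -
  obtain y where "y \<in> {a<..<b}" "y \<in> K" using assms unfolding in_Net by blast
  then show ?thesis using in_K_iff[of t y "{a<..<b}"] assms by (auto simp: in_Net)
qed

text \<open>Normalization divides every ratio by the diameter and the factor in front multiplies it
  back.\<close>

lemma tg_eq:
  assumes "(t, a, b) \<in> Net"
  shows "tg (t, a, b) = Max ((\<lambda>f. \<bar>f 1 - f 0\<bar>) ` M t {a<..<b})"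
proof -
  have ab: "a < b" and t: "t > 0" using assms by (auto simp: in_Net)
  have "{\<bar>Q\<bar> | Q c. (\<lambda>x. Q * x + c) \<in> V (t, a, b)} = (\<lambda>z. z / (b - a)) ` (\<lambda>f. \<bar>f 1 - f 0\<bar>) ` M t {a<..<b}"
  proof (intro set_eqI iffI)
    fix q assume "q \<in> {\<bar>Q\<bar> | Q c. (\<lambda>x. Q * x + c) \<in> V (t, a, b)}"
    then obtain Q c f where *: "q = \<bar>Q\<bar>" "f \<in> M t {a<..<b}"
      "(\<lambda>x. Q * x + c) = aff (1 / (b - a)) (- a / (b - a)) \<circ> f"
      using ab by (auto simp: nbr_set_eq)
    have "Q = 1 / (b - a) * (f 1 - f 0)" using fun_cong[OF *(3), of 1] fun_cong[OF *(3), of 0]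
      by (simp add: aff_def algebra_simps diff_divide_distrib)
    then show "q \<in> (\<lambda>z. z / (b - a)) ` (\<lambda>f. \<bar>f 1 - f 0\<bar>) ` M t {a<..<b}"
      using *(1,2) ab by (auto simp: image_image abs_mult)
  next
    fix q assume "q \<in> (\<lambda>z. z / (b - a)) ` (\<lambda>f. \<bar>f 1 - f 0\<bar>) ` M t {a<..<b}"
    then obtain f where f: "f \<in> M t {a<..<b}" "q = \<bar>f 1 - f 0\<bar> / (b - a)" by auto
    obtain \<sigma> where *: "S \<sigma> \<in> M t {a<..<b}" "q = \<bar>R \<sigma>\<bar> / (b - a)"
      using M_E[OF f(1)] f(2) by metis
    have "aff (1 / (b - a)) (- a / (b - a)) \<circ> S \<sigma> = (\<lambda>x. (R \<sigma> / (b - a)) * x + (S \<sigma> 0 - a) / (b - a))"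
      by (subst S_eq_aff) (auto simp: aff_comp aff_def diff_divide_distrib)
    moreover have "aff (1 / (b - a)) (- a / (b - a)) \<circ> S \<sigma> \<in> V (t, a, b)" using * ab by (auto simp: nbr_set_eq)
    ultimately show "q \<in> {\<bar>Q\<bar> | Q c. (\<lambda>x. Q * x + c) \<in> V (t, a, b)}"
      using * ab by (intro CollectI exI[of _ "R \<sigma> / (b - a)"] exI[of _ "(S \<sigma> 0 - a) / (b - a)"]) auto
  qed
  then have "tg (t, a, b) = (b - a) * Max ((\<lambda>z. z / (b - a)) ` (\<lambda>f. \<bar>f 1 - f 0\<bar>) ` M t {a<..<b})"
    by (simp only: trans_gen.simps)
  also have "Max ((\<lambda>z. z / (b - a)) ` (\<lambda>f. \<bar>f 1 - f 0\<bar>) ` M t {a<..<b}) =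
      Max ((\<lambda>f. \<bar>f 1 - f 0\<bar>) ` M t {a<..<b}) / (b - a)"
    using ab t finite_M Net_M_ne[OF assms]
    by (intro mono_Max_commute[symmetric]) (auto simp: mono_def divide_right_mono)
  finally show ?thesis using ab by simp
qed

lemma tg_attained:
  assumes "(t, a, b) \<in> Net"
  obtains \<sigma> where "S \<sigma> \<in> M t {a<..<b}" "tg (t, a, b) = \<bar>R \<sigma>\<bar>"
proof -
  have "tg (t, a, b) \<in> (\<lambda>f. \<bar>f 1 - f 0\<bar>) ` M t {a<..<b}"
    unfolding tg_eq[OF assms] using assms finite_M Net_M_ne[OF assms] by (intro Max_in) (auto simp: in_Net)
  then obtain f where "f \<in> M t {a<..<b}" "tg (t, a, b) = \<bar>f 1 - f 0\<bar>" by auto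
  then show ?thesis using M_E that by metis
qed

lemma tg_ge:
  assumes "(t, a, b) \<in> Net" "f \<in> M t {a<..<b}"
  shows "\<bar>f 1 - f 0\<bar> \<le> tg (t, a, b)"
  unfolding tg_eq[OF assms(1)] using assms finite_M by (intro Max_ge) (auto simp: in_Net)

lemma tg_bounds:
  assumes "(t, a, b) \<in> Net"
  shows "0 < tg (t, a, b)" "tg (t, a, b) < t" "tg (t, a, b) \<le> 1"
proof -
  obtain \<sigma> where \<sigma>: "S \<sigma> \<in> M t {a<..<b}" "tg (t, a, b) = \<bar>R \<sigma>\<bar>" by (rule tg_attained[OF assms])
  \<comment> \<open>The word \<open>\<sigma>\<close> need not lie in the cut set, but some word
    there has the same map and hence the same ratio.\<close>
  then obtain \<tau> where \<tau>: "\<tau> \<in> Lam t" "S \<sigma> = S \<tau>" by (auto simp: in_M)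
  then have "R \<sigma> = R \<tau>" by (simp add: ratio_word_eq[of r _ d])
  then show "0 < tg (t, a, b)" "tg (t, a, b) < t" "tg (t, a, b) \<le> 1"
    using \<sigma> \<tau> Lam_R R_pos R_le_1 by auto
qed

lemma loc_iso_tg:
  assumes "loc_iso t {a<..<b} t' l c" "(t, a, b) \<in> Net" "(t', aff l c a, aff l c b) \<in> Net"
  shows "tg (t', aff l c a, aff l c b) = l * tg (t, a, b)"
proof -
  have l: "l > 0" using assms by (simp add: loc_iso_def)
  have M: "M t' {aff l c a<..<aff l c b} = (\<lambda>f. aff l c \<circ> f) ` M t {a<..<b}"
    using assms aff_image_greaterThanLessThan[OF l] by (simp add: loc_iso_def)
  have "tg (t', aff l c a, aff l c b) = Max ((\<lambda>z. l * z) ` (\<lambda>f. \<bar>f 1 - f 0\<bar>) ` M t {a<..<b})"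
    using l by (simp add: tg_eq[OF assms(3)] M image_image aff_diff abs_mult)
  also have "\<dots> = l * tg (t, a, b)" unfolding tg_eq[OF assms(2)]
    using l assms finite_M Net_M_ne[OF assms(2)]
    by (intro mono_Max_commute[symmetric]) (auto simp: mono_def in_Net)
  finally show ?thesis .
qed

section \<open>End points and the nesting of net intervals\<close>

lemma S01: "S \<sigma> 0 \<in> {0..1}" "S \<sigma> 1 \<in> {0..1}"
  using S_J[of \<sigma>] unfolding image_subset_iff by auto

lemma endp_subset: "endp t \<subseteq> {0..1}"
  using S01 unfolding endpoints_gen_def by blast

lemma finite_endp: "t > 0 \<Longrightarrow> finite (endp t)"
  by (auto simp: endpoints_gen_def finite_Lam)

lemma K_word:
  assumes "t > 0" "z \<in> K"
  obtains \<sigma> x where "\<sigma> \<in> Lam t" "x \<in> K" "S \<sigma> x = z"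
  using equalityD1[OF K_cover[OF assms(1)]] assms(2) by blast

text \<open>An extreme of the unit interval is a value of some \<open>S \<sigma>\<close> lying
  between \<open>S \<sigma> 0\<close> and \<open>S \<sigma> 1\<close>, which stay in the unit
  interval; one of them must equal it.\<close>

lemma zero_in_endp: "t > 0 \<Longrightarrow> 0 \<in> endp t" and one_in_endp: "t > 0 \<Longrightarrow> 1 \<in> endp t"
proof -
  assume t: "t > 0"
  obtain \<sigma> x where \<sigma>: "\<sigma> \<in> Lam t" "x \<in> K" "S \<sigma> x = 0" using K_word[OF t zero_in_K] by metis
  have "S \<sigma> 0 = 0 \<or> S \<sigma> 1 = 0" using S_J_between[of x \<sigma>] \<sigma> K_subset S01[of \<sigma>] by (auto simp: min_def split: if_splits)
  then show "0 \<in> endp t" using \<sigma>(1) unfolding endpoints_gen_def by (metis UN_I insert_iff)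
  obtain \<tau> y where \<tau>: "\<tau> \<in> Lam t" "y \<in> K" "S \<tau> y = 1" using K_word[OF t one_in_K] by metis
  have "S \<tau> 0 = 1 \<or> S \<tau> 1 = 1" using S_J_between[of y \<tau>] \<tau> K_subset S01[of \<tau>] by (auto simp: max_def split: if_splits)
  then show "1 \<in> endp t" using \<tau>(1) unfolding endpoints_gen_def by (metis UN_I insert_iff)
qed

text \<open>As 0 and 1 are end points of every generation, a word can be refined so that a given end
  of its image remains an end.\<close>

lemma endp_mono:
  assumes "0 < s" "s \<le> t"
  shows "endp t \<subseteq> endp s"
proof
  fix y assume "y \<in> endp t"
  then obtain \<sigma> e where \<sigma>: "\<sigma> \<in> Lam t" "y = S \<sigma> e" "e = 0 \<or> e = 1" by (auto simp: endpoints_gen_def)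
  have "s / \<bar>R \<sigma>\<bar> > 0" using assms R_pos by simp
  then have "e \<in> endp (s / \<bar>R \<sigma>\<bar>)" using \<sigma>(3) zero_in_endp one_in_endp by blast
  then obtain \<tau> e' where \<tau>: "\<tau> \<in> Lam (s / \<bar>R \<sigma>\<bar>)" "e = S \<tau> e'" "e' = 0 \<or> e' = 1" by (auto simp: endpoints_gen_def)
  have "\<sigma> @ \<tau> \<in> Lam s" using Lam_split[OF assms] \<sigma> \<tau> by blast
  moreover have "y = S (\<sigma> @ \<tau>) e'" by (simp add: \<sigma> \<tau> sim_word_append)
  ultimately show "y \<in> endp s" using \<tau>(3) unfolding endpoints_gen_def by blast
qed

text \<open>Coarse end points are also fine end points, so none of them lies inside the fine
  interval.\<close>

lemma Net_nested:
  assumes "(t, a, b) \<in> Net" "(s, a', b') \<in> Net" "s \<le> t" "{a<..<b} \<inter> {a'<..<b'} \<noteq> {}"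
  shows "a \<le> a'" "b' \<le> b"
proof -
  have "a \<in> endp s" "b \<in> endp s" using assms endp_mono[of s t] unfolding in_Net by blast+
  then have "a \<notin> {a'<..<b'}" "b \<notin> {a'<..<b'}" using assms(2) unfolding in_Net by blast+
  moreover obtain z where "z \<in> {a<..<b}" "z \<in> {a'<..<b'}" using assms(4) by blast
  ultimately show "a \<le> a'" "b' \<le> b" by auto
qed

lemma Net_unique:
  assumes "(t, a, b) \<in> Net" "(t, a', b') \<in> Net" "{a<..<b} \<inter> {a'<..<b'} \<noteq> {}"
  shows "a = a'" "b' = b"
proof -
  have "{a'<..<b'} \<inter> {a<..<b} \<noteq> {}" using assms(3) by blast
  then show "a = a'" "b' = b"
    using Net_nested[OF assms(1,2) _ assms(3)] Net_nested[OF assms(2,1)] by auto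
qed

text \<open>Here and in \<open>endp_left\<close> the point \<open>z\<close> may itself be an end
  point; the half-open conditions select the gap on its right or on its left.\<close>

lemma endp_right:
  assumes "t > 0" "0 \<le> z" "z < 1"
  obtains a b where "a \<in> endp t" "b \<in> endp t" "a \<le> z" "z < b" "{a<..<b} \<inter> endp t = {}"
proof -
  define A where "A = {y \<in> endp t. y \<le> z}"
  define B where "B = {y \<in> endp t. z < y}"
  have fin: "finite A" "finite B" using finite_endp[OF assms(1)] by (auto simp: A_def B_def)
  have ne: "A \<noteq> {}" "B \<noteq> {}" using zero_in_endp one_in_endp assms by (auto simp: A_def B_def)
  have "Max A \<in> A" "Min B \<in> B" using fin ne by auto
  then have AB: "Max A \<in> endp t" "Min B \<in> endp t" "Max A \<le> z" "z < Min B"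
    unfolding A_def B_def by blast+
  have gap: "y \<notin> endp t" if "Max A < y" "y < Min B" for y
  proof
    assume y: "y \<in> endp t"
    show False
    proof (cases "y \<le> z")
      case True
      then have "y \<le> Max A" using y fin by (intro Max_ge) (auto simp: A_def)
      then show False using that by simp
    next
      case False
      then have "Min B \<le> y" using y fin by (intro Min_le) (auto simp: B_def)
      then show False using that by simp
    qed
  qed
  show ?thesis by (rule that[OF AB]) (use gap in auto)
qed

lemma endp_left:
  assumes "t > 0" "0 < z" "z \<le> 1"
  obtains a b where "a \<in> endp t" "b \<in> endp t" "a < z" "z \<le> b" "{a<..<b} \<inter> endp t = {}"
proof -
  define A where "A = {y \<in> endp t. y < z}"
  define B where "B = {y \<in> endp t. z \<le> y}"
  have fin: "finite A" "finite B" using finite_endp[OF assms(1)] by (auto simp: A_def B_def)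
  have ne: "A \<noteq> {}" "B \<noteq> {}" using zero_in_endp one_in_endp assms by (auto simp: A_def B_def)
  have "Max A \<in> A" "Min B \<in> B" using fin ne by auto
  then have AB: "Max A \<in> endp t" "Min B \<in> endp t" "Max A < z" "z \<le> Min B"
    unfolding A_def B_def by blast+
  have gap: "y \<notin> endp t" if "Max A < y" "y < Min B" for y
  proof
    assume y: "y \<in> endp t"
    show False
    proof (cases "y < z")
      case True
      then have "y \<le> Max A" using y fin by (intro Max_ge) (auto simp: A_def)
      then show False using that by simp
    next
      case False
      then have "Min B \<le> y" using y fin by (intro Min_le) (auto simp: B_def)
      then show False using that by simp
    qed
  qed
  show ?thesis by (rule that[OF AB]) (use gap in auto)
qed

lemma Net_at:
  assumes "t > 0" "z \<in> K" "z \<notin> endp t"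
  obtains a b where "(t, a, b) \<in> Net" "a < z" "z < b"
proof -
  have "z \<noteq> 0" "z \<noteq> 1" using assms zero_in_endp one_in_endp by auto
  then have "0 \<le> z" "z < 1" using assms(2) K_subset by (auto simp: subset_iff less_le)
  then obtain a b where ab: "a \<in> endp t" "b \<in> endp t" "a \<le> z" "z < b" "{a<..<b} \<inter> endp t = {}"
    using endp_right[OF assms(1)] by metis
  have "a < z" using ab assms(3) by (metis less_le)
  moreover from this have "(t, a, b) \<in> Net" unfolding in_Net using ab assms by force
  ultimately show ?thesis using that ab by blast
qed

lemma Net_point:
  assumes "(s, a, b) \<in> Net" "s \<le> t"
  obtains z where "z \<in> K" "a < z" "z < b" "z \<notin> endp t"
proof -
  obtain z where "z \<in> {a<..<b}" "z \<in> K" using assms unfolding in_Net by blast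
  moreover have "s > 0" "{a<..<b} \<inter> endp s = {}" using assms unfolding in_Net by auto
  ultimately have "z \<notin> endp t" using endp_mono[OF _ assms(2)] by blast
  then show ?thesis using that \<open>z \<in> K\<close> \<open>z \<in> {a<..<b}\<close> by auto
qed

text \<open>For \<open>s\<close> above the transition generation every map seen in the interval has
  ratio below \<open>s\<close> in modulus, so the only continuation is the empty word.\<close>

lemma M_gen_eq:
  assumes "(t, a, b) \<in> Net" "tg (t, a, b) < s" "s \<le> t"
  shows "M s {a<..<b} = M t {a<..<b}"
proof -
  have s: "s > 0" using assms(2) tg_bounds(1)[OF assms(1)] by simp
  have nil: "Lam (s / \<bar>f 1 - f 0\<bar>) = {[]}" if f: "f \<in> M t {a<..<b}" for f
  proof -
    obtain \<sigma> where "\<bar>f 1 - f 0\<bar> = \<bar>R \<sigma>\<bar>" using M_E[OF f] by metis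
    moreover have "\<bar>f 1 - f 0\<bar> < s" using tg_ge[OF assms(1) f] assms(2) by simp
    ultimately show ?thesis using R_pos[of \<sigma>] by (intro Lam_gt_1) simp
  qed
  have meet: "f ` K \<inter> {a<..<b} \<noteq> {}" if "f \<in> M t {a<..<b}" for f
    using that unfolding in_M by blast
  have "M s {a<..<b} = {f \<circ> S \<tau> | f \<tau>. f \<in> M t {a<..<b} \<and> \<tau> \<in> Lam (s / \<bar>f 1 - f 0\<bar>) \<and> (f \<circ> S \<tau>) ` K \<inter> {a<..<b} \<noteq> {}}"
    using s assms(3) by (intro M_refine) auto
  also have "\<dots> = M t {a<..<b}"
  proof (intro subset_antisym subsetI)
    fix f assume f: "f \<in> M t {a<..<b}"
    have "[] \<in> Lam (s / \<bar>f 1 - f 0\<bar>)" using nil[OF f] by simp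
    then show "f \<in> {f \<circ> S \<tau> | f \<tau>. f \<in> M t {a<..<b} \<and> \<tau> \<in> Lam (s / \<bar>f 1 - f 0\<bar>) \<and> (f \<circ> S \<tau>) ` K \<inter> {a<..<b} \<noteq> {}}"
      using f meet[OF f] by (intro CollectI exI[of _ f] exI[of _ "[]"]) simp
  next
    fix g assume "g \<in> {f \<circ> S \<tau> | f \<tau>. f \<in> M t {a<..<b} \<and> \<tau> \<in> Lam (s / \<bar>f 1 - f 0\<bar>) \<and> (f \<circ> S \<tau>) ` K \<inter> {a<..<b} \<noteq> {}}"
    then obtain f \<tau> where f: "f \<in> M t {a<..<b}" "\<tau> \<in> Lam (s / \<bar>f 1 - f 0\<bar>)" "g = f \<circ> S \<tau>" by blast
    then have "\<tau> = []" using nil[OF f(1)] by simp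
    then show "g \<in> M t {a<..<b}" using f by simp
  qed
  finally show ?thesis .
qed

lemma Net_gen_eq:
  assumes "(t, a, b) \<in> Net" "tg (t, a, b) < s" "s \<le> t"
  shows "(s, a, b) \<in> Net" "V (s, a, b) = V (t, a, b)"
proof -
  have s: "s > 0" using assms(2) tg_bounds(1)[OF assms(1)] by simp
  have ab: "a < b" using assms(1) by (simp add: in_Net)
  have "y \<in> endp s \<longleftrightarrow> y \<in> endp t" if "y \<in> {a<..<b}" for y
    using in_endp_iff[OF that, of s] in_endp_iff[OF that, of t] M_gen_eq[OF assms] by simp
  moreover have "a \<in> endp s" "b \<in> endp s" using endp_mono[OF s assms(3)] assms(1) unfolding in_Net by blast+
  ultimately show "(s, a, b) \<in> Net" using assms(1) s unfolding in_Net by blast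
  show "V (s, a, b) = V (t, a, b)" by (simp add: nbr_set_eq[OF ab] M_gen_eq[OF assms])
qed

text \<open>The ends of a map seen in the interval lie outside its interior, so the image of the
  unit interval spans it.\<close>

lemma Net_diam:
  assumes "(t, a, b) \<in> Net"
  shows "b - a < t"
proof -
  obtain f where f: "f \<in> M t {a<..<b}" using Net_M_ne[OF assms] by blast
  obtain \<sigma> where \<sigma>: "\<sigma> \<in> Lam t" "S \<sigma> \<in> M t {a<..<b}" using M_E[OF f] by metis
  then obtain x where x: "x \<in> K" "a < S \<sigma> x" "S \<sigma> x < b" by (auto elim!: M_E simp: in_M)
  have "S \<sigma> 0 \<in> endp t" "S \<sigma> 1 \<in> endp t" using \<sigma> by (auto simp: endpoints_gen_def)
  then have "S \<sigma> 0 \<notin> {a<..<b}" "S \<sigma> 1 \<notin> {a<..<b}" using assms unfolding in_Net by blast+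
  then have "b - a \<le> \<bar>S \<sigma> 1 - S \<sigma> 0\<bar>"
    using S_J_between[of x \<sigma>] x K_subset by (auto simp: min_def max_def split: if_splits)
  then show ?thesis using Lam_R[OF \<sigma>(1)] by (simp add: sim_word_diff)
qed

lemma is_child_iff: "is_child r d K (t, a, b) (s, a', b') \<longleftrightarrow>
    (t, a, b) \<in> Net \<and> (s, a', b') \<in> Net \<and> s = tg (t, a, b) \<and> a \<le> a' \<and> b' \<le> b"
  by (auto simp: is_child_def in_Net)

lemma Net_child:
  assumes "(t, a, b) \<in> Net" "(s, a', b') \<in> Net" "s \<le> tg (t, a, b)" "a \<le> a'" "b' \<le> b"
  obtains a1 b1 where "is_child r d K (t, a, b) (tg (t, a, b), a1, b1)" "a1 \<le> a'" "b' \<le> b1"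
proof -
  obtain z where z: "z \<in> K" "a' < z" "z < b'" "z \<notin> endp (tg (t, a, b))"
    by (rule Net_point[OF assms(2,3)])
  obtain a1 b1 where 1: "(tg (t, a, b), a1, b1) \<in> Net" "a1 < z" "z < b1"
    using Net_at[OF tg_bounds(1)[OF assms(1)] z(1,4)] by metis
  have "z \<in> {a1<..<b1}" "z \<in> {a'<..<b'}" "z \<in> {a<..<b}" using 1 z assms(4,5) by simp_all
  then have "{a1<..<b1} \<inter> {a'<..<b'} \<noteq> {}" "{a<..<b} \<inter> {a1<..<b1} \<noteq> {}" by blast+
  note * = Net_nested[OF 1(1) assms(2,3) this(1)]
    Net_nested[OF assms(1) 1(1) less_imp_le[OF tg_bounds(2)[OF assms(1)]] this(2)]
  have "is_child r d K (t, a, b) (tg (t, a, b), a1, b1)" using * 1(1) assms(1) by (simp add: is_child_iff)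
  then show ?thesis using that *(1,2) by blast
qed

subsection \<open>The transition graph\<close>

lemma wf_G: "wf_digraph G"
  by unfold_locales (auto simp: transition_graph_def edge_label_def is_child_def)

lemma edge_label_in_arcs: "is_child r d K D D' \<Longrightarrow> edge_label r d K D D' \<in> arcs G"
  unfolding transition_graph_def by (simp only: pre_digraph.select_convs) blast

lemma verts_G: "verts G = V ` Net"
  by (simp add: transition_graph_def)

lemma tail_edge_label: "tail G (edge_label r d K D D') = V D"
  and head_edge_label: "head G (edge_label r d K D D') = V D'"
  by (simp_all add: transition_graph_def edge_label_def)

lemma child_dominates: "is_child r d K D D' \<Longrightarrow> V D \<rightarrow>\<^bsub>G\<^esub> V D'"
  using edge_label_in_arcs[of D D']
  by (force simp: arcs_ends_conv tail_edge_label head_edge_label image_iff intro!: bexI[of _ "edge_label r d K D D'"])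

lemma dominates_child:
  assumes "u \<rightarrow>\<^bsub>G\<^esub> v"
  obtains D D' where "is_child r d K D D'" "V D = u" "V D' = v"
  using assms by (auto simp: arcs_ends_conv transition_graph_def edge_label_def)

text \<open>Passing to the child that contains the target lowers the generation to the ratio of a
  word, and that word drops out of the set counted by the induction. Once the transition generation
  lies below \<open>s\<close>, the interval persists down to generation \<open>s\<close> and is the
  target.\<close>

lemma descent:
  assumes "(t, a, b) \<in> Net" "(s, a', b') \<in> Net" "s \<le> t" "a \<le> a'" "b' \<le> b"
  shows "V (t, a, b) \<rightarrow>\<^sup>*\<^bsub>G\<^esub> V (s, a', b')"
  using assms
proof (induction "card {\<sigma>. s \<le> \<bar>R \<sigma>\<bar> \<and> \<bar>R \<sigma>\<bar> < t}" arbitrary: t a b rule: less_induct)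
  case less
  have s: "s > 0" "a' < b'" using less.prems by (auto simp: in_Net)
  show ?case
  proof (cases "tg (t, a, b) < s")
    case True
    have *: "(s, a, b) \<in> Net" "V (s, a, b) = V (t, a, b)"
      using Net_gen_eq[OF less.prems(1) True less.prems(3)] by auto
    obtain z where "z \<in> {a'<..<b'}" using dense[OF s(2)] by auto
    moreover from this have "z \<in> {a<..<b}" using less.prems(4,5) by simp
    ultimately have "{a<..<b} \<inter> {a'<..<b'} \<noteq> {}" by blast
    then have "a = a'" "b = b'" using Net_unique[OF *(1) less.prems(2)] by auto
    then have "V (t, a, b) = V (s, a', b')" using * by simp
    moreover have "V (s, a', b') \<in> verts G" using less.prems(2) by (simp add: verts_G)
    ultimately show ?thesis using wf_digraph.reachable_refl[OF wf_G] by simp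
  next
    case False
    then have le: "s \<le> tg (t, a, b)" by simp
    obtain a1 b1 where 1: "is_child r d K (t, a, b) (tg (t, a, b), a1, b1)" "a1 \<le> a'" "b' \<le> b1"
      using Net_child[OF less.prems(1,2) le less.prems(4,5)] by metis
    obtain \<sigma> where \<sigma>: "tg (t, a, b) = \<bar>R \<sigma>\<bar>" using tg_attained[OF less.prems(1)] by metis
    have "{\<sigma>. s \<le> \<bar>R \<sigma>\<bar> \<and> \<bar>R \<sigma>\<bar> < tg (t, a, b)} \<subset> {\<sigma>. s \<le> \<bar>R \<sigma>\<bar> \<and> \<bar>R \<sigma>\<bar> < t}"
      using tg_bounds(2)[OF less.prems(1)] \<sigma> le by (auto intro!: psubsetI)
    moreover have "finite {\<sigma>. s \<le> \<bar>R \<sigma>\<bar> \<and> \<bar>R \<sigma>\<bar> < t}"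
      by (rule finite_subset[OF _ finite_large_words[OF s(1)]]) auto
    ultimately have "V (tg (t, a, b), a1, b1) \<rightarrow>\<^sup>*\<^bsub>G\<^esub> V (s, a', b')"
      using 1 less.prems(2) le by (intro less.hyps psubset_card_mono) (auto simp: is_child_iff)
    then show ?thesis using child_dominates[OF 1(1)] wf_digraph.adj_reachable_trans[OF wf_G] by metis
  qed
qed

text \<open>An end outside \<open>I\<close> is not controlled by the isomorphism, hence the
  alternatives in the last two assumptions.\<close>

lemma Net_transfer:
  assumes iso: "loc_iso t I t' l c" and s: "s \<le> t" "l * s \<le> t'"
    and net: "(s, a, b) \<in> Net" and I: "{a<..<b} \<subseteq> I"
    and a: "a \<in> I \<or> aff l c a \<in> endp (l * s)" and b: "b \<in> I \<or> aff l c b \<in> endp (l * s)"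
  shows "(l * s, aff l c a, aff l c b) \<in> Net" "V (l * s, aff l c a, aff l c b) = V (s, a, b)"
proof -
  have s0: "s > 0" "a < b" and l: "l > 0" using net iso by (auto simp: in_Net loc_iso_def)
  have "loc_iso s I (l * s) l c" using loc_iso_refine[OF iso s0(1) s] by simp
  then have ab: "aff l c a \<in> endp (l * s)" "aff l c b \<in> endp (l * s)"
    using a b net loc_iso_endp by (auto simp: in_Net)
  have iso': "loc_iso s {a<..<b} (l * s) l c" by (rule loc_iso_refine[OF iso s0(1) s I])
  show "(l * s, aff l c a, aff l c b) \<in> Net"
    by (rule loc_iso_Net[OF iso' net _ ab]) (use l s0 in simp)
  show "V (l * s, aff l c a, aff l c b) = V (s, a, b)"
    by (rule loc_iso_nbr_set[OF iso' s0(2)])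
qed

text \<open>Equal neighbour sets give a local isomorphism between the parents, which scales the
  transition generation by the same factor \<open>l\<close>. Hence a vertex determines its outgoing
  edges.\<close>

lemma child_transfer:
  assumes child: "is_child r d K (t, a, b) (s, a', b')"
    and net: "(t2, a2, b2) \<in> Net" and V: "V (t2, a2, b2) = V (t, a, b)"
  defines "l \<equiv> (b2 - a2) / (b - a)"
  shows "is_child r d K (t2, a2, b2) (l * s, aff l (a2 - l * a) a', aff l (a2 - l * a) b')"
    "V (l * s, aff l (a2 - l * a) a', aff l (a2 - l * a) b') = V (s, a', b')"
proof -
  let ?c = "a2 - l * a"
  have net1: "(t, a, b) \<in> Net" "(s, a', b') \<in> Net" and s: "s = tg (t, a, b)" and le: "a \<le> a'" "b' \<le> b"
    using child by (auto simp: is_child_iff)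
  have ab: "a < b" "a2 < b2" "a' < b'" using net net1 by (auto simp: in_Net)
  note iso = nbr_set_loc_iso[OF V ab(1,2), folded l_def]
  have l: "l > 0" using iso(1) by (simp add: loc_iso_def)
  have tg2: "tg (t2, a2, b2) = l * s"
    using loc_iso_tg[OF iso(1) net1(1)] net by (simp add: iso s)
  have st: "s \<le> t" "l * s \<le> t2" "0 < l * s"
    using tg_bounds[OF net1(1)] tg_bounds[OF net] by (auto simp: s[symmetric] tg2[symmetric])
  \<comment> \<open>An end of the child is either interior to the parent, where the isomorphism
    applies, or an end of the parent, which remains an end point at the finer generation.\<close>
  have "a2 \<in> endp (l * s)" "b2 \<in> endp (l * s)" using net endp_mono[OF st(3,2)] unfolding in_Net by blast+
  then have "a' \<in> {a<..<b} \<or> aff l ?c a' \<in> endp (l * s)" "b' \<in> {a<..<b} \<or> aff l ?c b' \<in> endp (l * s)"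
    using le ab iso(2,3) by (cases "a' = a"; cases "b' = b"; auto)+
  moreover have "{a'<..<b'} \<subseteq> {a<..<b}" using le by auto
  ultimately have *: "(l * s, aff l ?c a', aff l ?c b') \<in> Net"
    "V (l * s, aff l ?c a', aff l ?c b') = V (s, a', b')"
    using Net_transfer[OF iso(1) st(1,2) net1(2)] by auto
  have "a2 \<le> aff l ?c a'" "aff l ?c b' \<le> b2" using le l iso(2,3) by (metis aff_le_iff)+
  then show "is_child r d K (t2, a2, b2) (l * s, aff l ?c a', aff l ?c b')"
    using * le net by (auto simp: is_child_iff tg2)
  show "V (l * s, aff l ?c a', aff l ?c b') = V (s, a', b')" using * le by auto
qed

text \<open>Consecutive edges of a path may come from unrelated net intervals;
  \<open>child_transfer\<close> moves each edge below the interval reached so far.\<close>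

lemma realize:
  assumes "V (t, a, b) \<rightarrow>\<^sup>*\<^bsub>G\<^esub> v" "(t, a, b) \<in> Net"
  obtains s a' b' where "(s, a', b') \<in> Net" "s \<le> t" "a \<le> a'" "b' \<le> b" "V (s, a', b') = v"
proof -
  interpret G: wf_digraph G by (rule wf_G)
  have "\<exists>s a' b'. (s, a', b') \<in> Net \<and> s \<le> t \<and> a \<le> a' \<and> b' \<le> b \<and> V (s, a', b') = v"
    using assms(1)
  proof (induction rule: G.reachable_induct)
    case base
    then show ?case using assms(2) by auto
  next
    case (step u v)
    then obtain s a' b' where s: "(s, a', b') \<in> Net" "s \<le> t" "a \<le> a'" "b' \<le> b" "V (s, a', b') = u" by blast
    obtain D D' where D: "is_child r d K D D'" "V D = u" "V D' = v" by (rule dominates_child[OF step(2)])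
    obtain t1 a1 b1 s1 a1' b1' where D_eq: "D = (t1, a1, b1)" "D' = (s1, a1', b1')" by (metis surj_pair)
    have "V (s, a', b') = V (t1, a1, b1)" using s D D_eq by simp
    note * = child_transfer[OF D(1)[unfolded D_eq] s(1) this]
    define l where "l = (b' - a') / (b1 - a1)"
    have "(l * s1, aff l (a' - l * a1) a1', aff l (a' - l * a1) b1') \<in> Net" "l * s1 < s"
      "a' \<le> aff l (a' - l * a1) a1'" "aff l (a' - l * a1) b1' \<le> b'"
      using *(1) tg_bounds(2)[OF s(1)] by (auto simp: is_child_iff l_def)
    moreover have "V (l * s1, aff l (a' - l * a1) a1', aff l (a' - l * a1) b1') = v"
      using *(2) D(3) by (simp add: l_def D_eq)
    ultimately show ?case using s(2-4)
      by (intro exI[of _ "l * s1"] exI[of _ "aff l (a' - l * a1) a1'"] exI[of _ "aff l (a' - l * a1) b1'"]) auto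
  qed
  then show ?thesis using that by blast
qed

end

subsection \<open>The essential class\<close>

text \<open>An essential class is closed under reachability, so it contains \<open>v0\<close> and
  all that is reached from it; by strong connectedness it contains nothing else.\<close>

lemma (in wf_digraph) essential_class_reachable:
  assumes v0: "v0 \<in> verts G" and reach: "\<And>v. v \<in> verts G \<Longrightarrow> v \<rightarrow>\<^sup>* v0"
  shows "(THE H. essential_class G H) = G \<restriction> {v. v0 \<rightarrow>\<^sup>* v}"
proof (rule the_equality)
  let ?W = "{v. v0 \<rightarrow>\<^sup>* v}"
  have sub: "?W \<subseteq> verts G" using reachable_in_verts by auto
  show "essential_class G (G \<restriction> ?W)"
    unfolding essential_class_def
  proof (intro conjI ballI allI impI)
    show "induced_subgraph (G \<restriction> ?W) G" using sub by (rule induced_induce)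
    show "strongly_connected (G \<restriction> ?W)"
    proof
      show "verts (G \<restriction> ?W) \<noteq> {}" using v0 by auto
      fix u v assume uv: "u \<in> verts (G \<restriction> ?W)" "v \<in> verts (G \<restriction> ?W)"
      have "u \<rightarrow>\<^sup>* v0" using uv sub reach by auto
      moreover have "v0 \<rightarrow>\<^sup>* v" using uv by simp
      ultimately have "u \<rightarrow>\<^sup>* v" by (rule reachable_trans)
      \<comment> \<open>Every \<open>u\<close> of the class reaches exactly \<open>?W\<close>, so
        paths from \<open>u\<close> survive in the restriction.\<close>
      moreover have "{w. u \<rightarrow>\<^sup>* w} = ?W"
        using \<open>u \<rightarrow>\<^sup>* v0\<close> uv(1) by (auto intro: reachable_trans)
      ultimately show "u \<rightarrow>\<^sup>*\<^bsub>G \<restriction> ?W\<^esub> v" using induce_reachable_preserves_paths by metis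
    qed
    fix v w assume "v \<in> verts (G \<restriction> ?W)" "v \<rightarrow>\<^sup>* w"
    then show "w \<in> verts (G \<restriction> ?W)" by (auto intro: reachable_trans)
  qed
  fix H assume "essential_class G H"
  then have H: "induced_subgraph H G" "strongly_connected H" "\<And>v w. v \<in> verts H \<Longrightarrow> v \<rightarrow>\<^sup>* w \<Longrightarrow> w \<in> verts H"
    unfolding essential_class_def by auto
  have sg: "subgraph H G" using H(1) by (rule induced_imp_subgraph)
  obtain v where v: "v \<in> verts H" using H(2) unfolding strongly_connected_def by blast
  then have "v \<in> verts G" using sg by blast
  then have v0H: "v0 \<in> verts H" using H(3)[OF v] reach by blast
  have "verts H = ?W"
  proof (intro subset_antisym subsetI)
    fix w assume "w \<in> ?W"
    then show "w \<in> verts H" using H(3)[OF v0H] by simp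
  next
    fix w assume "w \<in> verts H"
    then have "v0 \<rightarrow>\<^sup>*\<^bsub>H\<^esub> w" using H(2) v0H unfolding strongly_connected_def by blast
    then show "w \<in> ?W" using reachable_mono[OF _ sg] by simp
  qed
  moreover have "G \<restriction> verts H = H" using H(1) by (metis induce_eq_iff_induced)
  ultimately show "H = G \<restriction> ?W" by simp
qed

context ifs_hull
begin

section \<open>Sequences of children and symbolic representations\<close>

lemma child_gen:
  assumes "is_child r d K D D'"
  shows "fst D' = tg D" "fst D' < fst D" "fst D > 0"
proof -
  obtain t a b where D: "D = (t, a, b)" by (metis surj_pair)
  show eq: "fst D' = tg D" using assms by (simp add: is_child_def)
  show "fst D' < fst D" "fst D > 0"
    using assms tg_bounds[of t a b] unfolding eq D is_child_def by (auto simp: in_Net)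
qed

text \<open>After the first, the generations are strictly decreasing moduli of ratios, and only
  finitely many such moduli are at least \<open>e\<close>.\<close>

lemma child_seq_gen_small:
  assumes child: "\<And>n. is_child r d K (D n) (D (Suc n))" and e: "e > 0"
  obtains N where "\<And>n. n \<ge> N \<Longrightarrow> fst (D n) < e"
proof -
  let ?f = "\<lambda>n. fst (D (Suc n))"
  have dec: "strict_mono (\<lambda>n. - fst (D n))"
    using child_gen(2)[OF child] by (simp add: strict_mono_Suc_iff)
  then have "inj (\<lambda>n. fst (D n))" by (metis (mono_tags, lifting) injI strict_mono_eq)
  then have "inj ?f" by (auto simp: inj_def)
  then have inf: "infinite (range ?f)" by (rule range_inj_infinite)
  have "\<exists>n. ?f n < e"
  proof (rule ccontr)
    assume "\<nexists>n. ?f n < e"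
    then have ge: "?f n \<ge> e" for n by (simp add: not_less)
    have "?f n \<in> (\<lambda>\<sigma>. \<bar>R \<sigma>\<bar>) ` {\<sigma>. \<bar>R \<sigma>\<bar> \<ge> e}" for n
    proof -
      obtain t a b where D: "D n = (t, a, b)" by (metis surj_pair)
      have "(t, a, b) \<in> Net" using child[of n] D by (simp add: is_child_def)
      then obtain \<sigma> where "tg (t, a, b) = \<bar>R \<sigma>\<bar>" using tg_attained by metis
      then have "?f n = \<bar>R \<sigma>\<bar>" using child_gen(1)[OF child] D by simp
      then show ?thesis using ge[of n] by auto
    qed
    then have "range ?f \<subseteq> (\<lambda>\<sigma>. \<bar>R \<sigma>\<bar>) ` {\<sigma>. \<bar>R \<sigma>\<bar> \<ge> e}" by blast
    then show False using inf finite_large_words[OF e] finite_subset by blast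
  qed
  then obtain N where N: "fst (D (Suc N)) < e" by blast
  show ?thesis
  proof (rule that)
    fix n assume "n \<ge> Suc N"
    then have "fst (D n) \<le> fst (D (Suc N))" using strict_mono_less_eq[OF dec, of "Suc N" n] by simp
    then show "fst (D n) < e" using N by simp
  qed
qed

lemma endp_large: "t > 1 \<Longrightarrow> endp t = {0, 1}"
  by (simp add: endpoints_gen_def Lam_gt_1)

text \<open>Applied with the relations \<open>a \<le> x < b\<close> and \<open>a < x \<le> b\<close>: it turns the two sides of \<open>x\<close> into
  symbolic representations.\<close>

lemma side_rep:
  assumes ex: "\<And>t. t > 0 \<Longrightarrow> \<exists>a b. (t, a, b) \<in> Net \<and> Q a b"
    and overlap: "\<And>a b a' b'. a < b \<Longrightarrow> a' < b' \<Longrightarrow> Q a b \<Longrightarrow> Q a' b' \<Longrightarrow> {a<..<b} \<inter> {a'<..<b'} \<noteq> {}"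
    and mem: "\<And>a b. Q a b \<Longrightarrow> a \<le> x \<and> x \<le> b"
  obtains D where "symbolic_rep r d K x (\<lambda>n. edge_label r d K (D n) (D (Suc n)))"
    "\<And>n. is_child r d K (D n) (D (Suc n))" "\<And>n. Q (fst (snd (D n))) (snd (snd (D n)))"
proof -
  let ?P = "\<lambda>D. D \<in> Net \<and> Q (fst (snd D)) (snd (snd D))"
  \<comment> \<open>Any generation above 1 may start the sequence, since 0 and 1 are then the only
    end points; 2 is taken.\<close>
  obtain a b where ab: "(2, a, b) \<in> Net" "Q a b" using ex[of 2] by auto
  then have "a = 0" "b = 1" by (auto simp: in_Net endp_large)
  then have base: "?P (2, 0, 1)" using ab by simp
  have step: "\<exists>D'. ?P D' \<and> is_child r d K D D'" if "?P D" for D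
  proof -
    obtain t a b where D: "D = (t, a, b)" by (metis surj_pair)
    have net: "(t, a, b) \<in> Net" and Q: "Q a b" using that D by auto
    note tg = tg_bounds[OF net]
    obtain a' b' where 1: "(tg (t, a, b), a', b') \<in> Net" "Q a' b'" using ex[OF tg(1)] by blast
    have "{a<..<b} \<inter> {a'<..<b'} \<noteq> {}" using overlap[OF _ _ Q 1(2)] net 1(1) by (simp add: in_Net)
    from Net_nested[OF net 1(1) less_imp_le[OF tg(2)] this]
    have "is_child r d K (t, a, b) (tg (t, a, b), a', b')" using net 1 by (simp add: is_child_iff)
    then show ?thesis unfolding D using 1 by (intro exI[of _ "(tg (t, a, b), a', b')"]) simp
  qed
  define D where "D = rec_nat (2, 0, 1) (\<lambda>_ D. SOME D'. ?P D' \<and> is_child r d K D D')"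
  have D_Suc: "?P (D (Suc n)) \<and> is_child r d K (D n) (D (Suc n))" if "?P (D n)" for n
    unfolding D_def using someI_ex[OF step[OF that[unfolded D_def]]] by simp
  have P: "?P (D n)" for n
    by (induction n) (use base D_Suc in \<open>auto simp: D_def\<close>)
  have child: "is_child r d K (D n) (D (Suc n))" for n using D_Suc P by blast
  have x_in: "x \<in> ivl (D n)" for n
    using mem P[of n] by (cases "D n") auto
  have "y = x" if y: "\<And>n. y \<in> ivl (D n)" for y
  proof (rule ccontr)
    assume "y \<noteq> x"
    then have "\<bar>y - x\<bar> > 0" by simp
    then obtain N where "\<And>n. n \<ge> N \<Longrightarrow> fst (D n) < \<bar>y - x\<bar>" using child_seq_gen_small[of D, OF child] by metis
    then have small: "fst (D N) < \<bar>y - x\<bar>" by blast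
    obtain t a b where N: "D N = (t, a, b)" by (metis surj_pair)
    have "b - a < t" using Net_diam P[of N] N by auto
    then show False using small y[of N] x_in[of N] N by auto
  qed
  then have "(\<Inter>n. ivl (D n)) = {x}" using x_in by blast
  moreover have "D 0 = (2, 0, 1)" by (simp add: D_def)
  ultimately have "symbolic_rep r d K x (\<lambda>n. edge_label r d K (D n) (D (Suc n)))"
    unfolding symbolic_rep_def using child by (intro exI[of _ D]) auto
  then show ?thesis using that child P by blast
qed

end

subsection \<open>A net interval reached from every vertex\<close>

text \<open>The data extracted from weak separation: a set \<open>U\<close> on which words of
  positive ratio act as local isomorphisms, and the central net interval
  \<open>(ts, as, bs)\<close>. Its closure lies in \<open>U\<close>, so that
  \<open>Net_transfer\<close> also controls the ends.\<close>

locale centred_ifs = ifs_hull r d K for r d :: "'i::finite \<Rightarrow> real" and K +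
  fixes U :: "real set" and t0 ts as bs :: real
  assumes t0: "0 < t0" "t0 \<le> 1"
    and iso: "\<And>\<tau>. R \<tau> > 0 \<Longrightarrow> loc_iso t0 U (R \<tau> * t0) (R \<tau>) (S \<tau> 0)"
    and central: "(ts, as, bs) \<in> Net" "ts \<le> t0" "{as..bs} \<subseteq> U"
begin

lemma ts: "0 < ts" "ts \<le> 1" "as < bs" "0 \<le> as" "bs \<le> 1"
  using central t0 endp_subset[of ts] by (auto simp: in_Net)

lemma central_copy:
  assumes "R \<tau> > 0"
  shows "(R \<tau> * ts, S \<tau> as, S \<tau> bs) \<in> Net" "V (R \<tau> * ts, S \<tau> as, S \<tau> bs) = V (ts, as, bs)"
proof -
  have "as \<in> U" "bs \<in> U" "{as<..<bs} \<subseteq> U" using central(3) ts by auto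
  then show "(R \<tau> * ts, S \<tau> as, S \<tau> bs) \<in> Net" "V (R \<tau> * ts, S \<tau> as, S \<tau> bs) = V (ts, as, bs)"
    using Net_transfer[OF iso[OF assms] central(2) _ central(1)] central(2) assms
    by (auto simp: S_eq_aff[of \<tau>, symmetric])
qed

lemma central_descendant:
  assumes "(t, a, b) \<in> Net"
  obtains \<tau> where "R \<tau> > 0" "R \<tau> < t" "S \<tau> ` {0..1} \<subseteq> {a<..<b}"
proof -
  obtain z where "z \<in> {a<..<b}" "z \<in> K" using assms unfolding in_Net by blast
  then have z: "a < z" "z < b" "z \<in> K" by auto
  have t: "t > 0" using assms by (simp add: in_Net)
  define e where "e = Min {z - a, b - z, t}"
  have e: "e > 0" "e \<le> z - a" "e \<le> b - z" "e \<le> t" using z t by (auto simp: e_def)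
  obtain \<tau> where \<tau>: "S \<tau> ` {0..1} \<subseteq> ball z e" "R \<tau> > 0" "R \<tau> < e"
    by (rule small_image[OF z(3) e(1)])
  have "ball z e \<subseteq> {a<..<b}" using e by (auto simp: ball_eq_greaterThanLessThan)
  then show ?thesis using that[OF \<tau>(2)] \<tau> e by auto
qed

text \<open>Some word of positive ratio maps the unit interval into the given net interval, and it
  carries the central interval to a net interval with the central vertex.\<close>

lemma reaches_central:
  assumes "v \<in> verts G"
  shows "v \<rightarrow>\<^sup>*\<^bsub>G\<^esub> V (ts, as, bs)"
proof -
  obtain t a b where net: "(t, a, b) \<in> Net" "v = V (t, a, b)" using assms by (auto simp: verts_G)
  obtain \<tau> where \<tau>: "R \<tau> > 0" "R \<tau> < t" "S \<tau> ` {0..1} \<subseteq> {a<..<b}" by (rule central_descendant[OF net(1)])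
  have "S \<tau> as \<in> {a<..<b}" "S \<tau> bs \<in> {a<..<b}" using \<tau>(3) ts by (auto simp: image_subset_iff)
  moreover have "R \<tau> * ts \<le> t" using mult_left_le[of ts "R \<tau>"] ts \<tau>(1,2) by linarith
  ultimately have "V (t, a, b) \<rightarrow>\<^sup>*\<^bsub>G\<^esub> V (R \<tau> * ts, S \<tau> as, S \<tau> bs)"
    using \<tau> by (intro descent[OF net(1) central_copy(1)[OF \<tau>(1)]]) auto
  then show ?thesis by (simp add: central_copy(2)[OF \<tau>(1)] net(2))
qed

lemma ess_graph_eq: "ess_graph r d K = G \<restriction> {v. V (ts, as, bs) \<rightarrow>\<^sup>*\<^bsub>G\<^esub> v}"
  unfolding ess_graph_def
  by (rule wf_digraph.essential_class_reachable[OF wf_G]) (use central in \<open>auto simp: verts_G intro: reaches_central[unfolded verts_G]\<close>)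

lemma K_ess_rep:
  assumes "x \<in> K_ess r d K" "symbolic_rep r d K x (\<lambda>n. edge_label r d K (D n) (D (Suc n)))"
  obtains n where "V (ts, as, bs) \<rightarrow>\<^sup>*\<^bsub>G\<^esub> V (D n)"
proof -
  obtain N where "\<And>k. k \<ge> N \<Longrightarrow> edge_label r d K (D k) (D (Suc k)) \<in> arcs (ess_graph r d K)"
    using assms unfolding K_ess_def by blast
  then have "edge_label r d K (D N) (D (Suc N)) \<in> arcs (ess_graph r d K)" by blast
  then have "V (ts, as, bs) \<rightarrow>\<^sup>*\<^bsub>G\<^esub> V (D N)" by (simp add: ess_graph_eq tail_edge_label)
  then show ?thesis by (rule that)
qed

end

subsection \<open>Periodic points\<close>

lemma mod_periodic:
  fixes f :: "nat \<Rightarrow> 'b"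
  assumes "\<And>i. f (n + (i + p)) = f (n + i)"
  shows "f (n + k) = f (n + k mod p)"
proof (induction k rule: less_induct)
  case (less k)
  show ?case
  proof (cases "p = 0 \<or> k < p")
    case False
    then have "f (n + k) = f (n + ((k - p) + p))" by simp
    also have "\<dots> = f (n + (k - p))" by (rule assms)
    also have "\<dots> = f (n + (k - p) mod p)" using False by (intro less.IH) auto
    also have "(k - p) mod p = k mod p" using False by (simp add: le_mod_geq)
    finally show ?thesis .
  qed auto
qed

context ifs_hull
begin

lemma child_path:
  assumes child: "\<And>n. is_child r d K (D n) (D (Suc n))" and "i \<le> j"
  shows "pre_digraph.awalk G (V (D i)) (map (\<lambda>n. edge_label r d K (D n) (D (Suc n))) [i..<j]) (V (D j))"
  using assms(2)
proof (induction "j - i" arbitrary: i)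
  case 0
  have "V (D i) \<in> verts G" using child[of i] by (auto simp: verts_G is_child_def)
  then show ?case using 0 by (simp add: pre_digraph.awalk_def pre_digraph.cas.simps)
next
  case (Suc m)
  have "V (D i) \<in> verts G" using child[of i] by (auto simp: verts_G is_child_def)
  moreover have "pre_digraph.awalk G (V (D (Suc i))) (map (\<lambda>n. edge_label r d K (D n) (D (Suc n))) [Suc i..<j]) (V (D j))"
    using Suc by (intro Suc.hyps) auto
  ultimately show ?case using Suc.hyps(2) edge_label_in_arcs[OF child]
    by (simp add: upt_conv_Cons pre_digraph.awalk_def pre_digraph.cas.simps tail_edge_label head_edge_label)
qed

text \<open>At this \<open>n\<close> the value \<open>u\<close> lies above the transition generation
  of \<open>D n\<close> and not above its generation, so by \<open>Net_gen_eq\<close>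
  \<open>D n\<close> is also a net interval of generation \<open>u\<close>. Minimality is used to
  order the indices of different scales.\<close>

lemma rep_enters:
  assumes child: "\<And>n. is_child r d K (D n) (D (Suc n))" and u: "0 < u" "u < fst (D 0)"
  obtains n where "fst (D (Suc n)) < u" "u \<le> fst (D n)" "\<And>k. fst (D (Suc k)) < u \<Longrightarrow> n \<le> k"
proof -
  obtain N where "\<And>n. n \<ge> N \<Longrightarrow> fst (D n) < u" using child_seq_gen_small[of D, OF child u(1)] by metis
  then have ex: "\<exists>n. fst (D (Suc n)) < u" by (metis le_Suc_eq le_refl)
  define n where "n = (LEAST n. fst (D (Suc n)) < u)"
  have "fst (D (Suc n)) < u" unfolding n_def using ex by (rule LeastI_ex)
  moreover have least: "n \<le> k" if "fst (D (Suc k)) < u" for k unfolding n_def using that by (rule Least_le)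
  moreover have "u \<le> fst (D n)"
  proof (cases n)
    case 0
    then show ?thesis using u by simp
  next
    case (Suc m)
    then show ?thesis using least[of m] by (meson Suc_n_not_le_n not_le)
  qed
  ultimately show ?thesis using that by blast
qed

lemma S_power:
  assumes "S \<omega> y = y"
  shows "R (concat (replicate k \<omega>)) = R \<omega> ^ k" "S (concat (replicate k \<omega>)) z = y + R \<omega> ^ k * (z - y)"
proof -
  show R: "R (concat (replicate k \<omega>)) = R \<omega> ^ k"
    by (induction k) (simp_all add: ratio_word_append)
  have "S (concat (replicate k \<omega>)) y = y"
    by (induction k) (simp_all add: sim_word_append assms)
  then show "S (concat (replicate k \<omega>)) z = y + R \<omega> ^ k * (z - y)"
    using sim_word_diff[of r d "concat (replicate k \<omega>)" z y] R by simp
qed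

end

context centred_ifs
begin

text \<open>\<open>S \<omega> 0 / (1 - R \<omega>)\<close> is the fixed point of
  \<open>S \<omega>\<close>; it is interior because the ends of the central interval move
  inwards.\<close>

lemma contracting_word:
  assumes pos: "R \<omega> > 0" and inside: "S \<omega> ` {0..1} \<subseteq> {as<..<bs}"
  shows "R \<omega> < 1" "S \<omega> (S \<omega> 0 / (1 - R \<omega>)) = S \<omega> 0 / (1 - R \<omega>)"
    "as < S \<omega> 0 / (1 - R \<omega>)" "S \<omega> 0 / (1 - R \<omega>) < bs"
proof -
  have *: "as < S \<omega> x" "S \<omega> x < bs" if "0 \<le> x" "x \<le> 1" for x
    using inside that by (auto simp: image_subset_iff)
  have "\<omega> \<noteq> []" using *(1)[of 0] ts by auto
  then show less: "R \<omega> < 1" using R_less_1 pos by fastforce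
  let ?y = "S \<omega> 0 / (1 - R \<omega>)"
  show fixpt: "S \<omega> ?y = ?y" using less by (subst sim_word_affine) (simp add: field_simps)
  define y where "y = ?y"
  have "as < S \<omega> as" "S \<omega> bs < bs" using * ts by auto
  moreover have "S \<omega> as = y + R \<omega> * (as - y)" "S \<omega> bs = y + R \<omega> * (bs - y)"
    using sim_word_diff[of r d \<omega> _ y] fixpt[folded y_def] by (simp_all add: algebra_simps)
  ultimately have "0 < (1 - R \<omega>) * (y - as)" "0 < (1 - R \<omega>) * (bs - y)"
    by (simp_all add: algebra_simps)
  then have "as < y" "y < bs" using less by (simp_all add: zero_less_mult_iff)
  then show "as < ?y" "?y < bs" by (simp_all add: y_def)
qed

text \<open>The images of the central interval under the powers of \<open>S \<omega>\<close> shrink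
  to \<open>y\<close> and carry one vertex. As \<open>y\<close> is interior to net intervals of
  arbitrarily small generation, it is never an end point, so every symbolic representation of
  \<open>y\<close> passes through these images.\<close>

lemma periodic_point:
  assumes pos: "R \<omega> > 0" and inside: "S \<omega> ` {0..1} \<subseteq> {as<..<bs}"
  shows "S \<omega> 0 / (1 - R \<omega>) \<in> periodic_points r d K"
proof -
  define y where "y = S \<omega> 0 / (1 - R \<omega>)"
  define l where "l = R \<omega>"
  note y = contracting_word[OF assms, folded y_def l_def]
  have l: "0 < l" "l < 1" using pos y by (auto simp: l_def)
  note pow = S_power[OF y(2), folded l_def]
  have net: "(l ^ k * ts, y + l ^ k * (as - y), y + l ^ k * (bs - y)) \<in> Net"
    "V (l ^ k * ts, y + l ^ k * (as - y), y + l ^ k * (bs - y)) = V (ts, as, bs)" for k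
    using central_copy[of "concat (replicate k \<omega>)"] l by (simp_all add: pow)
  have inner: "y + l ^ k * (as - y) < y" "y < y + l ^ k * (bs - y)" for k
    using y l by (simp_all add: mult_pos_neg)
  have yK: "y \<in> K"
  proof (rule closed_sequentially)
    show "closed K" using K_compact by (rule compact_imp_closed)
    show "S (concat (replicate k \<omega>)) 0 \<in> K" for k using S_K zero_in_K by blast
    have "(\<lambda>k. y + l ^ k * (0 - y)) \<longlonglongrightarrow> y + 0 * (0 - y)"
      using l by (intro tendsto_intros LIMSEQ_realpow_zero) auto
    then show "(\<lambda>k. S (concat (replicate k \<omega>)) 0) \<longlonglongrightarrow> y" by (simp add: pow)
  qed
  have y_endp: "y \<notin> endp t" if t: "t > 0" for t
  proof
    assume "y \<in> endp t"
    obtain k where "l ^ k < t" using real_arch_pow_inv[OF t l(2)] by blast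
    moreover have "l ^ k * ts \<le> l ^ k" using ts l by (intro mult_left_le) auto
    ultimately have "l ^ k * ts \<le> t" by linarith
    then have "y \<in> endp (l ^ k * ts)" using endp_mono[of "l ^ k * ts" t] \<open>y \<in> endp t\<close> ts l by auto
    moreover have "y \<in> {y + l ^ k * (as - y)<..<y + l ^ k * (bs - y)}" using inner by simp
    ultimately show False using net(1)[of k] unfolding in_Net by blast
  qed
  have interior: "a < y \<and> y < b" if "(t, a, b) \<in> Net" "a \<le> y" "y \<le> b" for t a b
    using that y_endp[of t] unfolding in_Net by (metis less_le)
  have "\<exists>n \<theta>. closed_path G \<theta> \<and> (\<forall>k. e (n + k) = \<theta> ! (k mod length \<theta>))" if e: "symbolic_rep r d K y e" for e
  proof -
    obtain D t where D: "t > 1" "D 0 = (t, 0, 1)" "\<And>n. is_child r d K (D n) (D (Suc n))"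
      "(\<Inter>n. ivl (D n)) = {y}" "\<And>n. e n = edge_label r d K (D n) (D (Suc n))"
      using e unfolding symbolic_rep_def by blast
    define tt aa bb where "tt n = fst (D n)" and "aa n = fst (snd (D n))" and "bb n = snd (snd (D n))" for n
    have D_eq: "D n = (tt n, aa n, bb n)" for n by (simp add: tt_def aa_def bb_def)
    have child: "is_child r d K (tt n, aa n, bb n) (tt (Suc n), aa (Suc n), bb (Suc n))" for n
      using D(3) by (simp add: D_eq[symmetric])
    have nets: "(tt n, aa n, bb n) \<in> Net" for n using child[of n] by (simp add: is_child_iff)
    have "y \<in> ivl (D n)" for n using D(4) by blast
    then have y_in: "aa n < y \<and> y < bb n" for n using interior[OF nets] by (simp add: D_eq)
    \<comment> \<open>The \<open>k\<close>-th image appears at the last index whose generation is at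
      least \<open>l ^ k * ts\<close>, possibly under a larger generation than its own.\<close>
    have stage: "\<exists>n. aa n = y + l ^ k * (as - y) \<and> bb n = y + l ^ k * (bs - y) \<and> V (D n) = V (ts, as, bs) \<and>
        tt (Suc n) < l ^ k * ts \<and> (\<forall>j. tt (Suc j) < l ^ k * ts \<longrightarrow> n \<le> j)" for k
    proof -
      have "0 < l ^ k * ts" using l ts by simp
      moreover have "l ^ k * ts < fst (D 0)"
        using mult_le_one[of "l ^ k" ts] l ts D(1,2) by (simp add: power_le_one)
      ultimately obtain n where n: "tt (Suc n) < l ^ k * ts" "l ^ k * ts \<le> tt n" "\<And>j. tt (Suc j) < l ^ k * ts \<Longrightarrow> n \<le> j"
        using rep_enters[of D, OF D(3)] unfolding tt_def by metis
      have "tg (tt n, aa n, bb n) < l ^ k * ts" using child[of n] n(1) by (simp add: is_child_iff)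
      note 1 = Net_gen_eq[OF nets this n(2)]
      have "y \<in> {aa n<..<bb n}" "y \<in> {y + l ^ k * (as - y)<..<y + l ^ k * (bs - y)}" using inner y_in by auto
      then have "{aa n<..<bb n} \<inter> {y + l ^ k * (as - y)<..<y + l ^ k * (bs - y)} \<noteq> {}" by blast
      note 2 = Net_unique[OF 1(1) net(1) this]
      show ?thesis using 1 2 net(2)[of k] n by (intro exI[of _ n]) (simp add: D_eq)
    qed
    obtain n where n: "aa n = y + (as - y)" "bb n = y + (bs - y)" "V (D n) = V (ts, as, bs)"
      "\<And>j. tt (Suc j) < ts \<Longrightarrow> n \<le> j" using stage[of 0] by auto
    obtain m where m: "aa m = y + l * (as - y)" "bb m = y + l * (bs - y)" "V (D m) = V (ts, as, bs)"
      "tt (Suc m) < l * ts" using stage[of 1] by auto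
    have "l * ts < ts" using l ts by simp
    then have "n \<le> m" using n(4) m(4) by simp
    moreover have "n \<noteq> m"
    proof
      assume "n = m"
      then have "(1 - l) * (as - y) = 0" using n(1) m(1) by (simp add: algebra_simps)
      then show False using y(3) l by simp
    qed
    ultimately have nm: "n < m" by simp
    \<comment> \<open>Scaling about \<open>y\<close> carries the child at \<open>n + i\<close> to a
      child at \<open>m + i\<close>. It has \<open>y\<close> in its interior, so it is the next
      interval of the representation.\<close>
    have shift: "aa (m + i) = y + l * (aa (n + i) - y) \<and> bb (m + i) = y + l * (bb (n + i) - y) \<and> V (D (m + i)) = V (D (n + i))" for i
    proof (induction i)
      case 0
      then show ?case using n m by simp
    next
      case (Suc i)
      have ab: "aa (n + i) < bb (n + i)" using y_in[of "n + i"] by simp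
      have l_eq: "(bb (m + i) - aa (m + i)) / (bb (n + i) - aa (n + i)) = l"
        using Suc ab by (simp add: field_simps)
      have aff_eq: "aff l (aa (m + i) - l * aa (n + i)) z = y + l * (z - y)" for z
        using Suc by (simp add: aff_def algebra_simps)
      have "V (tt (m + i), aa (m + i), bb (m + i)) = V (tt (n + i), aa (n + i), bb (n + i))"
        using Suc unfolding D_eq by blast
      note 1 = child_transfer[OF child nets this, unfolded l_eq aff_eq]
      let ?a = "y + l * (aa (Suc (n + i)) - y)" and ?b = "y + l * (bb (Suc (n + i)) - y)"
      have gen: "l * tt (Suc (n + i)) = tt (Suc (m + i))" using 1(1) child[of "m + i"] by (simp add: is_child_iff)
      have "y \<in> {aa (Suc (m + i))<..<bb (Suc (m + i))}" "y \<in> {?a<..<?b}"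
        using y_in l by (simp_all add: mult_pos_neg)
      then have "{aa (Suc (m + i))<..<bb (Suc (m + i))} \<inter> {?a<..<?b} \<noteq> {}" by blast
      moreover have "(tt (Suc (m + i)), ?a, ?b) \<in> Net" using 1(1) unfolding is_child_iff gen by blast
      ultimately have "aa (Suc (m + i)) = ?a" "bb (Suc (m + i)) = ?b" using Net_unique[OF nets] by metis+
      then show ?case using 1(2) by (simp add: gen D_eq)
    qed
    have per: "e (n + (i + (m - n))) = e (n + i)" for i
    proof -
      have eq: "n + (i + (m - n)) = m + i" using nm by simp
      have "position_index (D (m + i)) (D (Suc (m + i))) = position_index (D (n + i)) (D (Suc (n + i)))"
        using shift[of i] shift[of "Suc i"] l by (simp add: D_eq) (simp add: right_diff_distrib[symmetric])
      then show ?thesis unfolding eq D(5) edge_label_def using shift[of i] shift[of "Suc i"] by simp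
    qed
    let ?\<theta> = "map (\<lambda>n. edge_label r d K (D n) (D (Suc n))) [n..<m]"
    have "closed_path G ?\<theta>"
      unfolding closed_path_def using child_path[of D n m, OF D(3)] nm n(3) m(3) by auto
    moreover have "e (n + k) = ?\<theta> ! (k mod length ?\<theta>)" for k
    proof -
      have "k mod (m - n) < m - n" using nm by (intro mod_less_divisor) simp
      then have "n + k mod (m - n) < m" using nm by linarith
      then show ?thesis
        using mod_periodic[where f=e and n=n and p="m - n" and k=k, OF per] nm by (simp add: D(5) nth_upt)
    qed
    ultimately show ?thesis by blast
  qed
  then show ?thesis using yK unfolding periodic_points_def y_def by blast
qed

end

subsection \<open>Weak separation provides a central net interval\<close>

context ifs_hull
begin

lemma aff_image_ball: "l > 0 \<Longrightarrow> aff l c ` ball x e = ball (aff l c x) (l * e)"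
  by (simp add: ball_eq_greaterThanLessThan aff_image_greaterThanLessThan) (simp add: aff_def algebra_simps)

lemma inj_comp_aff: "l > 0 \<Longrightarrow> inj (\<lambda>f. aff l c \<circ> f)"
  by (intro injI ext) (metis aff_eq_iff comp_apply)

text \<open>In a ball with the maximal number of maps, the images of these maps under a further word
  already exhaust the maps seen in the image of the ball.\<close>

lemma maximal_ball_loc_iso:
  assumes t0: "0 < t0" "t0 \<le> 1"
    and maximal: "\<And>x t. t > 0 \<Longrightarrow> card (M t (ball x t)) \<le> card (M t0 (ball x0 t0))"
    and pos: "R \<tau> > 0"
  shows "loc_iso t0 (ball x0 t0) (R \<tau> * t0) (R \<tau>) (S \<tau> 0)"
proof -
  let ?A = "(\<lambda>f. aff (R \<tau>) (S \<tau> 0) \<circ> f) ` M t0 (ball x0 t0)"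
  let ?B = "M (R \<tau> * t0) (ball (S \<tau> x0) (R \<tau> * t0))"
  have ball: "aff (R \<tau>) (S \<tau> 0) ` ball x0 t0 = ball (S \<tau> x0) (R \<tau> * t0)"
    using aff_image_ball[OF pos, of "S \<tau> 0" x0 t0] by (simp add: S_eq_aff[of \<tau>, symmetric])
  have "?A \<subseteq> ?B"
  proof
    fix g assume "g \<in> ?A"
    then obtain \<sigma> where \<sigma>: "\<sigma> \<in> Lam t0" "S \<sigma> ` K \<inter> ball x0 t0 \<noteq> {}" "g = S \<tau> \<circ> S \<sigma>"
      by (auto simp: S_eq_aff[of \<tau>, symmetric] maps_meeting_def)
    \<comment> \<open>\<open>t0 \<le> 1\<close> excludes the empty word, so the last letter of
      \<open>\<tau> @ \<sigma>\<close> belongs to \<open>\<sigma>\<close>.\<close>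
    have "\<sigma> \<noteq> []" using \<sigma>(1) t0 by (auto simp: Nil_in_Lam)
    then have "\<tau> @ \<sigma> \<in> Lam (R \<tau> * t0)"
      using \<sigma>(1) pos by (auto simp: words_gen_def ratio_word_append butlast_append abs_mult)
    moreover obtain x where "x \<in> K" "S \<sigma> x \<in> ball x0 t0" using \<sigma>(2) by blast
    then have "S (\<tau> @ \<sigma>) x \<in> ball (S \<tau> x0) (R \<tau> * t0)"
      unfolding ball[symmetric] by (auto simp: sim_word_append S_eq_aff[of \<tau>, symmetric])
    then have "S (\<tau> @ \<sigma>) ` K \<inter> ball (S \<tau> x0) (R \<tau> * t0) \<noteq> {}" using \<open>x \<in> K\<close> by blast
    ultimately show "g \<in> ?B" unfolding in_M \<sigma>(3) sim_word_append[symmetric] by blast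
  qed
  moreover have "card ?A = card (M t0 (ball x0 t0))"
    by (intro card_image inj_on_subset[OF inj_comp_aff[OF pos]]) simp
  ultimately have "?A = ?B" using maximal[of "R \<tau> * t0" "S \<tau> x0"] pos t0
    by (intro card_seteq finite_M) simp_all
  then show ?thesis using pos by (simp add: loc_iso_def ball)
qed

text \<open>A bounded set of counts has a maximum. Scales above 1 see only the identity, so a
  maximum attained there is 1 and is also attained by \<open>ball 0 1\<close> at scale 1.\<close>

lemma maximal_ball_exists:
  assumes "weak_separation r d K"
  obtains x0 t0 where "0 < t0" "t0 \<le> 1" "M t0 (ball x0 t0) \<noteq> {}"
    "\<And>x t. t > 0 \<Longrightarrow> card (M t (ball x t)) \<le> card (M t0 (ball x0 t0))"
proof -
  obtain C where C: "\<And>x t. t > 0 \<Longrightarrow> card (M t (ball x t)) \<le> C"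
    using assms unfolding weak_separation_def by blast
  define A where "A = {card (M t (ball x t)) | x t. t > 0}"
  have A: "finite A" "A \<noteq> {}" using C by (auto simp: A_def intro!: finite_subset[of _ "{..C}"] exI[of _ 1])
  have "Max A \<in> A" using A by (rule Max_in)
  then obtain x1 t1 where 1: "t1 > 0" "Max A = card (M t1 (ball x1 t1))" unfolding A_def by blast
  have max: "card (M t (ball x t)) \<le> Max A" if "t > 0" for x t
    using A(1) that by (intro Max_ge) (auto simp: A_def)
  obtain \<sigma> x where \<sigma>: "\<sigma> \<in> Lam 1" "x \<in> K" "S \<sigma> x = 0" using K_word[of 1 0] zero_in_K by auto
  then have "S \<sigma> ` K \<inter> ball 0 1 \<noteq> {}" by (metis IntI centre_in_ball emptyE imageI zero_less_one)
  then have ne: "M 1 (ball 0 1) \<noteq> {}" using \<sigma>(1) unfolding maps_meeting_def by blast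
  then have ge1: "1 \<le> card (M 1 (ball 0 1))" using finite_M[of 1] by (simp add: Suc_le_eq card_gt_0_iff)
  show ?thesis
  proof (cases "t1 \<le> 1")
    case True
    have "1 \<le> card (M t1 (ball x1 t1))" using ge1 max[of 1 0] 1 by simp
    then have "M t1 (ball x1 t1) \<noteq> {}" by auto
    then show ?thesis using that[OF 1(1) True] max 1(2) by simp
  next
    case False
    then have "M t1 (ball x1 t1) \<subseteq> {id}" by (auto simp: maps_meeting_def Lam_gt_1)
    then have "card (M t1 (ball x1 t1)) \<le> 1" using card_mono[of "{id}"] by simp
    then show ?thesis using that[of 1 0] ne ge1 max 1(2) by (metis le_trans order_refl zero_less_one)
  qed
qed

text \<open>Near a point \<open>z\<close> of \<open>K\<close> in the maximal ball there are
  infinitely many points of \<open>K\<close> but finitely many end points of generation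
  \<open>ts\<close>. The margin \<open>e\<close> is split between the distance of \<open>z'\<close>
  from \<open>z\<close> and the diameter of the net interval around \<open>z'\<close>.\<close>

lemma centred_ifs_exists:
  assumes "weak_separation r d K"
  obtains U t0 ts as bs where "centred_ifs r d K U t0 ts as bs"
proof -
  obtain x0 t0 where t0: "0 < t0" "t0 \<le> 1" and ne: "M t0 (ball x0 t0) \<noteq> {}" and
    maximal: "\<And>x t. t > 0 \<Longrightarrow> card (M t (ball x t)) \<le> card (M t0 (ball x0 t0))"
    using maximal_ball_exists[OF assms] by metis
  obtain f where "f \<in> M t0 (ball x0 t0)" using ne by blast
  then obtain z where z: "z \<in> K" "z \<in> ball x0 t0" using S_K unfolding in_M by blast
  obtain e where e: "e > 0" "ball z e \<subseteq> ball x0 t0" using z(2) openE[OF open_ball] by metis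
  define ts where "ts = min t0 (e / 2)"
  have ts: "ts > 0" "ts \<le> t0" "ts \<le> e / 2" using e t0 by (auto simp: ts_def)
  have "infinite (ball z (e / 2) \<inter> K)" using z e by (intro infinite_K_Int[of _ z]) auto
  then have "\<not> ball z (e / 2) \<inter> K \<subseteq> endp ts" using finite_subset[OF _ finite_endp[OF ts(1)]] by metis
  then obtain z' where z': "z' \<in> ball z (e / 2)" "z' \<in> K" "z' \<notin> endp ts" by blast
  obtain a b where net: "(ts, a, b) \<in> Net" "a < z'" "z' < b" using Net_at[OF ts(1) z'(2,3)] by metis
  have "{a..b} \<subseteq> ball z e"
  proof
    fix u assume u: "u \<in> {a..b}"
    have "a \<le> u" "u \<le> b" using u by simp_all
    then have "\<bar>u - z'\<bar> < e / 2" using Net_diam[OF net(1)] net(2,3) ts(3) by linarith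
    moreover have "\<bar>z - z'\<bar> < e / 2" using z'(1) by (simp add: dist_real_def)
    ultimately have "\<bar>z - u\<bar> < e" by linarith
    then show "u \<in> ball z e" by (simp add: dist_real_def)
  qed
  then have "centred_ifs r d K (ball x0 t0) t0 ts a b"
    using t0 maximal_ball_loc_iso[OF t0 maximal] net ts e by unfold_locales auto
  then show ?thesis by (rule that)
qed

end

subsection \<open>Self-similar measures\<close>

locale ssm = ifs_hull r d K for r d :: "'i::finite \<Rightarrow> real" and K +
  fixes p :: "'i \<Rightarrow> real" and \<mu> :: "real measure"
  assumes p_pos: "\<And>i. p i > 0" and p_sum: "(\<Sum>i\<in>UNIV. p i) = 1"
    and ssm: "self_similar_measure r d p \<mu>"
begin

sublocale prob_space \<mu>
  using ssm by (simp add: self_similar_measure_def)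

abbreviation W :: "'i list \<Rightarrow> real" where "W \<equiv> word_weight p"

lemma sets_mu: "sets \<mu> = sets borel" and
  ssm_eq: "E \<in> sets borel \<Longrightarrow> measure \<mu> E = (\<Sum>i\<in>UNIV. p i * measure \<mu> (sim r d i -` E))"
  using ssm by (auto simp: self_similar_measure_def)

lemma space_mu: "space \<mu> = UNIV"
  using sets_eq_imp_space_eq[OF sets_mu] by simp

lemma W_pos: "W \<sigma> > 0"
  using p_pos by (rule word_weight_pos)

lemma p_le_1: "p i \<le> 1"
  using p_sum p_pos member_le_sum[of i UNIV p] by (auto simp: less_imp_le)

lemma W_le_1: "W \<sigma> \<le> 1"
proof (induction \<sigma>)
  case (Cons i \<sigma>)
  then show ?case using p_le_1[of i] p_pos[of i] W_pos[of \<sigma>] by (simp add: mult_le_one less_imp_le)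
qed simp

lemma aff_vimage_borel: "E \<in> sets borel \<Longrightarrow> aff l c -` E \<in> sets borel"
proof -
  have "aff l c \<in> borel_measurable borel" unfolding aff_def by measurable
  then show "E \<in> sets borel \<Longrightarrow> aff l c -` E \<in> sets borel" using measurable_sets_borel by blast
qed

lemma S_vimage_borel: "E \<in> sets borel \<Longrightarrow> S \<sigma> -` E \<in> sets borel"
  using aff_vimage_borel S_eq_aff by metis

lemma sim_vimage_borel: "E \<in> sets borel \<Longrightarrow> sim r d i -` E \<in> sets borel"
  using S_vimage_borel[of E "[i]"] by simp

lemma aff_image_borel: "l \<noteq> 0 \<Longrightarrow> E \<in> sets borel \<Longrightarrow> aff l c ` E \<in> sets borel"
proof -
  assume l: "l \<noteq> 0" and E: "E \<in> sets borel"
  have "aff l c ` E = aff (1 / l) (- c / l) -` E"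
  proof (intro set_eqI iffI)
    fix y assume "y \<in> aff (1 / l) (- c / l) -` E"
    moreover have "y = aff l c (aff (1 / l) (- c / l) y)" using l by (simp add: aff_def field_simps)
    ultimately show "y \<in> aff l c ` E" by auto
  qed (use l in \<open>auto simp: aff_def diff_divide_distrib[symmetric] add_divide_distrib\<close>)
  then show ?thesis using aff_vimage_borel[OF E] by simp
qed

lemma S_image_borel: "E \<in> sets borel \<Longrightarrow> S \<sigma> ` E \<in> sets borel"
  using aff_image_borel[OF R_neq_0] S_eq_aff by metis

lemma S_vimage_image: "S \<sigma> -` S \<sigma> ` E = E"
  using S_inj by (rule inj_vimage_image_eq)

lemma measure_mono: "A \<subseteq> B \<Longrightarrow> B \<in> sets borel \<Longrightarrow> measure \<mu> A \<le> measure \<mu> B"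
  using finite_measure_mono[of A B] by (simp add: sets_mu)

section \<open>Decomposition of the measure along words\<close>

lemma measure_cut:
  assumes "t > 0" "E \<in> sets borel"
  shows "measure \<mu> E = (\<Sum>\<sigma>\<in>Lam t. W \<sigma> * measure \<mu> (S \<sigma> -` E))"
  using assms
proof (induction t arbitrary: E rule: Lam_induct)
  case (big t)
  then show ?case by (simp add: Lam_gt_1)
next
  case (small t)
  have fin: "finite (Lam (t / \<bar>r i\<bar>))" for i using small.hyps r_neq_0[of i] by (intro finite_Lam) simp
  have "measure \<mu> E = (\<Sum>i\<in>UNIV. p i * measure \<mu> (sim r d i -` E))" using small.prems by (rule ssm_eq)
  also have "\<dots> = (\<Sum>i\<in>UNIV. p i * (\<Sum>\<sigma>\<in>Lam (t / \<bar>r i\<bar>). W \<sigma> * measure \<mu> (S \<sigma> -` sim r d i -` E)))"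
    using small.IH[OF sim_vimage_borel[OF small.prems]] by simp
  also have "\<dots> = (\<Sum>i\<in>UNIV. \<Sum>\<sigma>\<in>Lam (t / \<bar>r i\<bar>). W (i # \<sigma>) * measure \<mu> (S (i # \<sigma>) -` E))"
    by (simp add: sum_distrib_left mult.assoc vimage_comp)
  also have "\<dots> = (\<Sum>i\<in>UNIV. \<Sum>\<sigma>\<in>(#) i ` Lam (t / \<bar>r i\<bar>). W \<sigma> * measure \<mu> (S \<sigma> -` E))"
    by (simp add: sum.reindex inj_on_def)
  also have "\<dots> = (\<Sum>\<sigma>\<in>Lam t. W \<sigma> * measure \<mu> (S \<sigma> -` E))"
    unfolding Lam_le_1[OF small.hyps] using fin by (subst sum.UNION_disjoint) auto
  finally show ?case .
qed

lemma measure_word_le: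
  assumes "E \<in> sets borel"
  shows "W \<sigma> * measure \<mu> (S \<sigma> -` E) \<le> measure \<mu> E"
  using assms
proof (induction \<sigma> arbitrary: E)
  case (Cons i \<sigma>)
  have "W (i # \<sigma>) * measure \<mu> (S (i # \<sigma>) -` E) = p i * (W \<sigma> * measure \<mu> (S \<sigma> -` sim r d i -` E))"
    by (simp add: mult.assoc vimage_comp)
  also have "\<dots> \<le> p i * measure \<mu> (sim r d i -` E)"
    using Cons.IH[OF sim_vimage_borel[OF Cons.prems]] p_pos[of i] by (intro mult_left_mono) auto
  also have "\<dots> \<le> (\<Sum>i\<in>UNIV. p i * measure \<mu> (sim r d i -` E))"
    using p_pos by (intro member_le_sum) (auto intro!: mult_nonneg_nonneg simp: less_imp_le)
  also have "\<dots> = measure \<mu> E" using ssm_eq[OF Cons.prems] by simp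
  finally show ?case .
qed simp

lemma measure_image_ge:
  assumes "E \<in> sets borel"
  shows "W \<sigma> * measure \<mu> E \<le> measure \<mu> (S \<sigma> ` E)"
  using measure_word_le[OF S_image_borel[OF assms], of \<sigma> \<sigma>] by (simp add: S_vimage_image)

text \<open>The measure of a neighbourhood of \<open>K\<close> does not drop when its radius is multiplied by the
  largest contraction ratio.\<close>

lemma measure_K: "measure \<mu> K = 1"
proof -
  define N where "N e = {y. infdist y K \<le> e}" for e
  have closed_N: "closed (N e)" for e
    unfolding N_def by (intro closed_Collect_le continuous_on_infdist continuous_intros)
  then have N: "N e \<in> sets borel" for e by (rule borel_closed)
  have step: "measure \<mu> (N e) \<le> measure \<mu> (N (rmax * e))" if e: "e \<ge> 0" for e
  proof -
    have "N e \<subseteq> sim r d i -` N (rmax * e)" for i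
    proof
      fix y assume y: "y \<in> N e"
      obtain k where k: "k \<in> K" "infdist y K = dist y k"
        using infdist_attains_inf[OF compact_imp_closed[OF K_compact] K_ne] by metis
      have "sim r d i k \<in> K" using k(1) K_eq by blast
      then have "infdist (sim r d i y) K \<le> dist (sim r d i y) (sim r d i k)" by (rule infdist_le)
      also have "\<dots> = \<bar>r i\<bar> * dist y k"
        by (simp add: sim_def dist_real_def abs_mult[symmetric] right_diff_distrib)
      also have "\<dots> \<le> rmax * e" using y k rmax e by (intro mult_mono) (auto simp: N_def)
      finally show "y \<in> sim r d i -` N (rmax * e)" by (simp add: N_def)
    qed
    then have "p i * measure \<mu> (N e) \<le> p i * measure \<mu> (sim r d i -` N (rmax * e))" for i
      using p_pos[of i] N sim_vimage_borel by (intro mult_left_mono measure_mono) auto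
    then have "(\<Sum>i\<in>UNIV. p i * measure \<mu> (N e)) \<le> measure \<mu> (N (rmax * e))"
      unfolding ssm_eq[OF N] by (intro sum_mono)
    then show ?thesis by (simp add: sum_distrib_right[symmetric] p_sum)
  qed
  have iter: "measure \<mu> (N e) \<le> measure \<mu> (N (rmax ^ n * e))" if "e \<ge> 0" for n e
  proof (induction n)
    case (Suc n)
    have "0 \<le> rmax ^ n * e" using that rmax(2) by simp
    from order.trans[OF Suc step[OF this]] show ?case by (simp add: mult.assoc)
  qed simp
  have inter: "(\<Inter>n. N (rmax ^ n * e)) = K" if e: "e \<ge> 0" for e
  proof (intro subset_antisym subsetI)
    fix y assume "y \<in> K"
    then show "y \<in> (\<Inter>n. N (rmax ^ n * e))" using e rmax(2) by (simp add: N_def)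
  next
    fix y assume y: "y \<in> (\<Inter>n. N (rmax ^ n * e))"
    have "(\<lambda>n. rmax ^ n * e) \<longlonglongrightarrow> 0 * e" using rmax by (intro tendsto_intros LIMSEQ_realpow_zero) auto
    then have "infdist y K \<le> 0 * e" using y by (intro LIMSEQ_le_const) (auto simp: N_def)
    then have "infdist y K = 0" using infdist_nonneg[of y K] by simp
    then show "y \<in> K" using in_closed_iff_infdist_zero[OF compact_imp_closed[OF K_compact] K_ne] by simp
  qed
  have le: "measure \<mu> (N e) \<le> measure \<mu> K" if e: "e \<ge> 0" for e
  proof -
    have dec: "decseq (\<lambda>n. N (rmax ^ n * e))"
    proof (rule decseq_SucI)
      fix n
      have "rmax ^ Suc n * e \<le> rmax ^ n * e"
        using rmax e by (intro mult_right_mono power_decreasing) auto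
      then show "N (rmax ^ Suc n * e) \<subseteq> N (rmax ^ n * e)" by (auto simp: N_def)
    qed
    have "(\<lambda>n. measure \<mu> (N (rmax ^ n * e))) \<longlonglongrightarrow> measure \<mu> (\<Inter>n. N (rmax ^ n * e))"
      using N dec by (intro finite_Lim_measure_decseq) (auto simp: sets_mu)
    then show ?thesis unfolding inter[OF e] using iter[OF e] by (intro LIMSEQ_le_const) auto
  qed
  have "(\<lambda>n. measure \<mu> (N (real n))) \<longlonglongrightarrow> measure \<mu> (\<Union>n. N (real n))"
    using N by (intro finite_Lim_measure_incseq) (auto simp: sets_mu incseq_def N_def)
  moreover have "(\<Union>n. N (real n)) = UNIV"
  proof -
    have "\<exists>n. infdist y K \<le> real n" for y by (rule real_arch_simple)
    then show ?thesis by (auto simp: N_def)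
  qed
  ultimately have "(\<lambda>n. measure \<mu> (N (real n))) \<longlonglongrightarrow> 1" using prob_space by (simp add: space_mu)
  then have "1 \<le> measure \<mu> K" using le by (intro LIMSEQ_le_const2) auto
  then show ?thesis using prob_le_1[of K] by simp
qed

lemma measure_superset_K: "K \<subseteq> B \<Longrightarrow> B \<in> sets borel \<Longrightarrow> measure \<mu> B = 1"
  using measure_mono[of K B] measure_K prob_le_1[of B] by simp

lemma measure_J: "measure \<mu> {0..1} = 1"
  using K_subset by (intro measure_superset_K) auto

lemma measure_disjoint_K:
  assumes "K \<inter> B = {}" "B \<in> sets borel"
  shows "measure \<mu> B = 0"
proof -
  have "measure \<mu> (space \<mu> - B) = 1" using assms by (intro measure_superset_K) (auto simp: space_mu)
  then show ?thesis using prob_compl[of B] assms by (simp add: sets_mu)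
qed

text \<open>Several words may define one map (exact overlaps). Weak separation bounds the number of
  maps and not of words, so the weights of all words with one map are collected.\<close>

definition wt :: "real \<Rightarrow> (real \<Rightarrow> real) \<Rightarrow> real" where
  "wt t f = (\<Sum>\<sigma>\<in>{\<sigma> \<in> Lam t. S \<sigma> = f}. W \<sigma>)"

lemma wt_pos:
  assumes "t > 0" "f \<in> M t E"
  shows "wt t f > 0"
proof -
  obtain \<sigma> where "f = S \<sigma>" "\<sigma> \<in> Lam t" using M_E[OF assms(2)] by metis
  then show ?thesis unfolding wt_def using finite_Lam[OF assms(1)] W_pos by (intro sum_pos) auto
qed

text \<open>Words whose image of \<open>K\<close> misses \<open>I\<close> contribute nothing because
  \<mu> is carried by \<open>K\<close>; the other terms are grouped by their maps.\<close>

lemma measure_local: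
  assumes t: "t > 0" and E: "E \<subseteq> I" "E \<in> sets borel"
  shows "measure \<mu> E = (\<Sum>f\<in>M t I. wt t f * measure \<mu> (f -` E))"
proof -
  let ?L = "{\<sigma> \<in> Lam t. S \<sigma> \<in> M t I}"
  have zero: "measure \<mu> (S \<sigma> -` E) = 0" if "\<sigma> \<in> Lam t - ?L" for \<sigma>
  proof (rule measure_disjoint_K)
    have "S \<sigma> ` K \<inter> I = {}" using that unfolding in_M by blast
    then show "K \<inter> S \<sigma> -` E = {}" using E(1) by blast
  qed (rule S_vimage_borel[OF E(2)])
  have "measure \<mu> E = (\<Sum>\<sigma>\<in>Lam t. W \<sigma> * measure \<mu> (S \<sigma> -` E))" by (rule measure_cut[OF t E(2)])
  also have "\<dots> = (\<Sum>\<sigma>\<in>?L. W \<sigma> * measure \<mu> (S \<sigma> -` E))"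
    using zero finite_Lam[OF t] by (intro sum.mono_neutral_right) auto
  also have "\<dots> = (\<Sum>f\<in>M t I. \<Sum>\<sigma>\<in>{\<sigma> \<in> ?L. S \<sigma> = f}. W \<sigma> * measure \<mu> (S \<sigma> -` E))"
    using finite_Lam[OF t] finite_M[OF t] by (intro sum.group[symmetric]) auto
  also have "\<dots> = (\<Sum>f\<in>M t I. wt t f * measure \<mu> (f -` E))"
  proof (rule sum.cong[OF refl])
    fix f assume f: "f \<in> M t I"
    then have eq: "{\<sigma> \<in> ?L. S \<sigma> = f} = {\<sigma> \<in> Lam t. S \<sigma> = f}" by blast
    show "(\<Sum>\<sigma>\<in>{\<sigma> \<in> ?L. S \<sigma> = f}. W \<sigma> * measure \<mu> (S \<sigma> -` E)) = wt t f * measure \<mu> (f -` E)"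
      unfolding eq wt_def sum_distrib_right by (rule sum.cong) auto
  qed
  finally show ?thesis .
qed

lemma wt_le_measure:
  assumes "t > 0" "B \<in> sets borel" "f ` {0..1} \<subseteq> B"
  shows "wt t f \<le> measure \<mu> B"
proof -
  have "wt t f = (\<Sum>\<sigma>\<in>{\<sigma> \<in> Lam t. S \<sigma> = f}. W \<sigma> * measure \<mu> (S \<sigma> -` B))"
    unfolding wt_def
  proof (rule sum.cong[OF refl])
    fix \<sigma> assume "\<sigma> \<in> {\<sigma> \<in> Lam t. S \<sigma> = f}"
    then have "measure \<mu> (S \<sigma> -` B) = 1"
      using assms(2,3) K_subset by (intro measure_superset_K S_vimage_borel) auto
    then show "W \<sigma> = W \<sigma> * measure \<mu> (S \<sigma> -` B)" by simp
  qed
  also have "\<dots> \<le> (\<Sum>\<sigma>\<in>Lam t. W \<sigma> * measure \<mu> (S \<sigma> -` B))"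
    using finite_Lam[OF assms(1)] W_pos by (intro sum_mono2) (auto intro!: mult_nonneg_nonneg simp: less_imp_le)
  also have "\<dots> = measure \<mu> B" using measure_cut[OF assms(1,2)] by simp
  finally show ?thesis .
qed

text \<open>By \<open>measure_local\<close>, pulling a subset of \<open>I\<close> back by
  \<open>f\<close> multiplies its measure by at most \<open>1 / wt t f\<close>; the sum collects
  these factors over all maps seen in \<open>I\<close>.\<close>

definition spread :: "real \<Rightarrow> real set \<Rightarrow> real" where
  "spread t I = (\<Sum>f\<in>M t I. 1 / wt t f)"

lemma spread_nonneg: "t > 0 \<Longrightarrow> spread t I \<ge> 0"
  unfolding spread_def using wt_pos by (intro sum_nonneg) (simp add: less_imp_le)

text \<open>The factor \<open>spread t I\<close> only depends on the source of the local isomorphism.\<close>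

lemma measure_loc_iso:
  assumes iso: "loc_iso t I t' l c" and t: "t > 0" "t' > 0" and E: "E \<subseteq> I" "E \<in> sets borel"
  shows "measure \<mu> (aff l c ` E) \<le> spread t I * measure \<mu> (aff l c ` {0..1}) * measure \<mu> E"
proof -
  have l: "l > 0" and M: "M t' (aff l c ` I) = (\<lambda>f. aff l c \<circ> f) ` M t I"
    using iso by (auto simp: loc_iso_def)
  have borel: "aff l c ` E \<in> sets borel" "aff l c ` {0..1} \<in> sets borel"
    using l E by (auto intro!: aff_image_borel)
  have "measure \<mu> (aff l c ` E) = (\<Sum>g\<in>M t' (aff l c ` I). wt t' g * measure \<mu> (g -` (aff l c ` E)))"
    using t E borel by (intro measure_local) auto
  also have "\<dots> = (\<Sum>f\<in>M t I. wt t' (aff l c \<circ> f) * measure \<mu> ((aff l c \<circ> f) -` (aff l c ` E)))"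
    unfolding M by (subst sum.reindex) (auto intro: inj_on_subset[OF inj_comp_aff[OF l]])
  also have "\<dots> \<le> (\<Sum>f\<in>M t I. 1 / wt t f * measure \<mu> (aff l c ` {0..1}) * measure \<mu> E)"
  proof (rule sum_mono)
    fix f assume f: "f \<in> M t I"
    obtain \<sigma> where \<sigma>: "f = S \<sigma>" using M_E[OF f] by metis
    have "(aff l c \<circ> f) -` (aff l c ` E) = f -` E"
      using l by (simp add: vimage_comp[symmetric] inj_vimage_image_eq inj_aff)
    moreover have "wt t f * measure \<mu> (f -` E) \<le> measure \<mu> E"
    proof -
      have "wt t f * measure \<mu> (f -` E) \<le> (\<Sum>f\<in>M t I. wt t f * measure \<mu> (f -` E))"
        using f finite_M[OF t(1)] wt_pos[OF t(1)] by (intro member_le_sum) (auto intro!: mult_nonneg_nonneg simp: less_imp_le)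
      then show ?thesis using measure_local[OF t(1) E] by simp
    qed
    then have "measure \<mu> (f -` E) \<le> 1 / wt t f * measure \<mu> E"
      using wt_pos[OF t(1) f] by (simp add: field_simps)
    \<comment> \<open>The transported map sends the unit interval into its image under
      \<open>aff l c\<close>, so its weight is absorbed in the measure of that image.\<close>
    moreover have "wt t' (aff l c \<circ> f) \<le> measure \<mu> (aff l c ` {0..1})"
      using S_J[of \<sigma>] borel t by (intro wt_le_measure) (auto simp: \<sigma> image_subset_iff)
    ultimately have "wt t' (aff l c \<circ> f) * measure \<mu> ((aff l c \<circ> f) -` (aff l c ` E)) \<le>
        measure \<mu> (aff l c ` {0..1}) * (1 / wt t f * measure \<mu> E)"
      by (simp only:) (intro mult_mono; simp)
    then show "wt t' (aff l c \<circ> f) * measure \<mu> ((aff l c \<circ> f) -` (aff l c ` E)) \<le>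
        1 / wt t f * measure \<mu> (aff l c ` {0..1}) * measure \<mu> E" by (simp add: mult_ac)
  qed
  also have "\<dots> = spread t I * measure \<mu> (aff l c ` {0..1}) * measure \<mu> E"
    by (simp add: spread_def sum_distrib_right)
  finally show ?thesis .
qed

end

subsection \<open>Limits\<close>

text \<open>Subadditivity is asked only for \<open>l \<ge> 1\<close>, since it will come from an
  image that has to lie in \<open>U\<close>. The limit is the infimum of \<open>u n / n\<close>,
  which yields \<open>L \<le> u 1\<close>.\<close>

lemma fekete:
  fixes u :: "nat \<Rightarrow> real"
  assumes sub: "\<And>k l. l \<ge> 1 \<Longrightarrow> u (k + l) \<le> u k + u l" and low: "\<And>n. real n * A \<le> u n + B"
  obtains L where "(\<lambda>n. u n / n) \<longlonglongrightarrow> L" "L \<le> u 1" "A \<le> L"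
proof -
  define X where "X = (\<lambda>n. u n / real n) ` {1..}"
  define L where "L = Inf X"
  have mult: "u (n * q) \<le> real q * u n" if "n \<ge> 1" "q \<ge> 1" for n q
    using that(2)
  proof (induction q rule: dec_induct)
    case (step q)
    have "u (n * Suc q) = u (n * q + n)" by (simp add: algebra_simps)
    also have "\<dots> \<le> u (n * q) + u n" using that by (intro sub) auto
    finally show ?case using step by (simp add: algebra_simps)
  qed simp
  \<comment> \<open>If \<open>u n / n\<close> were below \<open>A\<close>, the values of
    \<open>u\<close> at multiples of \<open>n\<close> would fall below the linear lower bound by any
    amount.\<close>
  have X_ge: "A \<le> u n / real n" if n: "n \<ge> 1" for n
  proof (rule ccontr)
    assume "\<not> A \<le> u n / real n"
    then have neg: "u n - real n * A < 0" using n by (simp add: field_simps not_le)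
    obtain q :: nat where q: "B < real q * (real n * A - u n)"
      using reals_Archimedean3[of "real n * A - u n"] neg by force
    have "real (n * Suc q) * A \<le> u (n * Suc q) + B" by (rule low)
    also have "u (n * Suc q) \<le> real (Suc q) * u n" using n by (intro mult) auto
    finally have "real (Suc q) * (real n * A - u n) \<le> B" by (simp add: algebra_simps)
    moreover have "real q * (real n * A - u n) \<le> real (Suc q) * (real n * A - u n)"
      using neg by (intro mult_right_mono) auto
    ultimately show False using q by linarith
  qed
  have bdd: "bdd_below X" unfolding X_def using X_ge by (auto intro!: bdd_belowI[of _ A])
  have ne: "X \<noteq> {}" by (auto simp: X_def)
  have L_le: "L \<le> u n / real n" if "n \<ge> 1" for n
    unfolding L_def using bdd that by (intro cInf_lower) (auto simp: X_def)
  have "A \<le> L" unfolding L_def using ne X_ge by (intro cInf_greatest) (auto simp: X_def)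
  moreover have "L \<le> u 1" using L_le[of 1] by simp
  moreover have "(\<lambda>n. u n / n) \<longlonglongrightarrow> L"
  proof (rule LIMSEQ_I)
    fix e :: real assume e: "e > 0"
    have "\<exists>x\<in>X. x < L + e / 2" using cInf_lessD[OF ne, of "L + e / 2"] e by (auto simp: L_def)
    then obtain N where N: "N \<ge> 1" "u N / real N < L + e / 2" by (auto simp: X_def)
    define C where "C = Max (u ` {..<N})"
    have C: "u s \<le> C" if "s < N" for s unfolding C_def using that by (intro Max_ge) auto
    have upper: "u n / real n \<le> u N / real N + (\<bar>C\<bar> + \<bar>u N\<bar>) / real n" if n: "n \<ge> 1" for n
    proof -
      \<comment> \<open>Division with remainder; the multiple of \<open>N\<close> is placed second
        because only the second summand must be positive.\<close>
      define q s where "q = n div N" and "s = n mod N"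
      have n_eq: "n = s + N * q" and s: "s < N" using N by (auto simp: q_def s_def)
      have "u n \<le> C + real q * u N"
      proof (cases "q = 0")
        case True
        then show ?thesis using n_eq C[OF s] by simp
      next
        case False
        then have "u (s + N * q) \<le> u s + u (N * q)" using N by (intro sub) (simp add: Suc_le_eq)
        also have "\<dots> \<le> C + real q * u N" using C[OF s] mult[OF N(1)] False by (intro add_mono) (auto simp: Suc_le_eq)
        finally show ?thesis using n_eq by simp
      qed
      moreover have "real q * u N = real n * (u N / real N) - real s / real N * u N"
        using N by (simp add: n_eq field_simps)
      moreover have "- (real s / real N * u N) \<le> \<bar>u N\<bar>"
      proof -
        have "\<bar>real s / real N * u N\<bar> \<le> 1 * \<bar>u N\<bar>"
          unfolding abs_mult using s by (intro mult_right_mono) auto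
        then show ?thesis by linarith
      qed
      ultimately have "u n \<le> real n * (u N / real N) + (\<bar>C\<bar> + \<bar>u N\<bar>)" by linarith
      then have "u n / real n \<le> (real n * (u N / real N) + (\<bar>C\<bar> + \<bar>u N\<bar>)) / real n"
        using n by (intro divide_right_mono) auto
      then show ?thesis using n by (simp add: add_divide_distrib)
    qed
    obtain n0 :: nat where n0: "(\<bar>C\<bar> + \<bar>u N\<bar>) / (e / 2) < real n0" using reals_Archimedean2 by blast
    show "\<exists>no. \<forall>n\<ge>no. norm (u n / real n - L) < e"
    proof (intro exI[of _ "max 1 n0"] allI impI)
      fix n assume n: "n \<ge> max 1 n0"
      have "(\<bar>C\<bar> + \<bar>u N\<bar>) / (e / 2) < real n" using n n0 by linarith
      then have "(\<bar>C\<bar> + \<bar>u N\<bar>) / real n < e / 2" using e n by (simp add: field_simps)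
      then have "u n / real n < L + e" using upper[of n] N(2) n by linarith
      moreover have "L \<le> u n / real n" using L_le n by simp
      ultimately show "norm (u n / real n - L) < e" by simp
    qed
  qed
  ultimately show ?thesis using that by blast
qed

text \<open>A bounded error of \<open>k t\<close> against \<open>ln t / c\<close> disappears after
  division by \<open>ln t\<close>, so a limit along integers becomes one along real scales.\<close>

lemma limit_along_scales:
  fixes v :: "nat \<Rightarrow> real" and k :: "real \<Rightarrow> nat"
  assumes v: "(\<lambda>n. v n / real n) \<longlonglongrightarrow> L" and c: "c < 0"
    and k: "\<forall>\<^sub>F t in at_right 0. \<bar>real (k t) - ln t / c\<bar> \<le> B"
  shows "((\<lambda>t. v (k t) / ln t) \<longlongrightarrow> L / c) (at_right 0)"
proof -
  have ln: "filterlim (\<lambda>t::real. ln t) at_bot (at_right 0)" by (rule ln_at_0)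
  have "filterlim (\<lambda>t. ln t / c - B) at_top (at_right 0)"
    using c by real_asymp
  then have "filterlim (\<lambda>t. real (k t)) at_top (at_right 0)"
    by (rule filterlim_at_top_mono) (use k in \<open>eventually_elim, linarith\<close>)
  then have k_top: "filterlim k sequentially (at_right 0)"
    by (simp add: filterlim_sequentially_iff_filterlim_real)
  have inv0: "((\<lambda>t. inverse (ln t)) \<longlongrightarrow> 0) (at_right (0::real))"
    by real_asymp
  then have "((\<lambda>t. B * \<bar>inverse (ln t)\<bar>) \<longlongrightarrow> B * \<bar>0\<bar>) (at_right 0)" by (intro tendsto_intros)
  then have B0: "((\<lambda>t. B * \<bar>inverse (ln t)\<bar>) \<longlongrightarrow> 0) (at_right 0)" by simp
  have neg: "\<forall>\<^sub>F t in at_right 0. ln t < (0::real)"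
    using ln by (rule filterlim_at_bot_dense[THEN iffD1, rule_format])
  have "((\<lambda>t. real (k t) / ln t - 1 / c) \<longlongrightarrow> 0) (at_right 0)"
  proof (rule Lim_null_comparison[OF _ B0])
    show "\<forall>\<^sub>F t in at_right 0. norm (real (k t) / ln t - 1 / c) \<le> B * \<bar>inverse (ln t)\<bar>"
      using k neg
    proof eventually_elim
      case (elim t)
      have "real (k t) / ln t - 1 / c = (real (k t) - ln t / c) * inverse (ln t)"
        using elim c by (simp add: field_simps)
      then show ?case using elim by (simp add: abs_mult mult_right_mono)
    qed
  qed
  then have ratio: "((\<lambda>t. real (k t) / ln t) \<longlongrightarrow> 1 / c) (at_right 0)" by (simp add: LIM_zero_iff)
  have "((\<lambda>t. v (k t) / real (k t)) \<longlongrightarrow> L) (at_right 0)"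
    by (rule filterlim_compose[OF v k_top])
  then have "((\<lambda>t. v (k t) / real (k t) * (real (k t) / ln t)) \<longlongrightarrow> L * (1 / c)) (at_right 0)"
    using ratio by (rule tendsto_mult)
  moreover have "\<forall>\<^sub>F t in at_right 0. v (k t) / real (k t) * (real (k t) / ln t) = v (k t) / ln t"
  proof -
    have "\<forall>\<^sub>F t in at_right 0. k t \<ge> 1" using k_top by (rule eventually_compose_filterlim[OF eventually_ge_at_top])
    then show ?thesis by eventually_elim simp
  qed
  ultimately have "((\<lambda>t. v (k t) / ln t) \<longlongrightarrow> L * (1 / c)) (at_right 0)"
    by (rule Lim_transform_eventually)
  then show ?thesis by simp
qed

text \<open>\<open>g t\<close> lies between two terms of \<open>m\<close> whose indices
  \<open>k1 t\<close> and \<open>k2 t\<close> differ from \<open>ln t / ln q\<close> by a bounded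
  amount; \<open>k2\<close> absorbs the factor \<open>e\<close>.\<close>

lemma local_dim_limit:
  fixes g :: "real \<Rightarrow> real" and m :: "nat \<Rightarrow> real"
  assumes mono: "\<And>s t. s \<le> t \<Longrightarrow> g s \<le> g t" and m: "\<And>k. m k > 0"
    and q: "0 < q" "q < 1" and e: "e > 0"
    and lower: "\<And>k. m k \<le> g (q ^ k)" and upper: "\<And>k. g (e * q ^ k) \<le> m k"
    and lim: "(\<lambda>k. ln (m k) / real k) \<longlonglongrightarrow> L"
  shows "((\<lambda>t. ln (g t) / ln t) \<longlongrightarrow> L / ln q) (at_right 0)"
proof -
  define c where "c = ln q"
  have c: "c < 0" using q by (simp add: c_def)
  have pow: "q ^ k = exp (real k * c)" for k using q by (simp add: c_def exp_of_nat_mult)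
  define k1 where "k1 t = nat \<lceil>ln t / c\<rceil>" for t
  define k2 where "k2 t = nat \<lfloor>(ln t - ln e) / c\<rfloor>" for t
  have small: "\<forall>\<^sub>F t in at_right 0. 0 < t \<and> t < min 1 e"
    using e eventually_at_right_real[of 0 "min 1 e"] by (auto elim: eventually_mono)
  have lim1: "((\<lambda>t. ln (m (k1 t)) / ln t) \<longlongrightarrow> L / c) (at_right 0)"
  proof (rule limit_along_scales[OF lim c, of _ 1])
    show "\<forall>\<^sub>F t in at_right 0. \<bar>real (k1 t) - ln t / c\<bar> \<le> 1"
      using small
    proof eventually_elim
      case (elim t)
      then have "ln t / c \<ge> 0" using c by (simp add: divide_nonpos_neg)
      then show ?case unfolding k1_def by linarith
    qed
  qed
  have lim2: "((\<lambda>t. ln (m (k2 t)) / ln t) \<longlongrightarrow> L / c) (at_right 0)"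
  proof (rule limit_along_scales[OF lim c, of _ "1 + \<bar>ln e / c\<bar>"])
    show "\<forall>\<^sub>F t in at_right 0. \<bar>real (k2 t) - ln t / c\<bar> \<le> 1 + \<bar>ln e / c\<bar>"
      using small
    proof eventually_elim
      case (elim t)
      then have "(ln t - ln e) / c \<ge> 0" using c e by (intro divide_nonpos_neg) auto
      then have "\<bar>real (k2 t) - (ln t - ln e) / c\<bar> \<le> 1" unfolding k2_def by linarith
      then show ?case unfolding diff_divide_distrib by linarith
    qed
  qed
  have bounds: "\<forall>\<^sub>F t in at_right 0. ln (m (k2 t)) / ln t \<le> ln (g t) / ln t \<and> ln (g t) / ln t \<le> ln (m (k1 t)) / ln t"
    using small
  proof eventually_elim
    case (elim t)
    have ln: "ln t < 0" using elim by simp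
    have "ln t / c \<le> real (k1 t)" unfolding k1_def by linarith
    then have "real (k1 t) * c \<le> ln t" using c by (simp add: field_simps)
    then have "q ^ k1 t \<le> t" unfolding pow using elim by (simp add: ln_ge_iff)
    then have g1: "m (k1 t) \<le> g t" using lower[of "k1 t"] mono by (meson order.trans)
    have "(ln t - ln e) / c \<ge> 0" using c e elim by (intro divide_nonpos_neg) auto
    then have "real (k2 t) \<le> (ln t - ln e) / c" unfolding k2_def by linarith
    then have "ln t \<le> ln e + real (k2 t) * c" using c by (simp add: field_simps)
    then have "exp (ln t) \<le> exp (ln e + real (k2 t) * c)" by simp
    then have "t \<le> e * q ^ k2 t" unfolding pow using elim e by (simp add: exp_add)
    then have g2: "g t \<le> m (k2 t)" using upper[of "k2 t"] mono by (meson order.trans)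
    have "ln (m (k1 t)) \<le> ln (g t)" "ln (g t) \<le> ln (m (k2 t))"
      using g1 g2 m[of "k1 t"] m[of "k2 t"] by (auto intro: ln_mono)
    then show ?case using ln by (auto intro: divide_right_mono_neg)
  qed
  show ?thesis unfolding c_def[symmetric]
    by (rule tendsto_sandwich[OF _ _ lim2 lim1]) (use bounds in \<open>auto elim: eventually_mono\<close>)
qed

lemma has_local_dimI:
  assumes "((\<lambda>t. ln (measure \<mu> (cball x t)) / ln t) \<longlongrightarrow> s) (at_right 0)"
  shows "has_local_dim \<mu> x (ereal s)"
proof -
  have "((\<lambda>t. ereal (ln (measure \<mu> (cball x t)) / ln t)) \<longlongrightarrow> ereal s) (at_right 0)"
    using assms by (rule tendsto_ereal)
  then show ?thesis
    unfolding has_local_dim_def upper_local_dim_def lower_local_dim_def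
    by (simp add: lim_imp_Limsup lim_imp_Liminf)
qed

subsection \<open>Local dimensions at periodic points\<close>

locale centred_ssm = centred_ifs r d K U t0 ts as bs + ssm r d K p \<mu>
  for r d :: "'i::finite \<Rightarrow> real" and K U t0 ts as bs p \<mu>
begin

text \<open>Since the constant \<open>spread t0 U\<close> serves all words, the measures of the iterated images of
  \<open>[0, 1]\<close> are submultiplicative up to a factor that does not depend on \<open>\<omega>\<close>.\<close>

lemma periodic_local_dim:
  assumes pos: "R \<omega> > 0" and inside: "S \<omega> ` {0..1} \<subseteq> {as<..<bs}"
    and P: "P > 0" and low: "\<And>E. E \<in> sets borel \<Longrightarrow> P * measure \<mu> E \<le> measure \<mu> (S \<omega> ` E)"
  obtains D where "has_local_dim \<mu> (S \<omega> 0 / (1 - R \<omega>)) (ereal D)" "ln P \<le> D * ln (R \<omega>)"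
    "D * ln (R \<omega>) \<le> ln (spread t0 U * measure \<mu> (S \<omega> ` {0..1}))"
proof -
  define y where "y = S \<omega> 0 / (1 - R \<omega>)"
  define q where "q = R \<omega>"
  note y = contracting_word[OF pos inside, folded y_def q_def]
  have q: "0 < q" "q < 1" using pos y by (auto simp: q_def)
  define w where "w k = concat (replicate k \<omega>)" for k
  note pow = S_power[OF y(2), folded q_def w_def]
  define J :: "real set" where "J = {0..1}"
  define m where "m k = measure \<mu> (S (w k) ` J)" for k
  define C where "C = spread t0 U"
  have w_add: "w (k + l) = w k @ w l" for k l by (simp add: w_def replicate_add)
  have w_1: "w 1 = \<omega>" by (simp add: w_def)
  have J: "J \<in> sets borel" by (simp add: J_def)
  have S_borel: "S \<sigma> ` J \<in> sets borel" for \<sigma> using J by (rule S_image_borel)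
  have m_ge: "P ^ k \<le> m k" for k
  proof (induction k)
    case 0
    then show ?case using measure_J by (simp add: m_def w_def J_def)
  next
    case (Suc k)
    have "P * P ^ k \<le> P * m k" using Suc P by simp
    also have "\<dots> \<le> measure \<mu> (S \<omega> ` S (w k) ` J)" unfolding m_def using S_borel by (rule low)
    also have "S \<omega> ` S (w k) ` J = S (w (1 + k)) ` J" unfolding w_add w_1 sim_word_append image_comp ..
    finally show ?case by (simp add: m_def)
  qed
  have m_pos: "m k > 0" for k using m_ge[of k] P by (meson less_le_trans zero_less_power)
  \<comment> \<open>For \<open>l \<ge> 1\<close> the second word begins with
    \<open>\<omega>\<close>, so its image lies in the central interval and hence in
    \<open>U\<close>.\<close>
  have sub: "m (k + l) \<le> C * m k * m l" if l: "l \<ge> 1" for k l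
  proof -
    have Rw: "R (w k) > 0" using q by (simp add: pow)
    then have Rt: "R (w k) * t0 > 0" using t0 by simp
    obtain l' where l': "l = 1 + l'" using l by (metis le_Suc_ex)
    have "S (w l) ` J = S \<omega> ` S (w l') ` J"
      unfolding l' w_add w_1 sim_word_append image_comp ..
    also have "\<dots> \<subseteq> {as<..<bs}" using inside S_J[of "w l'"] unfolding J_def by blast
    also have "\<dots> \<subseteq> U" using central(3) by auto
    finally have "measure \<mu> (S (w k) ` S (w l) ` J) \<le> C * measure \<mu> (S (w k) ` J) * measure \<mu> (S (w l) ` J)"
      unfolding C_def J_def
      by (rule measure_loc_iso[OF iso[OF Rw] t0(1) Rt _ S_borel, unfolded S_eq_aff[of "w k", symmetric] J_def])
    then show ?thesis by (simp add: m_def w_add sim_word_append image_comp)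
  qed
  have C: "C > 0"
  proof -
    have "0 < C * m 0 * m 1" using m_pos[of "0 + 1"] sub[of 1 0] by linarith
    then show ?thesis using m_pos by (simp add: zero_less_mult_iff) (meson less_asym)
  qed
  have m_ne: "m k \<noteq> 0" for k using m_pos[of k] by simp
  have ln_Cm: "ln (C * m k) = ln C + ln (m k)" for k using C m_pos[of k] by (simp add: ln_mult)
  \<comment> \<open>\<open>C * m k\<close> is submultiplicative without a constant.
    \<open>L \<le> u 1\<close> gives the upper estimate, the growth bound
    \<open>P ^ n \<le> m n\<close> the lower one.\<close>
  obtain L where L: "(\<lambda>n. ln (C * m n) / n) \<longlonglongrightarrow> L" "L \<le> ln (C * m 1)" "ln P \<le> L"
  proof (rule fekete[of "\<lambda>n. ln (C * m n)" "ln P" "- ln C"])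
    fix k l :: nat assume "l \<ge> 1"
    then have "C * m (k + l) \<le> (C * m k) * (C * m l)" using sub[of l k] C by (simp add: mult_ac)
    then have "ln (C * m (k + l)) \<le> ln ((C * m k) * (C * m l))" using C m_pos by simp
    then show "ln (C * m (k + l)) \<le> ln (C * m k) + ln (C * m l)" using C m_ne[of k] m_ne[of l] by (simp add: ln_mult)
  next
    fix n
    have "ln (P ^ n) \<le> ln (m n)" using m_ge[of n] P by (intro ln_mono) auto
    then show "real n * ln P \<le> ln (C * m n) + - ln C" using P by (simp add: ln_Cm ln_realpow)
  qed
  have "(\<lambda>n. ln C / real n) \<longlonglongrightarrow> 0" by (rule lim_const_over_n)
  from tendsto_diff[OF L(1) this] have lim: "(\<lambda>n. ln (m n) / n) \<longlonglongrightarrow> L"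
    by (simp add: ln_Cm add_divide_distrib)
  \<comment> \<open>The ball of radius \<open>e\<close> about \<open>y\<close> stays in the unit
    interval, so its scaled copies stay in the iterated images.\<close>
  define e where "e = min (y - as) (bs - y)"
  have e: "e > 0" "e \<le> y - as" "e \<le> bs - y" using y by (auto simp: e_def)
  have "((\<lambda>t. ln (measure \<mu> (cball y t)) / ln t) \<longlongrightarrow> L / ln q) (at_right 0)"
  proof (rule local_dim_limit[OF _ m_pos q e(1) _ _ lim])
    show "measure \<mu> (cball y s) \<le> measure \<mu> (cball y t)" if "s \<le> t" for s t
      using that by (intro measure_mono) auto
  next
    fix k
    have "S (w k) ` J \<subseteq> cball y (q ^ k)"
    proof
      fix z assume "z \<in> S (w k) ` J"
      then obtain x where x: "x \<in> J" "z = y + q ^ k * (x - y)" by (auto simp: pow)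
      have "\<bar>x - y\<bar> \<le> 1" using x(1) y ts by (auto simp: J_def)
      then have "q ^ k * \<bar>x - y\<bar> \<le> q ^ k" using q by (intro mult_left_le) auto
      then show "z \<in> cball y (q ^ k)" using q by (simp add: x(2) dist_real_def abs_mult)
    qed
    then show "m k \<le> measure \<mu> (cball y (q ^ k))" unfolding m_def by (intro measure_mono) auto
  next
    fix k
    have "cball y (e * q ^ k) \<subseteq> S (w k) ` J"
    proof
      fix z assume "z \<in> cball y (e * q ^ k)"
      then have "\<bar>z - y\<bar> \<le> e * q ^ k" by (simp add: dist_real_def abs_minus_commute)
      then have "\<bar>(z - y) / q ^ k\<bar> \<le> e" using q by (simp add: field_simps)
      then have "0 \<le> y + (z - y) / q ^ k" "y + (z - y) / q ^ k \<le> 1" using e ts by linarith+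
      then have "y + (z - y) / q ^ k \<in> J" by (simp add: J_def)
      moreover have "z = S (w k) (y + (z - y) / q ^ k)" using q by (simp add: pow)
      ultimately show "z \<in> S (w k) ` J" by blast
    qed
    then show "measure \<mu> (cball y (e * q ^ k)) \<le> m k" unfolding m_def using S_borel by (rule measure_mono)
  qed
  then have dim: "has_local_dim \<mu> y (ereal (L / ln q))" by (rule has_local_dimI)
  have "L / ln q * ln q = L" using q by simp
  then show ?thesis using that[of "L / ln q"] dim L unfolding y_def q_def C_def m_def w_1 J_def by simp
qed

end

subsection \<open>Transplanting a piece near a point into the central net interval\<close>

lemma sum_pigeonhole:
  fixes g :: "'b \<Rightarrow> real"
  assumes "finite A" "A \<noteq> {}" "x \<le> sum g A"
  obtains a where "a \<in> A" "x \<le> real (card A) * g a"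
proof -
  have "\<exists>a\<in>A. x \<le> real (card A) * g a"
  proof (rule ccontr)
    assume "\<not> ?thesis"
    then have "sum g A < sum (\<lambda>_. x / real (card A)) A"
      using assms by (intro sum_strict_mono) (auto simp: field_simps card_gt_0_iff)
    then show False using assms by simp
  qed
  then show ?thesis using that by blast
qed

context centred_ssm
begin

definition pmin :: real where "pmin = Min (range p)"

lemma pmin: "0 < pmin" "pmin \<le> p i" "pmin \<le> 1"
proof -
  show *: "pmin \<le> p i" for i unfolding pmin_def by (rule Min_le) auto
  show "0 < pmin" unfolding pmin_def by (subst Min_gr_iff) (use p_pos in auto)
  show "pmin \<le> 1" using *[of undefined] p_le_1[of undefined] by simp
qed

lemma short_word:
  assumes "length \<eta> \<le> 1"
  shows "pmin \<le> W \<eta>" "rmin \<le> \<bar>R \<eta>\<bar>"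
proof -
  have "\<eta> = [] \<or> (\<exists>i. \<eta> = [i])" using assms by (cases \<eta>) auto
  then show "pmin \<le> W \<eta>" "rmin \<le> \<bar>R \<eta>\<bar>" using pmin rmin by auto
qed

text \<open>\<open>D\<close> and \<open>q\<close> will be the local dimension and the contraction
  ratio at a periodic point built from \<open>\<sigma>\<close>, so that \<open>q powr D\<close> acts
  as a measure at a scale comparable to \<open>s\<close>. The suffix \<open>\<zeta>\<close> steers
  the image into a net interval, and \<open>B\<close> collects all constants.\<close>

definition good :: "'i list \<Rightarrow> real \<Rightarrow> real \<Rightarrow> 'i list \<Rightarrow> bool" where
  "good \<zeta> B s \<sigma> \<longleftrightarrow> (\<exists>y\<in>periodic_points r d K. \<exists>D q. has_local_dim \<mu> y (ereal D) \<and>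
     0 < q \<and> q < 1 \<and> s / B \<le> q \<and> q \<le> B * s \<and> ln (wt s (S \<sigma>) / B) \<le> D * ln q \<and>
     D * ln q \<le> ln (B * measure \<mu> (S (\<sigma> @ \<zeta>) ` {0..1})))"

lemma measure_word_image_pos: "measure \<mu> (S \<sigma> ` {0..1}) > 0"
  using measure_image_ge[of "{0..1}" \<sigma>] measure_J W_pos[of \<sigma>] by simp

lemma wt_word_pos: "s > 0 \<Longrightarrow> \<sigma> \<in> Lam s \<Longrightarrow> wt s (S \<sigma>) > 0"
  unfolding wt_def using finite_Lam W_pos by (intro sum_pos) auto

lemma good_mono:
  assumes "good \<zeta> B s \<sigma>" "0 < B" "B \<le> B'" "s > 0" "\<sigma> \<in> Lam s"
  shows "good \<zeta> B' s \<sigma>"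
proof -
  have 1: "s / B' \<le> s / B" "B * s \<le> B' * s" using assms by (auto intro!: divide_left_mono mult_right_mono)
  have "ln (wt s (S \<sigma>) / B') \<le> ln (wt s (S \<sigma>) / B)"
    using assms wt_word_pos[of s \<sigma>] by (intro ln_mono) (auto intro!: divide_left_mono)
  moreover have "ln (B * measure \<mu> (S (\<sigma> @ \<zeta>) ` {0..1})) \<le> ln (B' * measure \<mu> (S (\<sigma> @ \<zeta>) ` {0..1}))"
    using assms measure_word_image_pos[of "\<sigma> @ \<zeta>"] by (intro ln_mono) (auto intro!: mult_right_mono)
  ultimately show ?thesis using assms(1) 1 unfolding good_def by (meson order.trans)
qed

lemma spread_pos: "spread t0 U > 0"
proof -
  obtain y where "y \<in> {as<..<bs}" "y \<in> K" using central(1) unfolding in_Net by blast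
  moreover from this have "y \<in> U" using central(3) by auto
  ultimately have "M t0 U \<noteq> {}" using in_K_iff[OF t0(1)] by blast
  then show ?thesis unfolding spread_def using finite_M[OF t0(1)] wt_pos[OF t0(1)] by (intro sum_pos) auto
qed

text \<open>A copy of the net interval lies inside the central one, and the local isomorphism
  \<open>\<psi>\<close> onto it turns the coarse prefix of a word with map \<open>S \<sigma>\<close>
  into another word. This word, the rest of the old one and \<open>\<zeta>\<close> make up
  \<open>\<omega>\<close>, up to a letter that corrects the sign. The costs depend on the net
  interval and \<open>\<zeta>\<close>, not on \<open>s\<close> or \<open>\<sigma>\<close>.\<close>

lemma transplant:
  assumes net1: "(t1, a1, b1) \<in> Net" and reach: "V (ts, as, bs) \<rightarrow>\<^sup>*\<^bsub>G\<^esub> V (t1, a1, b1)"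
  obtains B where "B > 0" "\<And>s \<sigma>. 0 < s \<Longrightarrow> s \<le> t1 \<Longrightarrow> s \<le> 1 \<Longrightarrow> \<sigma> \<in> Lam s \<Longrightarrow>
    S (\<sigma> @ \<zeta>) ` {0..1} \<subseteq> {a1<..<b1} \<Longrightarrow> good \<zeta> B s \<sigma>"
proof -
  let ?I = "{a1<..<b1}" and ?J = "{0..1::real}"
  have t1: "t1 > 0" "a1 < b1" using net1 by (auto simp: in_Net)
  \<comment> \<open>A descendant may share an end with the central interval; passing first to an
    interior copy of the latter makes the inclusion strict.\<close>
  obtain \<tau>0 where \<tau>0: "R \<tau>0 > 0" "S \<tau>0 ` {0..1} \<subseteq> {as<..<bs}" by (rule central_descendant[OF central(1)])
  note copy = central_copy[OF \<tau>0(1)]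
  obtain th ah bh where hat: "(th, ah, bh) \<in> Net" "S \<tau>0 as \<le> ah" "bh \<le> S \<tau>0 bs" "V (th, ah, bh) = V (t1, a1, b1)"
    using realize[OF reach[folded copy(2)] copy(1)] by metis
  have "S \<tau>0 as \<in> {as<..<bs}" "S \<tau>0 bs \<in> {as<..<bs}" using \<tau>0(2) ts by (auto simp: image_subset_iff)
  then have inside: "as < ah" "bh < bs" using hat by auto
  have th: "th > 0" "ah < bh" using hat(1) by (auto simp: in_Net)
  define l where "l = (bh - ah) / (b1 - a1)"
  define \<psi> where "\<psi> = aff l (ah - l * a1)"
  note iso = nbr_set_loc_iso[OF hat(4) t1(2) th(2), folded l_def]
  have l: "l > 0" using iso(1) by (simp add: loc_iso_def)
  have M_hat: "M th (\<psi> ` ?I) = (\<lambda>f. \<psi> \<circ> f) ` M t1 ?I" using iso(1) by (simp add: loc_iso_def \<psi>_def)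
  have \<psi>_I: "\<psi> ` ?I = {ah<..<bh}" using l iso by (simp add: \<psi>_def aff_image_greaterThanLessThan)
  define L1 where "L1 = {\<sigma> \<in> Lam t1. S \<sigma> \<in> M t1 ?I}"
  \<comment> \<open>The isomorphism carries a map seen in \<open>?I\<close> to a map seen in the
    copy, which again comes from a word; \<open>h\<close> selects one.\<close>
  have "\<exists>\<sigma>'. S \<sigma>' = \<psi> \<circ> S \<sigma>" if "\<sigma> \<in> L1" for \<sigma>
  proof -
    have "\<psi> \<circ> S \<sigma> \<in> M th (\<psi> ` ?I)" using that unfolding M_hat L1_def by blast
    then show ?thesis using M_E by metis
  qed
  then obtain h where h: "\<And>\<sigma>. \<sigma> \<in> L1 \<Longrightarrow> S (h \<sigma>) = \<psi> \<circ> S \<sigma>" by metis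
  have L1: "finite L1" "L1 \<noteq> {}"
  proof -
    show "finite L1" using finite_Lam[OF t1(1)] by (simp add: L1_def)
    obtain f where f: "f \<in> M t1 ?I" using Net_M_ne[OF net1] by blast
    obtain \<sigma> where "\<sigma> \<in> Lam t1" "S \<sigma> \<in> M t1 ?I" using M_E[OF f] by metis
    then have "\<sigma> \<in> L1" by (simp add: L1_def)
    then show "L1 \<noteq> {}" by blast
  qed
  define N where "N = real (card L1)"
  have N: "N > 0" using L1 by (simp add: N_def card_gt_0_iff)
  define wmin where "wmin = Min (W ` h ` L1)"
  have wmin: "wmin > 0" "\<And>\<sigma>. \<sigma> \<in> L1 \<Longrightarrow> wmin \<le> W (h \<sigma>)"
    unfolding wmin_def using L1 W_pos by auto
  \<comment> \<open>\<open>c1\<close> is the cost in weight: the new prefix, \<open>\<zeta>\<close>,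
    the correcting letter and a pigeonhole over \<open>N\<close> prefixes. \<open>c2\<close> is the
    cost in ratio, with one \<open>rmin\<close> for the cut of \<open>\<sigma>\<close> and one for
    the correcting letter.\<close>
  define c1 where "c1 = wmin * W \<zeta> * pmin / N"
  define c2 where "c2 = l * rmin * \<bar>R \<zeta>\<bar> * rmin"
  define C where "C = spread t0 U * spread t1 ?I"
  have c1: "c1 > 0" using wmin W_pos pmin N by (simp add: c1_def)
  have c2: "c2 > 0" using l rmin R_pos by (simp add: c2_def)
  have C: "C \<ge> 0" using spread_nonneg t0 t1 by (simp add: C_def)
  define B where "B = Max {1 / c1, 1 / c2, l, C}"
  have B: "1 / c1 \<le> B" "1 / c2 \<le> B" "l \<le> B" "C \<le> B" by (auto simp: B_def)
  have B_pos: "B > 0" using B(3) l by linarith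
  have inv_B: "1 / B \<le> c1" "1 / B \<le> c2" using B(1,2) c1 c2 B_pos by (simp_all add: field_simps)
  have "good \<zeta> B s \<sigma>" if s: "0 < s" "s \<le> t1" "s \<le> 1" and \<sigma>: "\<sigma> \<in> Lam s" and sub: "S (\<sigma> @ \<zeta>) ` ?J \<subseteq> ?I" for s \<sigma>
  proof -
    define T where "T \<sigma>1 = {\<tau> \<in> Lam (s / \<bar>R \<sigma>1\<bar>). S (\<sigma>1 @ \<tau>) = S \<sigma>}" for \<sigma>1
    define Q where "Q \<sigma>1 = (\<Sum>\<tau>\<in>T \<sigma>1. W \<tau>)" for \<sigma>1
    have fin_T: "finite (T \<sigma>1)" for \<sigma>1
      unfolding T_def using finite_Lam[of "s / \<bar>R \<sigma>1\<bar>"] s R_pos[of \<sigma>1] by simp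
    have prefix: "\<sigma>1 \<in> L1" if "\<sigma>1 \<in> Lam t1" "S (\<sigma>1 @ \<tau>) = S \<sigma>" for \<sigma>1 \<tau>
    proof -
      have "S \<tau> (S \<zeta> 0) \<in> K" using S_K zero_in_K by blast
      moreover have "S (\<sigma> @ \<zeta>) 0 \<in> ?I" using sub by (auto simp: image_subset_iff)
      then have "S \<sigma>1 (S \<tau> (S \<zeta> 0)) \<in> ?I" using that(2)[symmetric] by (simp add: sim_word_append)
      ultimately have "S \<sigma>1 ` K \<inter> ?I \<noteq> {}" by blast
      then have "S \<sigma>1 \<in> M t1 ?I" using that(1) unfolding in_M by blast
      then show ?thesis using that(1) by (simp add: L1_def)
    qed
    \<comment> \<open>Every word of the cut set with the map of \<open>\<sigma>\<close> has a prefix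
      in \<open>L1\<close>. The continuations \<open>T \<sigma>1\<close> of some prefix therefore
      have total weight at least \<open>wt s (S \<sigma>) / N\<close>.\<close>
    have "{\<sigma>' \<in> Lam s. S \<sigma>' = S \<sigma>} \<subseteq> (\<lambda>(\<sigma>1, \<tau>). \<sigma>1 @ \<tau>) ` (SIGMA \<sigma>1:L1. T \<sigma>1)"
    proof
      fix \<sigma>' assume "\<sigma>' \<in> {\<sigma>' \<in> Lam s. S \<sigma>' = S \<sigma>}"
      then have \<sigma>': "\<sigma>' \<in> Lam s" "S \<sigma>' = S \<sigma>" by simp_all
      obtain \<sigma>1 \<tau> where *: "\<sigma>' = \<sigma>1 @ \<tau>" "\<sigma>1 \<in> Lam t1" "\<tau> \<in> Lam (s / \<bar>R \<sigma>1\<bar>)"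
        using equalityD1[OF Lam_split[OF s(1,2)], THEN subsetD, OF \<sigma>'(1)] by blast
      moreover have "S (\<sigma>1 @ \<tau>) = S \<sigma>" using *(1) \<sigma>'(2) by simp
      ultimately show "\<sigma>' \<in> (\<lambda>(\<sigma>1, \<tau>). \<sigma>1 @ \<tau>) ` (SIGMA \<sigma>1:L1. T \<sigma>1)"
        using prefix by (intro image_eqI[of _ _ "(\<sigma>1, \<tau>)"]) (auto simp: T_def)
    qed
    then have "wt s (S \<sigma>) \<le> (\<Sum>\<sigma>'\<in>(\<lambda>(\<sigma>1, \<tau>). \<sigma>1 @ \<tau>) ` (SIGMA \<sigma>1:L1. T \<sigma>1). W \<sigma>')"
      unfolding wt_def using L1 fin_T W_pos by (intro sum_mono2) (auto simp: less_imp_le)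
    also have "\<dots> \<le> (\<Sum>(\<sigma>1, \<tau>)\<in>(SIGMA \<sigma>1:L1. T \<sigma>1). W (\<sigma>1 @ \<tau>))"
      using sum_image_le[of "SIGMA \<sigma>1:L1. T \<sigma>1" W "\<lambda>(\<sigma>1, \<tau>). \<sigma>1 @ \<tau>"] L1 fin_T W_pos
      by (simp add: case_prod_unfold less_imp_le o_def)
    also have "\<dots> = (\<Sum>\<sigma>1\<in>L1. \<Sum>\<tau>\<in>T \<sigma>1. W (\<sigma>1 @ \<tau>))" using L1 fin_T by (simp add: sum.Sigma)
    also have "\<dots> \<le> (\<Sum>\<sigma>1\<in>L1. Q \<sigma>1)"
      unfolding Q_def using W_le_1 W_pos by (intro sum_mono) (simp add: word_weight_append mult_left_le_one_le less_imp_le)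
    finally obtain \<sigma>1 where \<sigma>1: "\<sigma>1 \<in> L1" "wt s (S \<sigma>) \<le> N * Q \<sigma>1"
      using sum_pigeonhole[OF L1] unfolding N_def by metis
    have wt_pos: "wt s (S \<sigma>) > 0" using s \<sigma> by (intro wt_word_pos)
    then have "N * Q \<sigma>1 > 0" using \<sigma>1(2) by linarith
    then have "Q \<sigma>1 > 0" using N by (simp add: zero_less_mult_iff)
    then obtain \<tau>1 where \<tau>1: "\<tau>1 \<in> T \<sigma>1" unfolding Q_def by fastforce
    obtain \<eta> where \<eta>: "R ((h \<sigma>1 @ \<tau>1 @ \<zeta>) @ \<eta>) > 0" "length \<eta> \<le> 1" by (rule sign_fix)
    define \<omega> where "\<omega> = (h \<sigma>1 @ \<tau>1 @ \<zeta>) @ \<eta>"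
    \<comment> \<open>All continuations in \<open>T \<sigma>1\<close> lead to the same map
      \<open>S \<omega>\<close>, although \<open>\<omega>\<close> uses only \<open>\<tau>1\<close>;
      this lets their weights add up in \<open>P\<close>.\<close>
    have S_\<omega>: "S (h \<sigma>1) ` S \<tau> ` S (\<zeta> @ \<eta>) ` E = S \<omega> ` E" if "\<tau> \<in> T \<sigma>1" for \<tau> E
    proof -
      have eq: "S (h \<sigma>1) \<circ> S \<tau> \<circ> S (\<zeta> @ \<eta>) = \<psi> \<circ> S \<sigma> \<circ> S (\<zeta> @ \<eta>)" if "\<tau> \<in> T \<sigma>1" for \<tau>
      proof -
        have "S \<sigma>1 \<circ> S \<tau> = S \<sigma>" using that by (simp add: T_def sim_word_append)
        then show ?thesis by (simp only: h[OF \<sigma>1(1)] comp_assoc)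
      qed
      have "S \<omega> = S (h \<sigma>1) \<circ> S \<tau>1 \<circ> S (\<zeta> @ \<eta>)"
        by (simp only: \<omega>_def sim_word_append comp_assoc)
      moreover have "S (h \<sigma>1) ` S \<tau> ` S (\<zeta> @ \<eta>) ` E = (S (h \<sigma>1) \<circ> S \<tau> \<circ> S (\<zeta> @ \<eta>)) ` E"
        by (simp only: image_comp comp_assoc)
      ultimately show ?thesis by (simp only: eq[OF that] eq[OF \<tau>1])
    qed
    have \<omega>_image: "S \<omega> ` ?J \<subseteq> \<psi> ` S (\<sigma> @ \<zeta>) ` ?J"
    proof -
      have "S \<omega> = \<psi> \<circ> (S \<sigma>1 \<circ> S \<tau>1) \<circ> S \<zeta> \<circ> S \<eta>"
        by (simp only: \<omega>_def sim_word_append h[OF \<sigma>1(1)] comp_assoc)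
      also have "S \<sigma>1 \<circ> S \<tau>1 = S \<sigma>" using \<tau>1 by (simp add: T_def sim_word_append)
      finally have "S \<omega> ` ?J = \<psi> ` S (\<sigma> @ \<zeta>) ` S \<eta> ` ?J" by (simp add: sim_word_append image_comp comp_assoc)
      then show ?thesis using S_J[of \<eta>] by blast
    qed
    have borel: "S \<sigma>' ` ?J \<in> sets borel" "\<psi> ` S \<sigma>' ` ?J \<in> sets borel" for \<sigma>'
      using l by (auto simp: \<psi>_def intro!: aff_image_borel S_image_borel)
    have inside_\<omega>: "S \<omega> ` ?J \<subseteq> {as<..<bs}"
    proof -
      have "\<psi> ` S (\<sigma> @ \<zeta>) ` ?J \<subseteq> \<psi> ` ?I" using sub by (rule image_mono)
      also have "\<dots> \<subseteq> {as<..<bs}" unfolding \<psi>_I using inside by auto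
      finally show ?thesis using \<omega>_image by (rule order.trans[rotated])
    qed
    define P where "P = W (h \<sigma>1) * Q \<sigma>1 * W (\<zeta> @ \<eta>)"
    have P: "P > 0" using W_pos \<open>Q \<sigma>1 > 0\<close> by (simp add: P_def)
    have low: "P * measure \<mu> E \<le> measure \<mu> (S \<omega> ` E)" if E: "E \<in> sets borel" for E
    proof -
      let ?F = "S (h \<sigma>1) -` S \<omega> ` E"
      have F: "?F \<in> sets borel" using E by (intro S_vimage_borel S_image_borel)
      have "W \<tau> * (W (\<zeta> @ \<eta>) * measure \<mu> E) \<le> W \<tau> * measure \<mu> (S \<tau> -` ?F)" if \<tau>: "\<tau> \<in> T \<sigma>1" for \<tau>
      proof (intro mult_left_mono)
        have "S \<tau> -` ?F = S (\<zeta> @ \<eta>) ` E" by (simp add: S_\<omega>[OF \<tau>, symmetric] S_vimage_image)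
        then show "W (\<zeta> @ \<eta>) * measure \<mu> E \<le> measure \<mu> (S \<tau> -` ?F)" using measure_image_ge[OF E] by simp
      qed (use W_pos[of \<tau>] in simp)
      then have "(\<Sum>\<tau>\<in>T \<sigma>1. W \<tau> * (W (\<zeta> @ \<eta>) * measure \<mu> E)) \<le> (\<Sum>\<tau>\<in>T \<sigma>1. W \<tau> * measure \<mu> (S \<tau> -` ?F))"
        by (rule sum_mono)
      also have "\<dots> \<le> (\<Sum>\<tau>\<in>Lam (s / \<bar>R \<sigma>1\<bar>). W \<tau> * measure \<mu> (S \<tau> -` ?F))"
        using s R_pos[of \<sigma>1] W_pos by (intro sum_mono2 finite_Lam) (auto simp: T_def less_imp_le)
      also have "\<dots> = measure \<mu> ?F" using s R_pos[of \<sigma>1] F by (intro measure_cut[symmetric]) auto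
      finally have "Q \<sigma>1 * (W (\<zeta> @ \<eta>) * measure \<mu> E) \<le> measure \<mu> ?F" by (simp add: Q_def sum_distrib_right)
      then have "W (h \<sigma>1) * (Q \<sigma>1 * (W (\<zeta> @ \<eta>) * measure \<mu> E)) \<le> W (h \<sigma>1) * measure \<mu> ?F"
        using W_pos[of "h \<sigma>1"] by (intro mult_left_mono) auto
      also have "\<dots> \<le> measure \<mu> (S \<omega> ` E)" using E by (intro measure_word_le S_image_borel)
      finally show ?thesis by (simp add: P_def mult.assoc)
    qed
    have pos: "R \<omega> > 0" using \<eta>(1) by (simp add: \<omega>_def)
    obtain D where D: "has_local_dim \<mu> (S \<omega> 0 / (1 - R \<omega>)) (ereal D)" "ln P \<le> D * ln (R \<omega>)"
      "D * ln (R \<omega>) \<le> ln (spread t0 U * measure \<mu> (S \<omega> ` ?J))"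
      by (rule periodic_local_dim[OF pos inside_\<omega> P low])
    have R_\<omega>: "R \<omega> = l * \<bar>R \<sigma>\<bar> * \<bar>R \<zeta>\<bar> * \<bar>R \<eta>\<bar>"
    proof -
      have "R (h \<sigma>1) = l * R \<sigma>1" by (simp add: ratio_word_eq[of r _ d] h[OF \<sigma>1(1)] \<psi>_def aff_diff)
      moreover have "R \<sigma>1 * R \<tau>1 = R \<sigma>"
      proof -
        have "R (\<sigma>1 @ \<tau>1) = R \<sigma>" using \<tau>1 by (simp add: ratio_word_eq[of r _ d] T_def)
        then show ?thesis by (simp add: ratio_word_append)
      qed
      ultimately have "R \<omega> = l * R \<sigma> * R \<zeta> * R \<eta>" by (simp add: \<omega>_def ratio_word_append mult.assoc)
      then have "\<bar>R \<omega>\<bar> = l * \<bar>R \<sigma>\<bar> * \<bar>R \<zeta>\<bar> * \<bar>R \<eta>\<bar>" using l by (simp add: abs_mult)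
      then show ?thesis using pos by simp
    qed
    have q_low: "s / B \<le> R \<omega>"
    proof -
      have "1 / B * s \<le> c2 * s" using inv_B(2) s by (intro mult_right_mono) auto
      also have "\<dots> = l * (s * rmin) * \<bar>R \<zeta>\<bar> * rmin" by (simp add: c2_def)
      also have "\<dots> \<le> l * \<bar>R \<sigma>\<bar> * \<bar>R \<zeta>\<bar> * \<bar>R \<eta>\<bar>"
        using l s Lam_R_lower[OF \<sigma> s(1,3)] short_word(2)[OF \<eta>(2)] rmin by (intro mult_mono mult_nonneg_nonneg) auto
      also have "\<dots> = R \<omega>" by (rule R_\<omega>[symmetric])
      finally show ?thesis by simp
    qed
    have q_up: "R \<omega> \<le> B * s"
    proof -
      have "R \<omega> \<le> B * s * 1 * 1" unfolding R_\<omega>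
        using l B(3) Lam_R[OF \<sigma>] R_le_1 s by (intro mult_mono mult_nonneg_nonneg) auto
      then show ?thesis by simp
    qed
    have "ln (wt s (S \<sigma>) / B) \<le> ln P"
    proof (rule ln_mono)
      have "wt s (S \<sigma>) / B \<le> c1 * wt s (S \<sigma>)" using mult_right_mono[OF inv_B(1), of "wt s (S \<sigma>)"] wt_pos by simp
      also have "\<dots> \<le> c1 * (N * Q \<sigma>1)" using c1 \<sigma>1 by (intro mult_left_mono) auto
      also have "\<dots> = wmin * Q \<sigma>1 * (W \<zeta> * pmin)" using N by (simp add: c1_def)
      also have "\<dots> \<le> W (h \<sigma>1) * Q \<sigma>1 * (W \<zeta> * W \<eta>)"
        using wmin \<sigma>1(1) short_word(1)[OF \<eta>(2)] W_pos \<open>Q \<sigma>1 > 0\<close> pmin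
        by (intro mult_mono mult_nonneg_nonneg) (auto simp: less_imp_le)
      finally show "wt s (S \<sigma>) / B \<le> P" by (simp add: P_def word_weight_append)
    qed (use wt_pos B_pos P in auto)
    moreover have "ln (spread t0 U * measure \<mu> (S \<omega> ` ?J)) \<le> ln (B * measure \<mu> (S (\<sigma> @ \<zeta>) ` ?J))"
    proof (rule ln_mono)
      have "measure \<mu> (S \<omega> ` ?J) \<le> measure \<mu> (\<psi> ` S (\<sigma> @ \<zeta>) ` ?J)" using \<omega>_image borel by (intro measure_mono)
      also have "\<dots> \<le> spread t1 ?I * measure \<mu> (\<psi> ` ?J) * measure \<mu> (S (\<sigma> @ \<zeta>) ` ?J)"
        unfolding \<psi>_def by (rule measure_loc_iso[OF iso(1) t1(1) th(1) sub borel(1)])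
      also have "\<dots> \<le> spread t1 ?I * 1 * measure \<mu> (S (\<sigma> @ \<zeta>) ` ?J)"
        using spread_nonneg[OF t1(1)] by (intro mult_right_mono mult_left_mono) auto
      finally have "spread t0 U * measure \<mu> (S \<omega> ` ?J) \<le> C * measure \<mu> (S (\<sigma> @ \<zeta>) ` ?J)"
        using mult_left_mono[OF _ spread_nonneg[OF t0(1)]] by (fastforce simp: C_def mult.assoc)
      also have "\<dots> \<le> B * measure \<mu> (S (\<sigma> @ \<zeta>) ` ?J)" using B(4) by (intro mult_right_mono) auto
      finally show "spread t0 U * measure \<mu> (S \<omega> ` ?J) \<le> B * measure \<mu> (S (\<sigma> @ \<zeta>) ` ?J)" .
      show "0 < spread t0 U * measure \<mu> (S \<omega> ` ?J)"
        using spread_pos measure_word_image_pos by simp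
    qed
    ultimately show ?thesis
      unfolding good_def using D periodic_point[OF pos inside_\<omega>] pos contracting_word(1)[OF pos inside_\<omega>] q_low q_up
      by (intro bexI[of _ "S \<omega> 0 / (1 - R \<omega>)"] exI[of _ D] exI[of _ "R \<omega>"]) auto
  qed
  then show ?thesis using that B_pos by blast
qed

end

subsection \<open>Approximation at a point of the essential class\<close>

text \<open>Meant for \<open>x = - ln t\<close>, \<open>y = - ln q\<close> and \<open>m\<close> the
  negative logarithm of the measure of a ball. Constant factors become additive errors
  \<open>b\<close>, and \<open>m \<le> c * x\<close> keeps their effect on the quotient of order
  \<open>1 / x\<close>.\<close>

lemma ratio_approx_upper:
  fixes x y b c m :: real
  assumes "b \<ge> 0" "x > b" "0 \<le> m" "m \<le> c * x" "\<bar>y - x\<bar> \<le> b"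
  shows "(m + b) / y \<le> m / x + (c * b + b) / (x - b)"
proof -
  have "(m + b) / y \<le> (m + b) / (x - b)" using assms by (intro divide_left_mono) auto
  also have "\<dots> = m / x + (m / x * b + b) / (x - b)" using assms by (simp add: field_simps)
  also have "\<dots> \<le> m / x + (c * b + b) / (x - b)"
    using assms by (intro add_left_mono divide_right_mono add_right_mono mult_right_mono) (auto simp: field_simps)
  finally show ?thesis .
qed

text \<open>The shift \<open>h\<close> will be \<open>ln 4\<close>, from the ball of radius
  \<open>4 * t\<close>. The sign of \<open>y - (x - h)\<close> is not known; if it is negative, the
  difference of the quotients is at most 0.\<close>

lemma ratio_approx_lower:
  fixes x y b c h m :: real
  assumes "b \<ge> 0" "h \<ge> 0" "x > b" "x > h" "0 \<le> m" "m \<le> c * (x - h)" "\<bar>y - x\<bar> \<le> b"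
  shows "m / (x - h) - (c * (h + b) + b) / (x - b) \<le> (m - b) / y"
proof -
  have y: "y > 0" "y \<ge> x - b" "y \<le> x + b" using assms by auto
  have c: "c \<ge> 0" using order.trans[OF assms(5,6)] assms(4) by (simp add: zero_le_mult_iff)
  have "m / (x - h) - m / y = m / (x - h) * ((y - (x - h)) / y)" using y assms by (simp add: field_simps)
  also have "\<dots> \<le> c * ((h + b) / (x - b))"
  proof (cases "y - (x - h) \<ge> 0")
    case True
    have "m / (x - h) \<le> c" using assms by (simp add: field_simps)
    moreover have "(y - (x - h)) / y \<le> (h + b) / (x - b)" using y assms True by (intro frac_le) auto
    ultimately show ?thesis using True y c by (intro mult_mono) auto
  next
    case False
    then have "m / (x - h) * ((y - (x - h)) / y) \<le> 0" using y assms
      by (intro mult_nonneg_nonpos divide_nonneg_nonneg divide_nonpos_nonneg) auto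
    moreover have "0 \<le> c * ((h + b) / (x - b))" using assms c by simp
    ultimately show ?thesis by linarith
  qed
  finally have "m / (x - h) - m / y \<le> c * ((h + b) / (x - b))" .
  moreover have "b / y \<le> b / (x - b)" using y assms by (intro divide_left_mono) auto
  moreover have "(m - b) / y = m / y - b / y" by (rule diff_divide_distrib)
  moreover have "(c * (h + b) + b) / (x - b) = c * ((h + b) / (x - b)) + b / (x - b)"
    by (simp only: add_divide_distrib[of "c * (h + b)" b] times_divide_eq_right)
  ultimately show ?thesis by linarith
qed

context centred_ssm
begin

text \<open>If \<open>K\<close> accumulates at \<open>x\<close> from one side, the gap between end
  points on that side is a net interval in every generation, and these intervals form a symbolic
  representation of \<open>x\<close>. As \<open>x\<close> is in \<open>K_ess\<close>, one of their
  vertices is essential.\<close>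

lemma sides:
  assumes x: "x \<in> K_ess r d K"
  shows "(\<exists>e>0. K \<inter> {x<..<x + e} = {}) \<or>
      (\<exists>t a b. (t, a, b) \<in> Net \<and> V (ts, as, bs) \<rightarrow>\<^sup>*\<^bsub>G\<^esub> V (t, a, b) \<and> a \<le> x \<and> x < b)" (is ?right)
    and "(\<exists>e>0. K \<inter> {x - e<..<x} = {}) \<or>
      (\<exists>t a b. (t, a, b) \<in> Net \<and> V (ts, as, bs) \<rightarrow>\<^sup>*\<^bsub>G\<^esub> V (t, a, b) \<and> a < x \<and> x \<le> b)" (is ?left)
proof -
  have x01: "0 \<le> x" "x \<le> 1" using x K_subset by (auto simp: K_ess_def)
  show ?right
  proof (rule disjCI)
    assume "\<not> (\<exists>t a b. (t, a, b) \<in> Net \<and> V (ts, as, bs) \<rightarrow>\<^sup>*\<^bsub>G\<^esub> V (t, a, b) \<and> a \<le> x \<and> x < b)"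
    then have none: "\<And>t a b. (t, a, b) \<in> Net \<Longrightarrow> V (ts, as, bs) \<rightarrow>\<^sup>*\<^bsub>G\<^esub> V (t, a, b) \<Longrightarrow> a \<le> x \<Longrightarrow> x < b \<Longrightarrow> False" by blast
    show "\<exists>e>0. K \<inter> {x<..<x + e} = {}"
    proof (rule ccontr)
      assume "\<not> ?thesis"
      then have acc: "K \<inter> {x<..<x + e} \<noteq> {}" if "e > 0" for e using that by blast
      have "x < 1"
      proof -
        obtain z where "z \<in> K" "z \<in> {x<..<x + 1}" using acc[OF zero_less_one] by blast
        then show ?thesis using K_subset by fastforce
      qed
      have ex: "\<exists>a b. (t, a, b) \<in> Net \<and> a \<le> x \<and> x < b" if t: "t > 0" for t
      proof -
        obtain a b where ab: "a \<in> endp t" "b \<in> endp t" "a \<le> x" "x < b" "{a<..<b} \<inter> endp t = {}"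
          by (rule endp_right[OF t x01(1) \<open>x < 1\<close>])
        have "b - x > 0" using ab(4) by simp
        from acc[OF this] obtain z where z: "z \<in> K" "z \<in> {x<..<x + (b - x)}" by blast
        have "z \<in> {a<..<b}" using z ab by auto
        then have "(t, a, b) \<in> Net" unfolding in_Net using ab z(1) t by auto
        then show ?thesis using ab by blast
      qed
      obtain D where D: "symbolic_rep r d K x (\<lambda>n. edge_label r d K (D n) (D (Suc n)))"
        "\<And>n. is_child r d K (D n) (D (Suc n))" "\<And>n. fst (snd (D n)) \<le> x \<and> x < snd (snd (D n))"
      proof (rule side_rep[of "\<lambda>a b. a \<le> x \<and> x < b" x])
        fix a b a' b' :: real assume "a < b" "a' < b'" "a \<le> x \<and> x < b" "a' \<le> x \<and> x < b'"
        moreover from this obtain z where "x < z" "z < min b b'" using dense[of x "min b b'"] by auto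
        ultimately have "z \<in> {a<..<b}" "z \<in> {a'<..<b'}" by auto
        then show "{a<..<b} \<inter> {a'<..<b'} \<noteq> {}" by blast
      qed (use ex in auto)
      obtain n where n: "V (ts, as, bs) \<rightarrow>\<^sup>*\<^bsub>G\<^esub> V (D n)" by (rule K_ess_rep[OF x D(1)])
      obtain t a b where "D n = (t, a, b)" by (metis surj_pair)
      then show False using none[of t a b] n D(2)[of n] D(3)[of n] by (auto simp: is_child_def)
    qed
  qed
  show ?left
  proof (rule disjCI)
    assume "\<not> (\<exists>t a b. (t, a, b) \<in> Net \<and> V (ts, as, bs) \<rightarrow>\<^sup>*\<^bsub>G\<^esub> V (t, a, b) \<and> a < x \<and> x \<le> b)"
    then have none: "\<And>t a b. (t, a, b) \<in> Net \<Longrightarrow> V (ts, as, bs) \<rightarrow>\<^sup>*\<^bsub>G\<^esub> V (t, a, b) \<Longrightarrow> a < x \<Longrightarrow> x \<le> b \<Longrightarrow> False" by blast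
    show "\<exists>e>0. K \<inter> {x - e<..<x} = {}"
    proof (rule ccontr)
      assume "\<not> ?thesis"
      then have acc: "K \<inter> {x - e<..<x} \<noteq> {}" if "e > 0" for e using that by blast
      have "0 < x"
      proof -
        obtain z where "z \<in> K" "z \<in> {x - 1<..<x}" using acc[OF zero_less_one] by blast
        then show ?thesis using K_subset by fastforce
      qed
      have ex: "\<exists>a b. (t, a, b) \<in> Net \<and> a < x \<and> x \<le> b" if t: "t > 0" for t
      proof -
        obtain a b where ab: "a \<in> endp t" "b \<in> endp t" "a < x" "x \<le> b" "{a<..<b} \<inter> endp t = {}"
          by (rule endp_left[OF t \<open>0 < x\<close> x01(2)])
        have "x - a > 0" using ab(3) by simp
        from acc[OF this] obtain z where z: "z \<in> K" "z \<in> {x - (x - a)<..<x}" by blast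
        have "z \<in> {a<..<b}" using z ab by auto
        then have "(t, a, b) \<in> Net" unfolding in_Net using ab z(1) t by auto
        then show ?thesis using ab by blast
      qed
      obtain D where D: "symbolic_rep r d K x (\<lambda>n. edge_label r d K (D n) (D (Suc n)))"
        "\<And>n. is_child r d K (D n) (D (Suc n))" "\<And>n. fst (snd (D n)) < x \<and> x \<le> snd (snd (D n))"
      proof (rule side_rep[of "\<lambda>a b. a < x \<and> x \<le> b" x])
        fix a b a' b' :: real assume "a < b" "a' < b'" "a < x \<and> x \<le> b" "a' < x \<and> x \<le> b'"
        moreover from this obtain z where "max a a' < z" "z < x" using dense[of "max a a'" x] by auto
        ultimately have "z \<in> {a<..<b}" "z \<in> {a'<..<b'}" by auto
        then show "{a<..<b} \<inter> {a'<..<b'} \<noteq> {}" by blast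
      qed (use ex in auto)
      obtain n where n: "V (ts, as, bs) \<rightarrow>\<^sup>*\<^bsub>G\<^esub> V (D n)" by (rule K_ess_rep[OF x D(1)])
      obtain t a b where "D n = (t, a, b)" by (metis surj_pair)
      then show False using none[of t a b] n D(2)[of n] D(3)[of n] by (auto simp: is_child_def)
    qed
  qed
qed

text \<open>An image in \<open>I s\<close> contains a point of \<open>K\<close>, so in the first
  alternative no small scale occurs; in the second \<open>transplant\<close> applies once
  \<open>I s\<close> lies in the net interval. Stating it for all large \<open>B\<close> lets
  finitely many constants be merged.\<close>

lemma good_one_side:
  assumes I: "\<And>s. I s = {x<..<x + 2 * s} \<or> I s = {x - 2 * s<..<x}"
    and side: "(\<exists>e>0. \<forall>s. 0 < s \<and> s < e \<longrightarrow> K \<inter> I s = {}) \<or>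
      (\<exists>t a b. (t, a, b) \<in> Net \<and> V (ts, as, bs) \<rightarrow>\<^sup>*\<^bsub>G\<^esub> V (t, a, b) \<and> (\<exists>e>0. \<forall>s. 0 < s \<and> s < e \<longrightarrow> I s \<subseteq> {a<..<b}))"
  shows "\<forall>\<^sub>F B in at_top. \<forall>s \<sigma>. 0 < s \<longrightarrow> s < 1 / B \<longrightarrow> \<sigma> \<in> Lam s \<longrightarrow> S (\<sigma> @ \<zeta>) ` {0..1} \<subseteq> I s \<longrightarrow> good \<zeta> B s \<sigma>"
  using side
proof (elim disjE exE conjE)
  fix e :: real assume e: "e > 0" "\<forall>s. 0 < s \<and> s < e \<longrightarrow> K \<inter> I s = {}"
  show ?thesis
    using eventually_ge_at_top[of "1 / e"]
  proof eventually_elim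
    case (elim B)
    have "B > 0" using elim e by (meson less_le_trans zero_less_divide_1_iff)
    then have "1 / B \<le> e" using elim e by (simp add: field_simps)
    show ?case
    proof (intro allI impI)
      fix s \<sigma> assume s: "0 < s" "s < 1 / B" "S (\<sigma> @ \<zeta>) ` {0..1} \<subseteq> I s"
      have "S (\<sigma> @ \<zeta>) 0 \<in> K" using S_K zero_in_K by blast
      moreover have "S (\<sigma> @ \<zeta>) 0 \<in> I s" using s(3) by (simp add: image_subset_iff)
      moreover have "K \<inter> I s = {}" using e(2) s(1,2) \<open>1 / B \<le> e\<close> by simp
      ultimately show "good \<zeta> B s \<sigma>" by blast
    qed
  qed
next
  fix t a b e
  assume net: "(t, a, b) \<in> Net" "V (ts, as, bs) \<rightarrow>\<^sup>*\<^bsub>G\<^esub> V (t, a, b)"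
    and e: "e > 0" "\<forall>s. 0 < s \<and> s < e \<longrightarrow> I s \<subseteq> {a<..<b}"
  have t: "t > 0" using net by (simp add: in_Net)
  obtain B0 where B0: "B0 > 0" "\<And>s \<sigma>. 0 < s \<Longrightarrow> s \<le> t \<Longrightarrow> s \<le> 1 \<Longrightarrow> \<sigma> \<in> Lam s \<Longrightarrow>
    S (\<sigma> @ \<zeta>) ` {0..1} \<subseteq> {a<..<b} \<Longrightarrow> good \<zeta> B0 s \<sigma>" by (rule transplant[OF net, of \<zeta>]) blast
  show ?thesis
    using eventually_ge_at_top[of "Max {B0, 1 / e, 1 / t, 1}"]
  proof eventually_elim
    case (elim B)
    then have B: "B0 \<le> B" "1 / e \<le> B" "1 / t \<le> B" "1 \<le> B" by auto
    then have le: "1 / B \<le> e" "1 / B \<le> t" "1 / B \<le> 1" using e t by (simp_all add: field_simps)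
    show ?case
    proof (intro allI impI)
      fix s \<sigma> assume s: "0 < s" "s < 1 / B" "\<sigma> \<in> Lam s" "S (\<sigma> @ \<zeta>) ` {0..1} \<subseteq> I s"
      have "I s \<subseteq> {a<..<b}" using e(2) s(1,2) le by auto
      then have "S (\<sigma> @ \<zeta>) ` {0..1} \<subseteq> {a<..<b}" using s(4) by blast
      then have "good \<zeta> B0 s \<sigma>" using B0(2) s le by auto
      then show "good \<zeta> B s \<sigma>" using good_mono B0(1) B(1) s by blast
    qed
  qed
qed

text \<open>Pigeonhole among the at most \<open>N\<close> maps that meet \<open>ball x s\<close>:
  they account for all of the measure of the smaller ball.\<close>

lemma heavy_map:
  assumes N: "card (M s (ball x s)) \<le> N" and s: "s > 0" and x: "x \<in> K"
  obtains \<sigma> where "\<sigma> \<in> Lam s" "measure \<mu> (cball x (s / 2)) \<le> real N * wt s (S \<sigma>)" "S \<sigma> ` {0..1} \<subseteq> ball x (2 * s)"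
proof -
  have "measure \<mu> (cball x (s / 2)) = (\<Sum>f\<in>M s (ball x s). wt s f * measure \<mu> (f -` cball x (s / 2)))"
    using s by (intro measure_local) auto
  also have "\<dots> \<le> (\<Sum>f\<in>M s (ball x s). wt s f)"
    using wt_pos[OF s] by (intro sum_mono) (simp add: mult_left_le less_imp_le)
  finally have le: "measure \<mu> (cball x (s / 2)) \<le> (\<Sum>f\<in>M s (ball x s). wt s f)" .
  have ne: "M s (ball x s) \<noteq> {}" using in_K_iff[OF s, of x "ball x s"] s x by auto
  obtain f where f: "f \<in> M s (ball x s)" "measure \<mu> (cball x (s / 2)) \<le> real (card (M s (ball x s))) * wt s f"
    using sum_pigeonhole[OF finite_M[OF s] ne le] by metis
  obtain \<sigma> where \<sigma>: "f = S \<sigma>" "\<sigma> \<in> Lam s" using M_E[OF f(1)] by metis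
  have "real (card (M s (ball x s))) * wt s f \<le> real N * wt s f"
    using N wt_pos[OF s f(1)] by (intro mult_right_mono) auto
  then have 1: "measure \<mu> (cball x (s / 2)) \<le> real N * wt s (S \<sigma>)" using f(2) \<sigma>(1) by simp
  have "S \<sigma> ` K \<inter> ball x s \<noteq> {}" using f(1) unfolding \<sigma>(1) by (auto elim!: M_E simp: in_M)
  then obtain u where u: "u \<in> K" "S \<sigma> u \<in> ball x s" by blast
  have "S \<sigma> z \<in> ball x (2 * s)" if z: "z \<in> {0..1}" for z
  proof -
    have "\<bar>z - u\<bar> \<le> 1" using z u(1) K_subset by fastforce
    then have "\<bar>R \<sigma>\<bar> * \<bar>z - u\<bar> \<le> \<bar>R \<sigma>\<bar>" by (intro mult_left_le) auto
    also have "\<dots> < s" using Lam_R[OF \<sigma>(2)] .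
    finally have "\<bar>S \<sigma> z - S \<sigma> u\<bar> < s" by (simp add: sim_word_diff abs_mult)
    moreover have "\<bar>x - S \<sigma> u\<bar> < s" using u(2) by (simp add: dist_real_def)
    ultimately have "\<bar>x - S \<sigma> z\<bar> < 2 * s" by linarith
    then show ?thesis by (simp add: dist_real_def)
  qed
  then show ?thesis using that[OF \<sigma>(2) 1] by blast
qed

lemma measure_cball_ge:
  assumes "x \<in> K" "t > 0"
  obtains \<rho> where "\<rho> \<in> Lam t" "W \<rho> \<le> measure \<mu> (cball x t)"
proof -
  obtain \<rho> u where \<rho>: "\<rho> \<in> Lam t" "u \<in> K" "S \<rho> u = x" using K_word[OF assms(2,1)] by metis
  have "S \<rho> ` {0..1} \<subseteq> cball x t"
  proof (intro image_subsetI)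
    fix z :: real assume "z \<in> {0..1}"
    then have "\<bar>u - z\<bar> \<le> 1" using \<rho>(2) K_subset by fastforce
    then have "\<bar>R \<rho>\<bar> * \<bar>u - z\<bar> \<le> \<bar>R \<rho>\<bar>" by (intro mult_left_le) auto
    then have "\<bar>R \<rho>\<bar> * \<bar>u - z\<bar> \<le> t" using Lam_R[OF \<rho>(1)] by linarith
    then show "S \<rho> z \<in> cball x t" using sim_word_diff[of r d \<rho> u z] \<rho>(3)
      by (simp add: dist_real_def abs_mult)
  qed
  then have "measure \<mu> (S \<rho> ` {0..1}) \<le> measure \<mu> (cball x t)" by (intro measure_mono) auto
  then show ?thesis using that[OF \<rho>(1)] measure_image_ge[of "{0..1}" \<rho>] measure_J by simp
qed

lemma interval_one_side:
  assumes "S \<rho> ` {0..1} \<subseteq> ball x e" "x \<notin> S \<rho> ` {0..1}"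
  shows "S \<rho> ` {0..1} \<subseteq> {x<..<x + e} \<or> S \<rho> ` {0..1} \<subseteq> {x - e<..<x}"
proof (rule ccontr)
  assume "\<not> ?thesis"
  then obtain u v where uv: "u \<in> S \<rho> ` {0..1}" "u \<notin> {x<..<x + e}" "v \<in> S \<rho> ` {0..1}" "v \<notin> {x - e<..<x}" by blast
  have "u \<in> ball x e" "v \<in> ball x e" "u \<noteq> x" "v \<noteq> x" using uv(1,3) assms by blast+
  then have "u < x" "x < v" using uv(2,4) by (auto simp: dist_real_def)
  have "continuous_on {0..1} (S \<rho>)" by (subst S_eq_aff) (auto simp: aff_def intro!: continuous_intros)
  from connected_continuous_image[OF this connected_Icc] have "{u..v} \<subseteq> S \<rho> ` {0..1}"
    using uv(1,3) by (rule connected_contains_Icc)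
  moreover have "x \<in> {u..v}" using \<open>u < x\<close> \<open>x < v\<close> by simp
  ultimately show False using assms(2) by blast
qed

text \<open>\<open>\<zeta>0\<close> and \<open>\<zeta>1\<close> have disjoint images, so the heavy
  map followed by one of them has an image that avoids \<open>x\<close>. Being an interval, it lies
  on one side of \<open>x\<close>, where \<open>good_one_side\<close> applies.\<close>

lemma approximating_periodic_points:
  assumes x: "x \<in> K_ess r d K" and N: "\<And>x t. t > 0 \<Longrightarrow> card (M t (ball x t)) \<le> N"
  obtains B where "B \<ge> 1" "\<And>t. 0 < t \<Longrightarrow> t < 1 / B \<Longrightarrow> \<exists>y\<in>periodic_points r d K. \<exists>D q.
    has_local_dim \<mu> y (ereal D) \<and> 0 < q \<and> q < 1 \<and> t / B \<le> q \<and> q \<le> B * t \<and>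
    ln (measure \<mu> (cball x t) / B) \<le> D * ln q \<and> D * ln q \<le> ln (B * measure \<mu> (cball x (4 * t)))"
proof -
  let ?J = "{0..1::real}"
  have xK: "x \<in> K" using x by (simp add: K_ess_def)
  obtain \<zeta>0 where \<zeta>0: "S \<zeta>0 ` ?J \<subseteq> ball 0 (1 / 3)" by (rule small_image[OF zero_in_K, of "1 / 3"]) simp_all
  obtain \<zeta>1 where \<zeta>1: "S \<zeta>1 ` ?J \<subseteq> ball 1 (1 / 3)" by (rule small_image[OF one_in_K, of "1 / 3"]) simp_all
  have disj: "S \<zeta>0 u \<noteq> S \<zeta>1 v" if "u \<in> ?J" "v \<in> ?J" for u v
  proof -
    have "S \<zeta>0 u \<in> ball 0 (1 / 3)" "S \<zeta>1 v \<in> ball 1 (1 / 3)" using that \<zeta>0 \<zeta>1 by blast+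
    then show ?thesis by (auto simp: dist_real_def)
  qed
  have right_side: "(\<exists>e>0. \<forall>s. 0 < s \<and> s < e \<longrightarrow> K \<inter> {x<..<x + 2 * s} = {}) \<or>
      (\<exists>t a b. (t, a, b) \<in> Net \<and> V (ts, as, bs) \<rightarrow>\<^sup>*\<^bsub>G\<^esub> V (t, a, b) \<and> (\<exists>e>0. \<forall>s. 0 < s \<and> s < e \<longrightarrow> {x<..<x + 2 * s} \<subseteq> {a<..<b}))"
    using sides(1)[OF x]
  proof (elim disjE exE conjE)
    fix e :: real assume "e > 0" "K \<inter> {x<..<x + e} = {}"
    then show ?thesis
      by (intro disjI1 exI[of _ "e / 2"]) (auto simp: disjoint_iff)
  next
    fix t a b assume *: "(t, a, b) \<in> Net" "V (ts, as, bs) \<rightarrow>\<^sup>*\<^bsub>G\<^esub> V (t, a, b)" "a \<le> x" "x < b"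
    have "\<exists>e>0. \<forall>s. 0 < s \<and> s < e \<longrightarrow> {x<..<x + 2 * s} \<subseteq> {a<..<b}"
      using *(3,4) by (intro exI[of _ "(b - x) / 2"]) auto
    then show ?thesis
      using * by blast
  qed
  have right: "\<forall>\<^sub>F B in at_top. \<forall>s \<sigma>. 0 < s \<longrightarrow> s < 1 / B \<longrightarrow> \<sigma> \<in> Lam s \<longrightarrow>
      S (\<sigma> @ \<zeta>) ` ?J \<subseteq> {x<..<x + 2 * s} \<longrightarrow> good \<zeta> B s \<sigma>" for \<zeta>
    by (rule good_one_side[where x=x, OF _ right_side]) simp
  have left_side: "(\<exists>e>0. \<forall>s. 0 < s \<and> s < e \<longrightarrow> K \<inter> {x - 2 * s<..<x} = {}) \<or>
      (\<exists>t a b. (t, a, b) \<in> Net \<and> V (ts, as, bs) \<rightarrow>\<^sup>*\<^bsub>G\<^esub> V (t, a, b) \<and> (\<exists>e>0. \<forall>s. 0 < s \<and> s < e \<longrightarrow> {x - 2 * s<..<x} \<subseteq> {a<..<b}))"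
    using sides(2)[OF x]
  proof (elim disjE exE conjE)
    fix e :: real assume "e > 0" "K \<inter> {x - e<..<x} = {}"
    then show ?thesis
      by (intro disjI1 exI[of _ "e / 2"]) (auto simp: disjoint_iff)
  next
    fix t a b assume *: "(t, a, b) \<in> Net" "V (ts, as, bs) \<rightarrow>\<^sup>*\<^bsub>G\<^esub> V (t, a, b)" "a < x" "x \<le> b"
    have "\<exists>e>0. \<forall>s. 0 < s \<and> s < e \<longrightarrow> {x - 2 * s<..<x} \<subseteq> {a<..<b}"
      using *(3,4) by (intro exI[of _ "(x - a) / 2"]) auto
    then show ?thesis
      using * by blast
  qed
  have left: "\<forall>\<^sub>F B in at_top. \<forall>s \<sigma>. 0 < s \<longrightarrow> s < 1 / B \<longrightarrow> \<sigma> \<in> Lam s \<longrightarrow>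
      S (\<sigma> @ \<zeta>) ` ?J \<subseteq> {x - 2 * s<..<x} \<longrightarrow> good \<zeta> B s \<sigma>" for \<zeta>
    by (rule good_one_side[where x=x, OF _ left_side]) simp
  obtain B where B: "B \<ge> 1"
    "\<And>\<zeta> s \<sigma>. \<zeta> = \<zeta>0 \<or> \<zeta> = \<zeta>1 \<Longrightarrow> 0 < s \<Longrightarrow> s < 1 / B \<Longrightarrow> \<sigma> \<in> Lam s \<Longrightarrow>
      S (\<sigma> @ \<zeta>) ` ?J \<subseteq> {x<..<x + 2 * s} \<or> S (\<sigma> @ \<zeta>) ` ?J \<subseteq> {x - 2 * s<..<x} \<Longrightarrow> good \<zeta> B s \<sigma>"
  proof -
    have "\<forall>\<^sub>F B in at_top. B \<ge> 1 \<and> (\<forall>\<zeta>\<in>{\<zeta>0, \<zeta>1}. (\<forall>s \<sigma>. 0 < s \<longrightarrow> s < 1 / B \<longrightarrow> \<sigma> \<in> Lam s \<longrightarrow>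
      S (\<sigma> @ \<zeta>) ` ?J \<subseteq> {x<..<x + 2 * s} \<longrightarrow> good \<zeta> B s \<sigma>) \<and> (\<forall>s \<sigma>. 0 < s \<longrightarrow> s < 1 / B \<longrightarrow> \<sigma> \<in> Lam s \<longrightarrow>
      S (\<sigma> @ \<zeta>) ` ?J \<subseteq> {x - 2 * s<..<x} \<longrightarrow> good \<zeta> B s \<sigma>))"
      using left right by (intro eventually_conj eventually_ge_at_top eventually_ball_finite ballI) auto
    then obtain B where "B \<ge> 1 \<and> (\<forall>\<zeta>\<in>{\<zeta>0, \<zeta>1}. (\<forall>s \<sigma>. 0 < s \<longrightarrow> s < 1 / B \<longrightarrow> \<sigma> \<in> Lam s \<longrightarrow>
      S (\<sigma> @ \<zeta>) ` ?J \<subseteq> {x<..<x + 2 * s} \<longrightarrow> good \<zeta> B s \<sigma>) \<and> (\<forall>s \<sigma>. 0 < s \<longrightarrow> s < 1 / B \<longrightarrow> \<sigma> \<in> Lam s \<longrightarrow>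
      S (\<sigma> @ \<zeta>) ` ?J \<subseteq> {x - 2 * s<..<x} \<longrightarrow> good \<zeta> B s \<sigma>))"
      using eventually_happens'[OF trivial_limit_at_top_linorder] by blast
    then show ?thesis using that[of B] by blast
  qed
  \<comment> \<open>\<open>2 * B\<close> accounts for \<open>s = 2 * t\<close>, and
    \<open>B * real N\<close> for the pigeonhole in \<open>heavy_map\<close>.\<close>
  define B' where "B' = 2 * B * (real N + 1)"
  have B': "2 * B \<le> B'" "B' \<ge> 1" "B * real N \<le> B'"
  proof -
    have "0 \<le> B * real N" using B(1) by simp
    moreover have "B' = 2 * (B * real N) + 2 * B" by (simp add: B'_def algebra_simps)
    ultimately show "2 * B \<le> B'" "B' \<ge> 1" "B * real N \<le> B'" using B(1) by linarith+
  qed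
  have "\<exists>y\<in>periodic_points r d K. \<exists>D q. has_local_dim \<mu> y (ereal D) \<and> 0 < q \<and> q < 1 \<and> t / B' \<le> q \<and> q \<le> B' * t \<and>
    ln (measure \<mu> (cball x t) / B') \<le> D * ln q \<and> D * ln q \<le> ln (B' * measure \<mu> (cball x (4 * t)))"
    if t: "0 < t" "t < 1 / B'" for t
  proof -
    \<comment> \<open>The closed ball of radius \<open>t = s / 2\<close> sits in the open ball of
      radius \<open>s\<close>, and images that meet the latter stay within
      \<open>2 * s = 4 * t\<close> of \<open>x\<close>.\<close>
    define s where "s = 2 * t"
    have s: "s > 0" using t by (simp add: s_def)
    have "s < 1 / B"
    proof -
      have "1 / B' \<le> 1 / (2 * B)" using B' B(1) by (intro divide_left_mono) auto
      then show ?thesis using t(2) by (simp add: s_def)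
    qed
    obtain \<sigma> where \<sigma>: "\<sigma> \<in> Lam s" "measure \<mu> (cball x (s / 2)) \<le> real N * wt s (S \<sigma>)" "S \<sigma> ` ?J \<subseteq> ball x (2 * s)"
      by (rule heavy_map[OF N[OF s] s xK])
    obtain \<zeta> where \<zeta>: "\<zeta> = \<zeta>0 \<or> \<zeta> = \<zeta>1" "x \<notin> S (\<sigma> @ \<zeta>) ` ?J"
    proof (cases "x \<in> S (\<sigma> @ \<zeta>0) ` ?J")
      case False
      then show ?thesis using that by blast
    next
      case True
      have "x \<notin> S (\<sigma> @ \<zeta>1) ` ?J"
      proof
        assume "x \<in> S (\<sigma> @ \<zeta>1) ` ?J"
        then obtain u v where "u \<in> ?J" "v \<in> ?J" "S \<sigma> (S \<zeta>0 u) = S \<sigma> (S \<zeta>1 v)"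
          using True by (auto simp: sim_word_append)
        then show False using disj injD[OF S_inj] by metis
      qed
      then show ?thesis using that by blast
    qed
    have sub: "S (\<sigma> @ \<zeta>) ` ?J \<subseteq> ball x (2 * s)" using \<sigma>(3) S_J[of \<zeta>] by (auto simp: sim_word_append image_subset_iff)
    have "good \<zeta> B s \<sigma>"
      using B(2)[OF \<zeta>(1) s \<open>s < 1 / B\<close> \<sigma>(1)] interval_one_side[OF sub \<zeta>(2)] by blast
    then obtain y D q where y: "y \<in> periodic_points r d K" "has_local_dim \<mu> y (ereal D)" "0 < q" "q < 1"
      "s / B \<le> q" "q \<le> B * s" "ln (wt s (S \<sigma>) / B) \<le> D * ln q"
      "D * ln q \<le> ln (B * measure \<mu> (S (\<sigma> @ \<zeta>) ` ?J))" unfolding good_def by blast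
    have wt: "wt s (S \<sigma>) > 0" using s \<sigma>(1) by (rule wt_word_pos)
    have mpos: "measure \<mu> (cball x t) > 0"
      using measure_cball_ge[OF xK t(1)] W_pos by (metis less_le_trans)
    have "t / B' \<le> q"
    proof -
      have "t / B' \<le> s / B" using t B(1) B' by (intro frac_le) (auto simp: s_def)
      then show ?thesis using y(5) by linarith
    qed
    moreover have "q \<le> B' * t"
    proof -
      have "B * s \<le> B' * t" using B'(1) t by (simp add: s_def)
      then show ?thesis using y(6) by linarith
    qed
    moreover have "ln (measure \<mu> (cball x t) / B') \<le> D * ln q"
    proof -
      have "measure \<mu> (cball x t) / B' \<le> wt s (S \<sigma>) / B"
      proof -
        have "measure \<mu> (cball x t) * B \<le> real N * wt s (S \<sigma>) * B"
          using \<sigma>(2) B(1) by (intro mult_right_mono) (auto simp: s_def)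
        also have "\<dots> \<le> B' * wt s (S \<sigma>)" using B'(3) wt by (simp add: mult.commute mult.left_commute)
        finally show ?thesis using B(1) B' by (simp add: field_simps)
      qed
      then have "ln (measure \<mu> (cball x t) / B') \<le> ln (wt s (S \<sigma>) / B)"
        using mpos B' by (intro ln_mono) auto
      then show ?thesis using y(7) by linarith
    qed
    moreover have "D * ln q \<le> ln (B' * measure \<mu> (cball x (4 * t)))"
    proof -
      have "S (\<sigma> @ \<zeta>) ` ?J \<subseteq> cball x (4 * t)" using sub by (auto simp: s_def)
      then have "measure \<mu> (S (\<sigma> @ \<zeta>) ` ?J) \<le> measure \<mu> (cball x (4 * t))" by (intro measure_mono) auto
      then have "B * measure \<mu> (S (\<sigma> @ \<zeta>) ` ?J) \<le> B' * measure \<mu> (cball x (4 * t))"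
        using B(1) B' by (intro mult_mono) auto
      then have "ln (B * measure \<mu> (S (\<sigma> @ \<zeta>) ` ?J)) \<le> ln (B' * measure \<mu> (cball x (4 * t)))"
        using measure_word_image_pos B(1) by (intro ln_mono) auto
      then show ?thesis using y(8) by linarith
    qed
    ultimately show ?thesis using y(1-4) by blast
  qed
  then show ?thesis using that[OF B'(2)] by blast
qed

end

text \<open>The bounds \<open>F (4 * t)\<close> and \<open>F t\<close> need not be close to each
  other. One of them is placed where \<open>F\<close> is near its upper or lower limit; the other is
  controlled by the definition of that limit.\<close>

lemma Limsup_Liminf_in_closure:
  fixes F :: "real \<Rightarrow> real" and T :: "real set"
  assumes bound: "\<forall>\<^sub>F t in at_right 0. 0 \<le> F t \<and> F t \<le> A"
    and approx: "\<And>e. e > 0 \<Longrightarrow> \<exists>\<delta>>0. \<forall>t. 0 < t \<and> t < \<delta> \<longrightarrow> (\<exists>D\<in>T. F (4 * t) - e \<le> D \<and> D \<le> F t + e)"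
  shows "Limsup (at_right 0) (\<lambda>t. ereal (F t)) \<in> closure (ereal ` T)"
    and "Liminf (at_right 0) (\<lambda>t. ereal (F t)) \<in> closure (ereal ` T)"
proof -
  let ?sup = "Limsup (at_right 0) (\<lambda>t. ereal (F t))" and ?inf = "Liminf (at_right 0) (\<lambda>t. ereal (F t))"
  have nt: "at_right (0::real) \<noteq> bot" by simp
  have b0: "\<forall>\<^sub>F t in at_right 0. 0 \<le> ereal (F t)" and bA: "\<forall>\<^sub>F t in at_right 0. ereal (F t) \<le> ereal A"
    using bound by (auto elim: eventually_mono)
  have "0 \<le> ?inf" using b0 by (rule Liminf_bounded)
  moreover have le: "?inf \<le> ?sup" by (rule Liminf_le_Limsup[OF nt])
  moreover have "?sup \<le> ereal A" using bA by (rule Limsup_bounded)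
  ultimately have "\<bar>?sup\<bar> \<noteq> \<infinity>" "\<bar>?inf\<bar> \<noteq> \<infinity>" by auto
  then obtain \<alpha> \<beta> where \<alpha>: "?sup = ereal \<alpha>" and \<beta>: "?inf = ereal \<beta>" by (metis ereal_real')
  have closure: "ereal \<gamma> \<in> closure (ereal ` T)" if "\<And>e. e > 0 \<Longrightarrow> \<exists>D\<in>T. \<bar>D - \<gamma>\<bar> < e" for \<gamma>
  proof -
    have "\<gamma> \<in> closure T" using that by (simp add: closure_approachable dist_real_def)
    moreover have "ereal ` closure T \<subseteq> closure (ereal ` T)"
      by (rule image_closure_subset) (auto intro: continuous_on_ereal closure_subset[THEN subsetD])
    ultimately show ?thesis by blast
  qed
  have "\<exists>D\<in>T. \<bar>D - \<alpha>\<bar> < e" if e: "e > 0" for e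
  proof -
    define e' where "e' = e / 3"
    have e': "e' > 0" using e by (simp add: e'_def)
    obtain \<delta>1 where \<delta>1: "\<delta>1 > 0" "\<And>t. 0 < t \<Longrightarrow> t < \<delta>1 \<Longrightarrow> \<exists>D\<in>T. F (4 * t) - e' \<le> D \<and> D \<le> F t + e'"
      using approx[OF e'] by blast
    have "\<forall>\<^sub>F t in at_right 0. ereal (F t) < ereal (\<alpha> + e')" using e' by (intro Limsup_lessD) (simp add: \<alpha>)
    then obtain \<delta>2 where \<delta>2: "\<delta>2 > 0" "\<And>t. 0 < t \<Longrightarrow> t < \<delta>2 \<Longrightarrow> F t < \<alpha> + e'"
      by (auto simp: eventually_at_right_field)
    have "\<exists>t>0. t < min \<delta>1 \<delta>2 \<and> \<alpha> - e' < F t"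
    proof (rule ccontr)
      assume "\<not> ?thesis"
      then have "F t \<le> \<alpha> - e'" if "0 < t" "t < min \<delta>1 \<delta>2" for t using that by (meson not_le)
      then have "\<forall>\<^sub>F t in at_right 0. ereal (F t) \<le> ereal (\<alpha> - e')"
        unfolding eventually_at_right_field using \<delta>1(1) \<delta>2(1) by (intro exI[of _ "min \<delta>1 \<delta>2"]) simp
      then have "?sup \<le> ereal (\<alpha> - e')" by (rule Limsup_bounded)
      then show False using e' by (simp add: \<alpha>)
    qed
    then obtain t where t: "t > 0" "t < \<delta>1" "t < \<delta>2" "\<alpha> - e' < F t" by auto
    \<comment> \<open>At scale \<open>t / 4\<close> the lower bound becomes \<open>F t\<close>,
      which is near \<open>\<alpha>\<close>, while \<open>F (t / 4)\<close> is below
      \<open>\<alpha> + e'\<close>.\<close>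
    obtain D where "D \<in> T" "F (4 * (t / 4)) - e' \<le> D" "D \<le> F (t / 4) + e'" using \<delta>1(2)[of "t / 4"] t by auto
    moreover have "F (t / 4) < \<alpha> + e'" using \<delta>2(2)[of "t / 4"] t by simp
    ultimately have "\<alpha> - 2 * e' < D" "D < \<alpha> + 2 * e'" using t(4) by simp_all
    then have "\<bar>D - \<alpha>\<bar> < e" using e by (simp add: e'_def abs_less_iff)
    then show ?thesis using \<open>D \<in> T\<close> by blast
  qed
  then show "?sup \<in> closure (ereal ` T)" unfolding \<alpha> by (rule closure)
  have "\<exists>D\<in>T. \<bar>D - \<beta>\<bar> < e" if e: "e > 0" for e
  proof -
    define e' where "e' = e / 3"
    have e': "e' > 0" using e by (simp add: e'_def)
    obtain \<delta>1 where \<delta>1: "\<delta>1 > 0" "\<And>t. 0 < t \<Longrightarrow> t < \<delta>1 \<Longrightarrow> \<exists>D\<in>T. F (4 * t) - e' \<le> D \<and> D \<le> F t + e'"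
      using approx[OF e'] by blast
    have "\<forall>\<^sub>F t in at_right 0. ereal (\<beta> - e') < ereal (F t)" using e' by (intro less_LiminfD) (simp add: \<beta>)
    then obtain \<delta>2 where \<delta>2: "\<delta>2 > 0" "\<And>t. 0 < t \<Longrightarrow> t < \<delta>2 \<Longrightarrow> \<beta> - e' < F t"
      by (auto simp: eventually_at_right_field)
    \<comment> \<open>\<open>\<delta>2 / 4\<close> keeps \<open>4 * t\<close> in the range where
      \<open>F\<close> is above \<open>\<beta> - e'\<close>.\<close>
    have "\<exists>t>0. t < min \<delta>1 (\<delta>2 / 4) \<and> F t < \<beta> + e'"
    proof (rule ccontr)
      assume "\<not> ?thesis"
      then have "\<beta> + e' \<le> F t" if "0 < t" "t < min \<delta>1 (\<delta>2 / 4)" for t using that by (meson not_le)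
      then have "\<forall>\<^sub>F t in at_right 0. ereal (\<beta> + e') \<le> ereal (F t)"
        unfolding eventually_at_right_field using \<delta>1(1) \<delta>2(1) by (intro exI[of _ "min \<delta>1 (\<delta>2 / 4)"]) simp
      then have "ereal (\<beta> + e') \<le> ?inf" by (rule Liminf_bounded)
      then show False using e' by (simp add: \<beta>)
    qed
    then obtain t where t: "t > 0" "t < \<delta>1" "t < \<delta>2 / 4" "F t < \<beta> + e'" by auto
    obtain D where "D \<in> T" "F (4 * t) - e' \<le> D" "D \<le> F t + e'" using \<delta>1(2)[of t] t by auto
    moreover have "\<beta> - e' < F (4 * t)" using \<delta>2(2)[of "4 * t"] t by simp
    ultimately have "\<beta> - 2 * e' < D" "D < \<beta> + 2 * e'" using t(4) by simp_all
    then have "\<bar>D - \<beta>\<bar> < e" using e by (simp add: e'_def abs_less_iff)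
    then show ?thesis using \<open>D \<in> T\<close> by blast
  qed
  then show "?inf \<in> closure (ereal ` T)" unfolding \<beta> by (rule closure)
qed

context centred_ssm
begin

text \<open>With \<open>a\<close> the largest \<open>ln (p i) / ln \<bar>r i\<bar>\<close>, the
  weight of a word is at least the power \<open>a\<close> of the modulus of its ratio. This keeps
  the local dimensions finite.\<close>

lemma ln_measure_cball_ge:
  obtains a where "a \<ge> 0" "\<And>x t. x \<in> K \<Longrightarrow> 0 < t \<Longrightarrow> t \<le> 1 \<Longrightarrow> a * (ln t + ln rmin) \<le> ln (measure \<mu> (cball x t))"
proof -
  define a where "a = Max (range (\<lambda>i. ln (p i) / ln \<bar>r i\<bar>))"
  have ln_r: "ln \<bar>r i\<bar> < 0" for i using r_bounds[of i] by simp
  have a_ge: "ln (p i) / ln \<bar>r i\<bar> \<le> a" for i unfolding a_def by (rule Max_ge) auto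
  have "0 \<le> ln (p i) / ln \<bar>r i\<bar>" for i using ln_r[of i] p_le_1[of i] p_pos[of i] by (intro divide_nonpos_neg) auto
  then have a: "a \<ge> 0" using a_ge by (meson order.trans)
  have W_ge: "a * ln \<bar>R \<sigma>\<bar> \<le> ln (W \<sigma>)" for \<sigma>
  proof (induction \<sigma>)
    case (Cons i \<sigma>)
    have "a * ln \<bar>r i\<bar> \<le> ln (p i)" using a_ge[of i] ln_r[of i] by (simp add: neg_divide_le_eq)
    then show ?case using Cons p_pos[of i] W_pos[of \<sigma>] r_neq_0[of i]
      by (simp add: ln_mult abs_mult distrib_left less_imp_neq[THEN not_sym])
  qed simp
  have "a * (ln t + ln rmin) \<le> ln (measure \<mu> (cball x t))" if xt: "x \<in> K" "0 < t" "t \<le> 1" for x t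
  proof -
    obtain \<rho> where \<rho>: "\<rho> \<in> Lam t" "W \<rho> \<le> measure \<mu> (cball x t)" by (rule measure_cball_ge[OF xt(1,2)])
    have "ln (t * rmin) \<le> ln \<bar>R \<rho>\<bar>" using Lam_R_lower[OF \<rho>(1) xt(2,3)] xt rmin by (intro ln_mono) auto
    then have "a * (ln t + ln rmin) \<le> a * ln \<bar>R \<rho>\<bar>" using a xt rmin(2) by (intro mult_left_mono) (simp_all add: ln_mult)
    also have "\<dots> \<le> ln (W \<rho>)" by (rule W_ge)
    also have "\<dots> \<le> ln (measure \<mu> (cball x t))" using \<rho>(2) W_pos by (intro ln_mono) auto
    finally show ?thesis .
  qed
  then show ?thesis using that a by blast
qed

lemma local_dims_in_closure:
  assumes x: "x \<in> K_ess r d K" and N: "\<And>x t. t > 0 \<Longrightarrow> card (M t (ball x t)) \<le> N"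
  shows "upper_local_dim \<mu> x \<in> closure (ereal ` {D. \<exists>y\<in>periodic_points r d K. has_local_dim \<mu> y (ereal D)})"
    and "lower_local_dim \<mu> x \<in> closure (ereal ` {D. \<exists>y\<in>periodic_points r d K. has_local_dim \<mu> y (ereal D)})"
proof -
  let ?T = "{D. \<exists>y\<in>periodic_points r d K. has_local_dim \<mu> y (ereal D)}"
  have xK: "x \<in> K" using x by (simp add: K_ess_def)
  define F where "F t = ln (measure \<mu> (cball x t)) / ln t" for t
  obtain a where a: "a \<ge> 0" "\<And>t. 0 < t \<Longrightarrow> t \<le> 1 \<Longrightarrow> a * (ln t + ln rmin) \<le> ln (measure \<mu> (cball x t))"
    using ln_measure_cball_ge xK by metis
  \<comment> \<open>For \<open>ln t \<le> -1\<close> the constant \<open>- ln rmin\<close> is at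
    most \<open>- ln rmin * - ln t\<close>, so it can be absorbed into the slope.\<close>
  define A where "A = a * (1 - ln rmin)"
  have ln_rmin: "ln rmin \<le> 0" using rmin by simp
  have A: "A \<ge> 0" using a ln_rmin by (simp add: A_def)
  define m where "m t = - ln (measure \<mu> (cball x t))" for t
  have mpos: "measure \<mu> (cball x t) > 0" if "t > 0" for t
    using measure_cball_ge[OF xK that] W_pos by (metis less_le_trans)
  have m0: "0 \<le> m t" if "t > 0" for t using mpos[OF that] prob_le_1 by (simp add: m_def)
  have mA: "m t \<le> A * - ln t" if "t > 0" "ln t \<le> -1" for t
  proof -
    have "t \<le> 1" using that by (metis ln_le_zero_iff neg_le_0_iff_le order.trans zero_le_one)
    then have "m t \<le> a * (- ln t - ln rmin)" using a(2)[OF that(1)] by (simp add: m_def algebra_simps)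
    also have "\<dots> \<le> a * ((1 - ln rmin) * - ln t)"
    proof (intro mult_left_mono a(1))
      have "- ln rmin * 1 \<le> - ln rmin * - ln t" using ln_rmin that by (intro mult_left_mono) auto
      then show "- ln t - ln rmin \<le> (1 - ln rmin) * - ln t" by (simp add: algebra_simps)
    qed
    finally show ?thesis by (simp add: A_def)
  qed
  have F_eq: "F t = m t / - ln t" for t by (simp add: F_def m_def)
  have bound: "\<forall>\<^sub>F t in at_right 0. 0 \<le> F t \<and> F t \<le> A"
    unfolding eventually_at_right_field
  proof (intro exI[of _ "exp (-1)"] conjI allI impI)
    fix t :: real assume t: "0 < t" "t < exp (- 1)"
    have ln: "ln t \<le> -1" using t by (metis ln_exp ln_less_cancel_iff exp_gt_zero less_imp_le)
    show "0 \<le> F t" unfolding F_eq using m0[OF t(1)] ln by (intro divide_nonneg_nonneg) auto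
    show "F t \<le> A" unfolding F_eq using mA[OF t(1) ln] ln by (subst pos_divide_le_eq) auto
  qed simp
  obtain B where B: "B \<ge> 1" "\<And>t. 0 < t \<Longrightarrow> t < 1 / B \<Longrightarrow> \<exists>y\<in>periodic_points r d K. \<exists>D q.
    has_local_dim \<mu> y (ereal D) \<and> 0 < q \<and> q < 1 \<and> t / B \<le> q \<and> q \<le> B * t \<and>
    ln (measure \<mu> (cball x t) / B) \<le> D * ln q \<and> D * ln q \<le> ln (B * measure \<mu> (cball x (4 * t)))"
    using approximating_periodic_points[OF x N] by blast
  define b where "b = ln B"
  define h where "h = ln (4::real)"
  have b: "b \<ge> 0" and h: "h \<ge> 0" using B(1) by (simp_all add: b_def h_def)
  have approx: "\<exists>\<delta>>0. \<forall>t. 0 < t \<and> t < \<delta> \<longrightarrow> (\<exists>D\<in>?T. F (4 * t) - e \<le> D \<and> D \<le> F t + e)" if e: "e > 0" for e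
  proof -
    define E where "E = A * (h + b) + b"
    have E: "E \<ge> 0" "A * b + b \<le> E" using A b h by (simp_all add: E_def distrib_left)
    \<comment> \<open>The threshold for \<open>u = - ln t\<close>: above it
      \<open>t < 1 / B\<close>, the linear bound \<open>mA\<close> holds at \<open>t\<close> and at
      \<open>4 * t\<close>, and the error \<open>E / (u - b)\<close> is at most
      \<open>e\<close>.\<close>
    define X where "X = b + h + 1 + E / e"
    show ?thesis
    proof (intro exI[of _ "exp (- X)"] conjI allI impI)
      show "exp (- X) > 0" by simp
      fix t :: real assume "0 < t \<and> t < exp (- X)"
      then have t: "0 < t" "t < exp (- X)" by simp_all
      define u where "u = - ln t"
      have u: "u > X" using t ln_less_cancel_iff[of t "exp (- X)"] by (simp add: u_def)
      have Ee: "E / e \<ge> 0" using E e by simp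
      have u_bounds: "u > b" "u > h" "u - h \<ge> 1" "u \<ge> 1" using u b h Ee unfolding X_def by linarith+
      have "E / e \<le> u - b" using u h unfolding X_def by linarith
      then have err: "E / (u - b) \<le> e" using e u_bounds by (simp add: field_simps)
      have "t < 1 / B"
      proof -
        have "ln t < - b" using u_bounds by (simp add: u_def)
        then have "ln t < ln (1 / B)" using B(1) by (simp add: b_def ln_div)
        then show ?thesis using t B(1) by simp
      qed
      then obtain y D q where *: "y \<in> periodic_points r d K" "has_local_dim \<mu> y (ereal D)" "0 < q" "q < 1"
        "t / B \<le> q" "q \<le> B * t" "ln (measure \<mu> (cball x t) / B) \<le> D * ln q"
        "D * ln q \<le> ln (B * measure \<mu> (cball x (4 * t)))" using B(2)[OF t(1)] by blast
      define v where "v = - ln q"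
      have v: "v > 0" using * by (simp add: v_def)
      have vu: "\<bar>v - u\<bar> \<le> b"
      proof -
        have "ln (t / B) \<le> ln q" "ln q \<le> ln (B * t)" using * t B(1) by (auto intro: ln_mono)
        then have "ln t - b \<le> ln q" "ln q \<le> b + ln t" using t B(1) by (simp_all add: ln_div ln_mult b_def)
        then show ?thesis by (simp add: u_def v_def)
      qed
      have ln4: "- ln (4 * t) = u - h" using t by (simp add: ln_mult u_def h_def)
      have "- m t - b \<le> D * ln q" using *(7) mpos[OF t(1)] B(1) by (simp add: ln_div m_def b_def)
      then have "D * v \<le> m t + b" by (simp add: v_def)
      then have "D \<le> (m t + b) / v" using v by (simp add: pos_le_divide_eq)
      also have "\<dots> \<le> m t / u + (A * b + b) / (u - b)"
        using b u_bounds m0[OF t(1)] mA[OF t(1)] vu by (intro ratio_approx_upper) (auto simp: u_def)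
      also have "(A * b + b) / (u - b) \<le> E / (u - b)" using E u_bounds by (intro divide_right_mono) auto
      finally have D_up: "D \<le> F t + e" using err by (simp add: F_eq u_def)
      have t4: "4 * t > 0" using t by simp
      have "D * ln q \<le> b - m (4 * t)" using *(8) mpos[OF t4] B(1) by (simp add: ln_mult m_def b_def)
      then have "m (4 * t) - b \<le> D * v" by (simp add: v_def)
      then have D_low: "(m (4 * t) - b) / v \<le> D" using v by (simp add: pos_divide_le_eq)
      have "m (4 * t) \<le> A * (u - h)" using mA[OF t4] ln4 u_bounds by simp
      then have "m (4 * t) / (u - h) - (A * (h + b) + b) / (u - b) \<le> (m (4 * t) - b) / v"
        using b h u_bounds m0[OF t4] vu by (intro ratio_approx_lower) auto
      then have "F (4 * t) - E / (u - b) \<le> (m (4 * t) - b) / v" by (simp add: F_eq ln4 E_def)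
      then have "F (4 * t) - e \<le> D" using D_low err by linarith
      then show "\<exists>D\<in>?T. F (4 * t) - e \<le> D \<and> D \<le> F t + e" using D_up * by blast
    qed
  qed
  show "upper_local_dim \<mu> x \<in> closure (ereal ` ?T)" "lower_local_dim \<mu> x \<in> closure (ereal ` ?T)"
    using Limsup_Liminf_in_closure[OF bound approx] unfolding upper_local_dim_def lower_local_dim_def F_def by auto
qed

end

theorem theorem4p1:
  fixes r d p :: "'i::finite \<Rightarrow> real" and K :: "real set" and \<mu> :: "real measure"
  assumes "ifs r d"
    and "is_attractor r d K"
    and "\<nexists>x. K = {x}"
    and "convex hull K = {0..1}"
    and "weak_separation r d K"
    and "\<And>i. p i > 0"
    and "(\<Sum>i\<in>UNIV. p i) = 1"
    and "self_similar_measure r d p \<mu>"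
  shows "upper_local_dim \<mu> ` K_ess r d K
           \<subseteq> closure {s. \<exists>x\<in>periodic_points r d K. has_local_dim \<mu> x s}
       \<and> lower_local_dim \<mu> ` K_ess r d K
           \<subseteq> closure {s. \<exists>x\<in>periodic_points r d K. has_local_dim \<mu> x s}"
proof -
  interpret ifs_hull r d K using assms by unfold_locales
  obtain U t0 ts as bs where "centred_ifs r d K U t0 ts as bs"
    by (rule centred_ifs_exists[OF assms(5)])
  then interpret centred_ifs r d K U t0 ts as bs .
  interpret centred_ssm r d K U t0 ts as bs p \<mu> using assms by unfold_locales
  obtain N where N: "\<And>x t. t > 0 \<Longrightarrow> card (M t (ball x t)) \<le> N"
    using assms(5) unfolding weak_separation_def by blast
  have "closure (ereal ` {D. \<exists>y\<in>periodic_points r d K. has_local_dim \<mu> y (ereal D)})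
      \<subseteq> closure {s. \<exists>x\<in>periodic_points r d K. has_local_dim \<mu> x s}"
    by (rule closure_mono) auto
  then show ?thesis using local_dims_in_closure[OF _ N] by blast
qed

end
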